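(* Let $(R,\mathfrak{m},F)$ be a commutative local ring with residue field $F=R/\mathfrak{m}\neq\mathbb{F}_2$. Then the Witt group $W(R)$ of inner product spaces over $R$ is, as an abelian group, generated by the elements $\langle a\rangle$, with $a\in R^*$, subject to the following three (families of defining) relations: (1) for all $a,b\in R^*$: $\langle a^2b\rangle=\langle b\rangle$; (2) for all $a\in R^*$: $\langle a\rangle+\langle -a\rangle=0$; (3) for all $a,b\in R^*$ with $a+b\in R^*$: $\langle a\rangle+\langle b\rangle=\langle a+b\rangle+\langle (a+b)ab\rangle$.
   Context: An inner product space over a commutative ring $R$ is a finitely generated projective $R$-module $V$ equipped with a non-degenerate symmetric $R$-bilinear form $\mathfrak{b}:V\times V\to R$. $GW(R)$ is the Grothendieck group of the abelian monoid of isometry classes of inner product spaces over $R$ under orthogonal sum, with ring structure induced by tensor product. For $a\in R^*$, $\langle a\rangle$ denotes the class of the rank one inner product space $R$ with form $\mathfrak{b}(x,y)=axy$. The Witt ring $W(R)$ is the quotient of $GW(R)$ by the ideal generated by $h=\langle 1\rangle+\langle -1\rangle$. *)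

theory Defs
  imports "HOL-Algebra.Algebra" "HOL-Number_Theory.Residues"
begin

section \<open>Local rings and modules\<close>

locale local_ring = cring R + maximalideal \<mm> R for \<mm> and R (structure) +
  assumes unique_maximal: "maximalideal I R \<Longrightarrow> I = \<mm>"

definition linear_maps ::
  "('a, 'r) ring_scheme \<Rightarrow> ('a, 'b, 'm) module_scheme \<Rightarrow> ('a, 'c, 'n) module_scheme \<Rightarrow> ('b \<Rightarrow> 'c) set"
  where "linear_maps R M N =
    {f \<in> hom (add_monoid M) (add_monoid N).
       \<forall>a\<in>carrier R. \<forall>x\<in>carrier M. f (a \<odot>\<^bsub>M\<^esub> x) = a \<odot>\<^bsub>N\<^esub> f x}"

definition bilinear_map ::
  "('a, 'r) ring_scheme \<Rightarrow> ('a, 'b, 'm) module_scheme \<Rightarrow> ('a, 'c, 'n) module_scheme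
    \<Rightarrow> ('a, 'd, 'k) module_scheme \<Rightarrow> ('b \<Rightarrow> 'c \<Rightarrow> 'd) \<Rightarrow> bool"
  where "bilinear_map R M N P t \<longleftrightarrow>
    (\<forall>x\<in>carrier M. (\<lambda>y. t x y) \<in> linear_maps R N P) \<and>
    (\<forall>y\<in>carrier N. (\<lambda>x. t x y) \<in> linear_maps R M P)"

definition self_module :: "('a, 'r) ring_scheme \<Rightarrow> ('a, 'a) module"
  where "self_module R =
    \<lparr>carrier = carrier R, monoid.mult = monoid.mult R, one = \<one>\<^bsub>R\<^esub>,
     ring.zero = \<zero>\<^bsub>R\<^esub>, add = add R, smult = monoid.mult R\<rparr>"

definition dual :: "('a, 'r) ring_scheme \<Rightarrow> ('a, 'b, 'm) module_scheme \<Rightarrow> ('b \<Rightarrow> 'a) set"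
  where "dual R M = linear_maps R M (self_module R) \<inter> extensional (carrier M)"

definition finitely_generated :: "('a, 'r) ring_scheme \<Rightarrow> ('a, 'b, 'm) module_scheme \<Rightarrow> bool"
  where "finitely_generated R M \<longleftrightarrow>
    (\<exists>A. finite A \<and> A \<subseteq> carrier M \<and>
      (\<forall>x\<in>carrier M. \<exists>c\<in>A \<rightarrow> carrier R. x = (\<Oplus>\<^bsub>M\<^esub>a\<in>A. c a \<odot>\<^bsub>M\<^esub> a)))"

text \<open>
  The lifting property. HOL cannot quantify over the carrier types of the test modules, so they
  are placed on \<^typ>\<open>nat \<Rightarrow> 'a\<close>. This type holds a copy of every finitely generated module over a
  ring on \<^typ>\<open>'a\<close> (pick one preimage in \<open>R\<^sup>n\<close> of each element). For a finitely generated \<open>M\<close> this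
  loses nothing: a surjection \<open>R\<^sup>n \<rightarrow> M\<close> is, up to isomorphism, one of the tests.
\<close>

definition projective_module :: "('a, 'r) ring_scheme \<Rightarrow> ('a, 'b, 'm) module_scheme \<Rightarrow> bool"
  where "projective_module R M \<longleftrightarrow>
    (\<forall>(N :: ('a, nat \<Rightarrow> 'a) module) (N' :: ('a, nat \<Rightarrow> 'a) module).
       \<forall>g\<in>linear_maps R N N'. \<forall>f\<in>linear_maps R M N'.
         module R N \<and> module R N' \<and> g ` carrier N = carrier N'
         \<longrightarrow> (\<exists>h\<in>linear_maps R M N. \<forall>x\<in>carrier M. g (h x) = f x))"


section \<open>Inner product spaces\<close>

text \<open>
  As for any \<^typ>\<open>('a, 'b) module\<close>, the fields \<open>mult\<close> and \<open>one\<close> play no role.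
\<close>

record ('a, 'b) form_module = "('a, 'b) module" +
  form :: "'b \<Rightarrow> 'b \<Rightarrow> 'a"

text \<open>
  Non-degenerate means that \<open>v \<mapsto> form v _\<close> is an isomorphism onto the dual module, not merely
  injective.
\<close>

locale inner_product_space = module R V for R (structure) and V :: "('a, 'b, 'v) form_module_scheme" +
  assumes finitely_generated: "finitely_generated R V"
    and projective: "projective_module R V"
    and bilinear: "bilinear_map R V V (self_module R) (form V)"
    and symmetric: "\<lbrakk>v \<in> carrier V; w \<in> carrier V\<rbrakk> \<Longrightarrow> form V v w = form V w v"
    and nondegenerate: "bij_betw (\<lambda>v. \<lambda>w\<in>carrier V. form V v w) (carrier V) (dual R V)"

definition isometric ::
  "('a, 'r) ring_scheme \<Rightarrow> ('a, 'b, 'v) form_module_scheme \<Rightarrow> ('a, 'c, 'w) form_module_scheme \<Rightarrow> bool"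
  where "isometric R V W \<longleftrightarrow>
    (\<exists>f\<in>linear_maps R V W. bij_betw f (carrier V) (carrier W) \<and>
       (\<forall>x\<in>carrier V. \<forall>y\<in>carrier V. form W (f x) (f y) = form V x y))"

text \<open>
  Isometry classes are formed among the spaces carried by \<^typ>\<open>nat \<Rightarrow> 'a\<close>; every inner product
  space is isometric to one of these.
\<close>

definition isometry_class ::
  "('a, 'r) ring_scheme \<Rightarrow> ('a, 'b, 'v) form_module_scheme \<Rightarrow> ('a, nat \<Rightarrow> 'a) form_module set"
  where "isometry_class R V = {U. inner_product_space R U \<and> isometric R V U}"

definition rank_one_space :: "('a, 'r) ring_scheme \<Rightarrow> 'a \<Rightarrow> ('a, 'a) form_module"
  where "rank_one_space R a =
    \<lparr>carrier = carrier R, monoid.mult = monoid.mult R, one = \<one>\<^bsub>R\<^esub>,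
     ring.zero = \<zero>\<^bsub>R\<^esub>, add = add R, smult = monoid.mult R,
     form = \<lambda>x y. a \<otimes>\<^bsub>R\<^esub> x \<otimes>\<^bsub>R\<^esub> y\<rparr>"

definition zero_space :: "('a, 'r) ring_scheme \<Rightarrow> ('a, unit) form_module"
  where "zero_space R =
    \<lparr>carrier = {()}, monoid.mult = \<lambda>_ _. (), one = (),
     ring.zero = (), add = \<lambda>_ _. (), smult = \<lambda>_ _. (),
     form = \<lambda>_ _. \<zero>\<^bsub>R\<^esub>\<rparr>"

definition orthogonal_sum ::
  "('a, 'r) ring_scheme \<Rightarrow> ('a, 'b, 'v) form_module_scheme \<Rightarrow> ('a, 'c, 'w) form_module_scheme
    \<Rightarrow> ('a, 'b \<times> 'c) form_module"
  where "orthogonal_sum R V W =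
    \<lparr>carrier = carrier V \<times> carrier W,
     monoid.mult = \<lambda>(v, w) (v', w'). (v \<otimes>\<^bsub>V\<^esub> v', w \<otimes>\<^bsub>W\<^esub> w'), one = (\<one>\<^bsub>V\<^esub>, \<one>\<^bsub>W\<^esub>),
     ring.zero = (\<zero>\<^bsub>V\<^esub>, \<zero>\<^bsub>W\<^esub>),
     add = \<lambda>(v, w) (v', w'). (v \<oplus>\<^bsub>V\<^esub> v', w \<oplus>\<^bsub>W\<^esub> w'),
     smult = \<lambda>a (v, w). (a \<odot>\<^bsub>V\<^esub> v, a \<odot>\<^bsub>W\<^esub> w),
     form = \<lambda>(v, w) (v', w'). form V v v' \<oplus>\<^bsub>R\<^esub> form W w w'\<rparr>"

text \<open>
  \<open>T\<close> is a tensor product of \<open>V\<close> and \<open>W\<close>: it carries a universal bilinear map, written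
  \<open>v \<otimes> w\<close> here, and its form satisfies
  \<open>form (v \<otimes> w) (v' \<otimes> w') = form v v' * form w w'\<close>.
  The test modules are again on \<^typ>\<open>nat \<Rightarrow> 'a\<close>, which is enough for finitely generated
  \<open>V\<close>, \<open>W\<close>, \<open>T\<close>: a bilinear map out of \<open>V \<times> W\<close> takes values in a finitely generated submodule.
\<close>

definition tensor_product ::
  "('a, 'r) ring_scheme \<Rightarrow> ('a, 'b, 'v) form_module_scheme \<Rightarrow> ('a, 'c, 'w) form_module_scheme
    \<Rightarrow> ('a, 'd, 't) form_module_scheme \<Rightarrow> bool"
  where "tensor_product R V W T \<longleftrightarrow>
    (\<exists>t. bilinear_map R V W T t \<and>
       (\<forall>(N :: ('a, nat \<Rightarrow> 'a) module) s. module R N \<and> bilinear_map R V W N s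
          \<longrightarrow> (\<exists>!h. h \<in> linear_maps R T N \<inter> extensional (carrier T) \<and>
                 (\<forall>v\<in>carrier V. \<forall>w\<in>carrier W. h (t v w) = s v w))) \<and>
       (\<forall>v\<in>carrier V. \<forall>v'\<in>carrier V. \<forall>w\<in>carrier W. \<forall>w'\<in>carrier W.
          form T (t v w) (t v' w') = form V v v' \<otimes>\<^bsub>R\<^esub> form W w w'))"

definition isometry_semiring ::
  "('a, 'r) ring_scheme \<Rightarrow> (('a, nat \<Rightarrow> 'a) form_module set) ring"
  where "isometry_semiring R =
    \<lparr>carrier = {isometry_class R V | V :: ('a, nat \<Rightarrow> 'a) form_module. inner_product_space R V},
     monoid.mult = \<lambda>A B. {T. inner_product_space R T \<and> (\<exists>V\<in>A. \<exists>W\<in>B. tensor_product R V W T)},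
     one = isometry_class R (rank_one_space R \<one>\<^bsub>R\<^esub>),
     ring.zero = isometry_class R (zero_space R),
     add = \<lambda>A B. \<Union>V\<in>A. \<Union>W\<in>B. isometry_class R (orthogonal_sum R V W)\<rparr>"


section \<open>Grothendieck-Witt and Witt rings\<close>

text \<open>The pair \<open>(a, b)\<close> stands for the formal difference \<open>a - b\<close>.\<close>

definition grothendieck_rel :: "('a, 's) ring_scheme \<Rightarrow> (('a \<times> 'a) \<times> ('a \<times> 'a)) set"
  where "grothendieck_rel S =
    {((a, b), (c, d)). a \<in> carrier S \<and> b \<in> carrier S \<and> c \<in> carrier S \<and> d \<in> carrier S \<and>
       (\<exists>k\<in>carrier S. a \<oplus>\<^bsub>S\<^esub> d \<oplus>\<^bsub>S\<^esub> k = c \<oplus>\<^bsub>S\<^esub> b \<oplus>\<^bsub>S\<^esub> k)}"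

definition formal_difference :: "('a, 's) ring_scheme \<Rightarrow> 'a \<Rightarrow> 'a \<Rightarrow> ('a \<times> 'a) set"
  where "formal_difference S a b = grothendieck_rel S `` {(a, b)}"

definition grothendieck_ring :: "('a, 's) ring_scheme \<Rightarrow> (('a \<times> 'a) set) ring"
  where "grothendieck_ring S =
    \<lparr>carrier = (carrier S \<times> carrier S) // grothendieck_rel S,
     monoid.mult = \<lambda>A B. \<Union>(a, b)\<in>A. \<Union>(c, d)\<in>B.
       formal_difference S (a \<otimes>\<^bsub>S\<^esub> c \<oplus>\<^bsub>S\<^esub> b \<otimes>\<^bsub>S\<^esub> d) (a \<otimes>\<^bsub>S\<^esub> d \<oplus>\<^bsub>S\<^esub> b \<otimes>\<^bsub>S\<^esub> c),
     one = formal_difference S \<one>\<^bsub>S\<^esub> \<zero>\<^bsub>S\<^esub>,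
     ring.zero = formal_difference S \<zero>\<^bsub>S\<^esub> \<zero>\<^bsub>S\<^esub>,
     add = \<lambda>A B. \<Union>(a, b)\<in>A. \<Union>(c, d)\<in>B.
       formal_difference S (a \<oplus>\<^bsub>S\<^esub> c) (b \<oplus>\<^bsub>S\<^esub> d)\<rparr>"

type_synonym 'a gw = "(('a, nat \<Rightarrow> 'a) form_module set \<times> ('a, nat \<Rightarrow> 'a) form_module set) set"

definition GW :: "('a, 'r) ring_scheme \<Rightarrow> 'a gw ring"
  where "GW R = grothendieck_ring (isometry_semiring R)"

definition GW_class :: "('a, 'r) ring_scheme \<Rightarrow> 'a \<Rightarrow> 'a gw"
  where "GW_class R a =
    formal_difference (isometry_semiring R)
      (isometry_class R (rank_one_space R a)) \<zero>\<^bsub>isometry_semiring R\<^esub>"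

definition hyperbolic_ideal :: "('a, 'r) ring_scheme \<Rightarrow> 'a gw set"
  where "hyperbolic_ideal R =
    Idl\<^bsub>GW R\<^esub> {GW_class R \<one>\<^bsub>R\<^esub> \<oplus>\<^bsub>GW R\<^esub> GW_class R (\<ominus>\<^bsub>R\<^esub> \<one>\<^bsub>R\<^esub>)}"

definition Witt_ring :: "('a, 'r) ring_scheme \<Rightarrow> 'a gw set ring"
  where "Witt_ring R = GW R Quot hyperbolic_ideal R"

definition Witt_class :: "('a, 'r) ring_scheme \<Rightarrow> 'a \<Rightarrow> 'a gw set"
  where "Witt_class R a = hyperbolic_ideal R +>\<^bsub>GW R\<^esub> GW_class R a"


section \<open>Presentations of abelian groups\<close>

text \<open>
  \<open>G\<close> is the abelian group generated by the \<open>g s\<close>, \<open>s \<in> S\<close>, subject to the relations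
  \<open>r = 0\<close> for \<open>r \<in> Rels\<close>, where a relator \<open>r\<close> is an element of the free abelian group on \<open>S\<close>.
  The homomorphism \<open>\<phi>\<close> is determined by \<open>g\<close>.
\<close>

definition abelian_presentation ::
  "('g, 'k) monoid_scheme \<Rightarrow> 's set \<Rightarrow> ('s \<Rightarrow> 'g) \<Rightarrow> ('s \<Rightarrow>\<^sub>0 int) set \<Rightarrow> bool"
  where "abelian_presentation G S g Rels \<longleftrightarrow>
    comm_group G \<and> Rels \<subseteq> carrier (free_Abelian_group S) \<and>
    (\<exists>\<phi>\<in>hom (free_Abelian_group S) G.
       (\<forall>s\<in>S. \<phi> (frag_of s) = g s) \<and>
       \<phi> ` carrier (free_Abelian_group S) = carrier G \<and>
       kernel (free_Abelian_group S) G \<phi> = generate (free_Abelian_group S) Rels)"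

end

theory Submission
  imports Defs "HOL-Library.Set_Algebras"
begin

text \<open>
  By Gram matrices, classes of inner product spaces over the local ring \<open>R\<close> add and multiply like
  symmetric matrices up to base change. A space is free, and once \<open>\<langle>1\<rangle>\<close> is added to it, it has an
  orthogonal basis; so every element of \<open>GW(R)\<close> is a difference of sums of classes \<open>\<langle>a\<rangle>\<close>.
  For the relations one shows that two orthogonal bases of the same space have the same image under
  every \<open>c\<close> that satisfies (1) and (3). Given a unit norm vector \<open>f\<close> written in the first basis,
  moves inside two-dimensional orthogonal summands, each an instance of (1) and (3), produce a basis
  containing \<open>f\<close>; then one passes to the orthogonal complement. Two cases need care.
  Over \<open>F\<^sub>3\<close> a two-dimensional move can be blocked, and it is only realised after adding \<open>\<langle>b\<rangle>\<close>.
  In residue characteristic 2 all partial sums of \<open>f\<close> may have non-unit norm; then either one more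
  basis vector outside the support of \<open>f\<close> unlocks the moves, or \<open>f\<close> is a characteristic vector
  and its complement has no vector of unit norm.
\<close>

subsection \<open>Local rings\<close>

text \<open>Relation (3) is a change of basis: orthogonal \<open>e\<close>, \<open>f\<close> become
  \<open>e + f\<close> and the vector orthogonal to it in their plane. With (1) it reaches
  \<open>e + x f\<close> for units \<open>x\<close>, provided that the new norm is a unit. Other
  vectors must be reached along a path of such changes, so all intermediate norms have to be units,
  and the residue field decides whether a path exists. For \<open>x\<close> in \<open>\<mm>\<close>
  a detour needs a unit \<open>y\<close> with \<open>a + b y^2\<close> a unit. At most two classes
  of \<open>y\<close> are bad, so four field elements suffice; with three elements
  \<open>a = - b\<close> blocks both classes, with two \<open>a = b = 1\<close> blocks the only one.
  Uniqueness is proved for every \<open>c\<close> subject to (1) and (3), not for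
  \<open>W(R)\<close>, because it is applied with \<open>c a\<close> the coset of the generator
  \<open>a\<close> modulo the relators: equality of isometry classes then becomes a consequence of
  the relators. Relation (2) enters only at the end, through the ideal generated by
  \<open>h\<close>.\<close>

context cring
begin

lemma Union_chain_ideal:
  assumes ne: "C \<noteq> {}" and id: "\<And>J. J \<in> C \<Longrightarrow> ideal J R"
    and ch: "\<And>J K. \<lbrakk>J \<in> C; K \<in> C\<rbrakk> \<Longrightarrow> J \<subseteq> K \<or> K \<subseteq> J"
  shows "ideal (\<Union>C) R"
proof (rule idealI)
  show "ring R" ..
  have sub: "J \<in> C \<Longrightarrow> subgroup J (add_monoid R)" for J
    using id ideal.axioms(1) additive_subgroup.a_subgroup by blast
  show "subgroup (\<Union>C) (add_monoid R)"
  proof (rule add.subgroupI)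
    show "\<Union>C \<subseteq> carrier R" using ideal.Icarr[OF id] by auto
    show "\<Union>C \<noteq> {}" using ne subgroup.one_closed[OF sub] by auto
    show "\<ominus> a \<in> \<Union>C" if "a \<in> \<Union>C" for a
      using that subgroup.m_inv_closed[OF sub] by (auto simp: a_inv_def)
    show "a \<oplus> b \<in> \<Union>C" if ab: "a \<in> \<Union>C" "b \<in> \<Union>C" for a b
    proof -
      obtain J K where JK: "J \<in> C" "K \<in> C" "a \<in> J" "b \<in> K" using ab by blast
      then obtain L where L: "L \<in> C" "a \<in> L" "b \<in> L" using ch by blast
      then have "a \<oplus> b \<in> L" using subgroup.m_closed[OF sub[OF L(1)] L(2,3)] by simp
      then show ?thesis using L by blast
    qed
  qed
  show "\<And>a x. a \<in> \<Union>C \<Longrightarrow> x \<in> carrier R \<Longrightarrow> x \<otimes> a \<in> \<Union>C"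
    using ideal.I_l_closed[OF id] by auto
  show "\<And>a x. a \<in> \<Union>C \<Longrightarrow> x \<in> carrier R \<Longrightarrow> a \<otimes> x \<in> \<Union>C"
    using ideal.I_r_closed[OF id] by auto
qed

text \<open>Zorn's lemma on the ideals that contain \<open>x\<close> but not 1. The locale
  \<open>local_ring\<close> speaks only of maximal ideals, and this is what lets
  \<open>Units_iff\<close> place every non-unit in \<open>\<mm>\<close>.\<close>

lemma nonunit_in_maximalideal:
  assumes x: "x \<in> carrier R" "x \<notin> Units R"
  obtains M where "maximalideal M R" "x \<in> M"
proof -
  let ?A = "{J. ideal J R \<and> \<one> \<notin> J \<and> x \<in> J}"
  have "PIdl x \<in> ?A"
  proof -
    have "\<one> \<notin> PIdl x"
    proof
      assume "\<one> \<in> PIdl x"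
      then obtain y where "y \<in> carrier R" "\<one> = y \<otimes> x" unfolding cgenideal_def by blast
      then show False using x by (metis Units_one_closed unit_factor m_comm)
    qed
    then show ?thesis using x cgenideal_ideal cgenideal_self by simp
  qed
  then have "?A \<noteq> {}" by blast
  then obtain M where M: "M \<in> ?A" "\<forall>J\<in>?A. M \<subseteq> J \<longrightarrow> J = M"
  proof (rule subset_Zorn_nonempty[THEN bexE])
    show "\<Union>C \<in> ?A" if "C \<noteq> {}" "subset.chain ?A C" for C
      using that Union_chain_ideal[of C] unfolding subset_chain_def by blast
  qed blast
  have "maximalideal M R"
  proof (rule maximalidealI)
    show "ideal M R" using M by blast
    show "carrier R \<noteq> M" using M by blast
    fix J assume J: "ideal J R" "M \<subseteq> J" "J \<subseteq> carrier R"
    then show "J = M \<or> J = carrier R"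
      using M ideal.one_imp_carrier by blast
  qed
  then show thesis using that M by blast
qed

end

context local_ring
begin

lemma Units_iff: "x \<in> Units R \<longleftrightarrow> x \<in> carrier R \<and> x \<notin> \<mm>"
proof
  assume x: "x \<in> Units R"
  then have "x \<notin> \<mm>"
    using I_notcarr one_imp_carrier I_r_closed[of x "inv x"] by auto
  then show "x \<in> carrier R \<and> x \<notin> \<mm>" using x by auto
qed (metis nonunit_in_maximalideal unique_maximal)

lemma nonunit: "x \<in> carrier R \<Longrightarrow> x \<notin> Units R \<Longrightarrow> x \<in> \<mm>"
  by (simp add: Units_iff)

text \<open>Being a unit depends only on the class modulo \<open>\<mm>\<close>. Most unit checks on
  norms below are instances of this.\<close>

lemma Units_add_nonunit:
  assumes "a \<in> Units R" "x \<in> \<mm>" shows "a \<oplus> x \<in> Units R"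
proof -
  have c: "a \<in> carrier R" "x \<in> carrier R" using assms by auto
  have "a \<in> \<mm>" if "a \<oplus> x \<in> \<mm>"
  proof -
    have "(a \<oplus> x) \<ominus> x \<in> \<mm>" using that assms(2) by (simp add: a_minus_def)
    moreover have "(a \<oplus> x) \<ominus> x = a" using c by algebra
    ultimately show ?thesis by simp
  qed
  then show ?thesis using assms c by (auto simp: Units_iff)
qed

lemma Units_minus: "a \<in> Units R \<Longrightarrow> \<ominus> a \<in> Units R"
  using Units_closed[of a] a_inv_closed[of "\<ominus> a"] by (auto simp: Units_iff)

lemma Units_mult_iff:
  "\<lbrakk>a \<in> carrier R; b \<in> carrier R\<rbrakk> \<Longrightarrow> a \<otimes> b \<in> Units R \<longleftrightarrow> a \<in> Units R \<and> b \<in> Units R"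
  using unit_factor[of a b] unit_factor[of b a] m_comm[of a b] by auto

end

text \<open>
  The values are kept in a monoid, with only the cancellation that is needed, because \<open>c\<close> will take
  values in cosets under elementwise addition of sets. The last assumption excludes the residue
  field \<open>F\<^sub>2\<close>.
\<close>

locale diagonal_invariant = local_ring \<mm> R for \<mm> and R (structure) +
  fixes c :: "'a \<Rightarrow> 'g::comm_monoid_add"
  assumes c_square: "\<lbrakk>a \<in> Units R; b \<in> Units R\<rbrakk> \<Longrightarrow> c (a \<otimes> a \<otimes> b) = c b"
    and c_add: "\<lbrakk>a \<in> Units R; b \<in> Units R; a \<oplus> b \<in> Units R\<rbrakk>
      \<Longrightarrow> c a + c b = c (a \<oplus> b) + c ((a \<oplus> b) \<otimes> a \<otimes> b)"
    and c_cancel: "\<lbrakk>a \<in> Units R; b \<in> Units R; a' \<in> Units R; b' \<in> Units R; d \<in> Units R;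
        c a + c b + c d = c a' + c b' + c d\<rbrakk> \<Longrightarrow> c a + c b = c a' + c b'"
    and residue_field: "\<exists>y\<in>Units R. y \<ominus> \<one> \<in> Units R"
begin

lemma c_eqI: "\<lbrakk>k \<in> Units R; b \<in> Units R; b' = k \<otimes> k \<otimes> b\<rbrakk> \<Longrightarrow> c b' = c b"
  by (simp add: c_square)

text \<open>Relation (3) for \<open>a\<close> and \<open>b x^2\<close>; relation (1) then drops
  \<open>x^2\<close> from the second entry and from the product on the right.\<close>

lemma c_add_unit_square:
  assumes a: "a \<in> Units R" and b: "b \<in> Units R" and x: "x \<in> Units R"
    and t: "a \<oplus> b \<otimes> x \<otimes> x \<in> Units R"
  shows "c a + c b = c (a \<oplus> b \<otimes> x \<otimes> x) + c ((a \<oplus> b \<otimes> x \<otimes> x) \<otimes> a \<otimes> b)"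
proof -
  let ?t = "a \<oplus> b \<otimes> x \<otimes> x"
  have C1 [simp]: "a \<in> carrier R" "b \<in> carrier R" "x \<in> carrier R" using a b x by auto
  have "c b = c (b \<otimes> x \<otimes> x)"
    by (rule sym, rule c_eqI[OF x b], insert C1, algebra)
  moreover have "c (?t \<otimes> a \<otimes> (b \<otimes> x \<otimes> x)) = c (?t \<otimes> a \<otimes> b)"
    by (rule c_eqI[OF x], use a b t in simp, insert C1, algebra)
  ultimately show ?thesis using c_add[OF a, of "b \<otimes> x \<otimes> x"] b x t by simp
qed

text \<open>
  For orthogonal \<open>e\<close>, \<open>f\<close> of norms \<open>a\<close>, \<open>b\<close>, the vector \<open>e + x f\<close> is reached through \<open>e + y f\<close>.
\<close>

lemma c_add_nonunit_via:
  assumes a: "a \<in> Units R" and b: "b \<in> Units R" and x: "x \<in> \<mm>"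
    and y: "y \<in> Units R" and s: "a \<oplus> b \<otimes> y \<otimes> y \<in> Units R"
  shows "c a + c b = c (a \<oplus> b \<otimes> x \<otimes> x) + c ((a \<oplus> b \<otimes> x \<otimes> x) \<otimes> a \<otimes> b)"
proof -
  define s where "s = a \<oplus> b \<otimes> y \<otimes> y"
  define t where "t = a \<oplus> b \<otimes> x \<otimes> x"
  define p where "p = a \<oplus> b \<otimes> x \<otimes> y"
  define q where "q = y \<ominus> x"
  have C1 [simp]: "a \<in> carrier R" "b \<in> carrier R" "x \<in> carrier R" "y \<in> carrier R" using a b x y by auto
  have tU: "t \<in> Units R" unfolding t_def using a x by (intro Units_add_nonunit) (auto simp: I_l_closed)
  have pU: "p \<in> Units R" unfolding p_def using a x by (intro Units_add_nonunit) (auto simp: I_l_closed I_r_closed)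
  have qU: "q \<in> Units R" unfolding q_def a_minus_def using y x by (intro Units_add_nonunit) auto
  have sU: "s \<in> Units R" unfolding s_def by (rule s)
  note U = a b y tU pU qU sU
  have C2 [simp]: "s \<in> carrier R" "t \<in> carrier R" "p \<in> carrier R" "q \<in> carrier R" using U by auto
  \<comment> \<open>In the orthogonal basis \<open>e + y f\<close>, \<open>- b y e + a f\<close>,
    whose norms are \<open>s\<close> and \<open>s a b\<close>, the vector \<open>s (e + x f)\<close>
    has coordinates \<open>p\<close> and \<open>- q\<close>. The identity computes its norm
    \<open>s^2 t\<close> as a sum of two units, so (3) applies to them.\<close>
  have sum: "s \<otimes> p \<otimes> p \<oplus> s \<otimes> a \<otimes> b \<otimes> q \<otimes> q = s \<otimes> s \<otimes> t"
  proof -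
    have "p \<otimes> p \<oplus> a \<otimes> b \<otimes> q \<otimes> q = s \<otimes> t"
      unfolding s_def t_def p_def q_def using C1 by algebra
    then have "s \<otimes> (p \<otimes> p \<oplus> a \<otimes> b \<otimes> q \<otimes> q) = s \<otimes> (s \<otimes> t)" by simp
    then show ?thesis by (simp add: r_distr m_assoc)
  qed
  have "c a + c b = c s + c (s \<otimes> a \<otimes> b)"
    using c_add_unit_square[OF a b y s] unfolding s_def .
  also have "c s = c (s \<otimes> p \<otimes> p)" by (rule sym, rule c_eqI[OF pU sU], simp add: m_ac)
  also have "c (s \<otimes> a \<otimes> b) = c (s \<otimes> a \<otimes> b \<otimes> q \<otimes> q)"
    by (rule sym, rule c_eqI[OF qU]) (use U in simp, insert C1 C2, algebra)
  also have "c (s \<otimes> p \<otimes> p) + c (s \<otimes> a \<otimes> b \<otimes> q \<otimes> q) =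
    c (s \<otimes> s \<otimes> t) + c (s \<otimes> s \<otimes> t \<otimes> (s \<otimes> p \<otimes> p) \<otimes> (s \<otimes> a \<otimes> b \<otimes> q \<otimes> q))"
    using c_add[of "s \<otimes> p \<otimes> p" "s \<otimes> a \<otimes> b \<otimes> q \<otimes> q"] U unfolding sum by simp
  also have "c (s \<otimes> s \<otimes> t) = c t" using sU tU by (rule c_square)
  also have "c (s \<otimes> s \<otimes> t \<otimes> (s \<otimes> p \<otimes> p) \<otimes> (s \<otimes> a \<otimes> b \<otimes> q \<otimes> q)) = c (t \<otimes> a \<otimes> b)"
    by (rule c_eqI[of "s \<otimes> s \<otimes> p \<otimes> q"]) (use U in simp, use U in simp, insert C1 C2, algebra)
  finally show ?thesis unfolding t_def .
qed

text \<open>Here \<open>b x^2\<close> is a non-unit, so (3) cannot be applied to \<open>a\<close>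
  and \<open>b x^2\<close> directly.\<close>

lemma c_add_nonunit:
  assumes a: "a \<in> Units R" and b: "b \<in> Units R" and x: "x \<in> \<mm>"
  shows "c a + c b = c (a \<oplus> b \<otimes> x \<otimes> x) + c ((a \<oplus> b \<otimes> x \<otimes> x) \<otimes> a \<otimes> b)"
proof (cases "\<exists>y\<in>Units R. a \<oplus> b \<otimes> y \<otimes> y \<in> Units R")
  case True
  then show ?thesis using c_add_nonunit_via[OF a b x] by blast
next
  case False
  \<comment> \<open>The residue field is \<open>F\<^sub>3\<close>: there \<open>\<langle>b\<rangle> + \<langle>b\<rangle> = \<langle>2b\<rangle> + \<langle>2b\<rangle>\<close>, and a unit \<open>y\<close> does exist for \<open>a\<close>, \<open>2b\<close>.
    So the identity is proved with \<open>c b\<close> added, splitting \<open>b x\<^sup>2\<close> into two equal steps, and \<open>c b\<close> is cancelled.\<close>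
  have C1 [simp]: "a \<in> carrier R" "b \<in> carrier R" "x \<in> carrier R" using a b x by auto
  have no: "a \<oplus> b \<otimes> y \<otimes> y \<in> \<mm>" if "y \<in> Units R" for y
    using False that by (intro nonunit) auto
  obtain y where y: "y \<in> Units R" "y \<ominus> \<one> \<in> Units R" using residue_field by blast
  have C2 [simp]: "y \<in> carrier R" using y by auto
  have ab: "a \<oplus> b \<in> \<mm>" using no[of \<one>] by simp
  define two where "two = \<one> \<oplus> \<one>"
  have C3 [simp]: "two \<in> carrier R" by (simp add: two_def)
  \<comment> \<open>Both \<open>a + b\<close> and \<open>a + b y^2\<close> lie in
    \<open>\<mm>\<close>, hence so does \<open>b (y - 1) (y + 1)\<close>. As \<open>y - 1\<close> is
    a unit, \<open>y\<close> is congruent to -1 and 2 is congruent to the unit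
    \<open>1 - y\<close>.\<close>
  have "y \<oplus> \<one> \<in> \<mm>"
  proof -
    have "(a \<oplus> b \<otimes> y \<otimes> y) \<ominus> (a \<oplus> b) \<in> \<mm>" using no[OF y(1)] ab by (simp add: a_minus_def)
    moreover have "(a \<oplus> b \<otimes> y \<otimes> y) \<ominus> (a \<oplus> b) = b \<otimes> (y \<ominus> \<one>) \<otimes> (y \<oplus> \<one>)" using C1 C2 C3 by algebra
    ultimately have "\<not> b \<otimes> (y \<ominus> \<one>) \<otimes> (y \<oplus> \<one>) \<in> Units R" by (simp add: Units_iff)
    then show ?thesis using b y by (intro nonunit) auto
  qed
  moreover have "two = \<ominus> (y \<ominus> \<one>) \<oplus> (y \<oplus> \<one>)" unfolding two_def using C1 C2 C3 by algebra
  ultimately have two: "two \<in> Units R" using y by (simp add: Units_add_nonunit Units_minus)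
  define h where "h = inv two"
  have hU: "h \<in> Units R" using two by (simp add: h_def)
  have C4 [simp]: "h \<in> carrier R" using hU by auto
  have h2: "two \<otimes> h = \<one>" using two by (simp add: h_def)
  \<comment> \<open>Since \<open>x = 2 z\<close>, the term \<open>b x^2\<close> is twice
    \<open>2 b z^2\<close>, and \<open>u\<close> below lies halfway between \<open>a\<close> and
    \<open>t\<close>.\<close>
  define z where "z = h \<otimes> x"
  have zm: "z \<in> \<mm>" unfolding z_def using x by (simp add: I_l_closed)
  have C5 [simp]: "z \<in> carrier R" using zm by auto
  have xz: "x = two \<otimes> z" unfolding z_def using h2 by (simp add: m_assoc[symmetric])
  define u where "u = a \<oplus> (two \<otimes> b) \<otimes> z \<otimes> z"
  define t where "t = a \<oplus> b \<otimes> x \<otimes> x"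
  have uU: "u \<in> Units R" unfolding u_def using a zm by (intro Units_add_nonunit) (auto simp: I_l_closed)
  have tU: "t \<in> Units R" unfolding t_def using a x by (intro Units_add_nonunit) (auto simp: I_l_closed)
  have C6 [simp]: "u \<in> carrier R" "t \<in> carrier R" using uU tU by auto
  have tu: "t = u \<oplus> (two \<otimes> b) \<otimes> z \<otimes> z" unfolding t_def u_def xz two_def using C1 C2 C3 C4 C5 C6 by algebra
  note U = a b two uU tU
  \<comment> \<open>Modulo \<open>\<mm>\<close>, \<open>a + 2 b\<close> is \<open>b\<close>. So with
    \<open>2 b\<close> in place of \<open>b\<close> the unit 1 already serves for the
    detour.\<close>
  have y1: "a \<oplus> (two \<otimes> b) \<otimes> \<one> \<otimes> \<one> \<in> Units R"
  proof -
    have "b \<oplus> (a \<oplus> b) = a \<oplus> (two \<otimes> b) \<otimes> \<one> \<otimes> \<one>" unfolding two_def using C1 C2 C3 C4 C5 C6 by algebra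
    then show ?thesis using Units_add_nonunit[OF b ab] by simp
  qed
  have y2: "u \<oplus> (two \<otimes> b) \<otimes> \<one> \<otimes> \<one> \<in> Units R"
  proof -
    have "(a \<oplus> (two \<otimes> b) \<otimes> \<one> \<otimes> \<one>) \<oplus> (two \<otimes> b) \<otimes> z \<otimes> z = u \<oplus> (two \<otimes> b) \<otimes> \<one> \<otimes> \<one>"
      unfolding u_def using C1 C2 C3 C4 C5 C6 by algebra
    then show ?thesis using Units_add_nonunit[OF y1, of "(two \<otimes> b) \<otimes> z \<otimes> z"] zm by (simp add: I_l_closed)
  qed
  have e1: "c a + c (two \<otimes> b) = c u + c (u \<otimes> a \<otimes> (two \<otimes> b))"
    using c_add_nonunit_via[OF a _ zm _ y1] U unfolding u_def by simp
  have e2: "c u + c (two \<otimes> b) = c t + c (t \<otimes> u \<otimes> (two \<otimes> b))"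
    using c_add_nonunit_via[OF uU _ zm _ y2] U unfolding tu by simp
  have bb: "b \<oplus> b = two \<otimes> b" unfolding two_def using C1 C2 C3 C4 C5 C6 by algebra
  have e3: "c b + c b = c (two \<otimes> b) + c (two \<otimes> b)"
  proof -
    have "c (two \<otimes> b \<otimes> b \<otimes> b) = c (two \<otimes> b)" by (rule c_eqI[OF b]) (use U in simp, insert C1 C2 C3 C4 C5 C6, algebra)
    then show ?thesis using c_add[OF b b] U by (simp add: bb)
  qed
  \<comment> \<open>As \<open>t + a = 2 u\<close>, the entries \<open>t a b\<close> and
    \<open>a^2 b\<close> add up to the unit \<open>2 u a b\<close>, and (3) applies to them.\<close>
  have e4: "c (t \<otimes> a \<otimes> b) + c b = c (u \<otimes> a \<otimes> (two \<otimes> b)) + c (t \<otimes> u \<otimes> (two \<otimes> b))"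
  proof -
    have sum: "t \<otimes> a \<otimes> b \<oplus> a \<otimes> a \<otimes> b = u \<otimes> a \<otimes> (two \<otimes> b)"
      unfolding t_def u_def xz two_def using C1 C2 C3 C4 C5 C6 by algebra
    have "c b = c (a \<otimes> a \<otimes> b)" using c_square[OF a b] by simp
    moreover have "c (u \<otimes> a \<otimes> (two \<otimes> b) \<otimes> (t \<otimes> a \<otimes> b) \<otimes> (a \<otimes> a \<otimes> b)) = c (t \<otimes> u \<otimes> (two \<otimes> b))"
      by (rule c_eqI[of "a \<otimes> a \<otimes> b"]) (use U in simp, use U in simp, insert C1 C2 C3 C4 C5 C6, algebra)
    ultimately show ?thesis
      using c_add[of "t \<otimes> a \<otimes> b" "a \<otimes> a \<otimes> b"] U unfolding sum by simp
  qed
  have "c a + c b + c b = c a + c (two \<otimes> b) + c (two \<otimes> b)" using e3 by (simp add: add.assoc)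
  also have "\<dots> = c u + c (two \<otimes> b) + c (u \<otimes> a \<otimes> (two \<otimes> b))" using e1 by (simp add: ac_simps)
  also have "\<dots> = c t + (c (u \<otimes> a \<otimes> (two \<otimes> b)) + c (t \<otimes> u \<otimes> (two \<otimes> b)))" using e2 by (simp add: ac_simps)
  also have "\<dots> = c t + c (t \<otimes> a \<otimes> b) + c b" using e4 by (simp add: add.assoc)
  finally show ?thesis using c_cancel[of a b t "t \<otimes> a \<otimes> b" b] U unfolding t_def by simp
qed

lemma c_add_square:
  assumes a: "a \<in> Units R" and b: "b \<in> Units R" and x: "x \<in> carrier R"
    and t: "a \<oplus> b \<otimes> x \<otimes> x \<in> Units R"
  shows "c a + c b = c (a \<oplus> b \<otimes> x \<otimes> x) + c ((a \<oplus> b \<otimes> x \<otimes> x) \<otimes> a \<otimes> b)"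
  using c_add_unit_square[OF a b _ t] c_add_nonunit[OF a b] nonunit[OF x] by blast

end

subsection \<open>Spans and orthogonal families\<close>

lemma (in cring) unit_mult_zero:
  assumes "u \<in> Units R" "a \<in> carrier R" "a \<otimes> u = \<zero>" shows "a = \<zero>"
proof -
  have "a = (a \<otimes> u) \<otimes> inv u" using assms(1,2) by (simp add: m_assoc Units_closed)
  then show ?thesis using assms by simp
qed

context module
begin

text \<open>The coefficient set is a parameter: the whole ring gives the span \<open>spn\<close>,
  while \<open>\<mm>\<close> gives \<open>\<mm>\<close> times the span, as Nakayama's lemma
  requires. Lists allow families to be changed one vector at a time by induction.\<close>

primrec lspan :: "'a set \<Rightarrow> 'c list \<Rightarrow> 'c set" where
  "lspan I [] = {\<zero>\<^bsub>M\<^esub>}"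
| "lspan I (v # vs) = {a \<odot>\<^bsub>M\<^esub> v \<oplus>\<^bsub>M\<^esub> w | a w. a \<in> I \<and> w \<in> lspan I vs}"

abbreviation spn :: "'c list \<Rightarrow> 'c set" where "spn \<equiv> lspan (carrier R)"

lemma lspan_ConsI: "\<lbrakk>a \<in> I; w \<in> lspan I vs\<rbrakk> \<Longrightarrow> a \<odot>\<^bsub>M\<^esub> v \<oplus>\<^bsub>M\<^esub> w \<in> lspan I (v # vs)"
  by auto

lemma lspan_closed: "\<lbrakk>I \<subseteq> carrier R; set vs \<subseteq> carrier M\<rbrakk> \<Longrightarrow> lspan I vs \<subseteq> carrier M"
proof (induction vs)
  case (Cons v vs)
  then show ?case by (auto intro!: M.a_closed smult_closed)
qed simp

lemma lspan_mono: "I \<subseteq> J \<Longrightarrow> lspan I vs \<subseteq> lspan J vs"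
  by (induction vs) auto

lemma lspan_zero: "\<lbrakk>\<zero> \<in> I; set vs \<subseteq> carrier M\<rbrakk> \<Longrightarrow> \<zero>\<^bsub>M\<^esub> \<in> lspan I vs"
proof (induction vs)
  case (Cons v vs)
  then have "\<zero> \<odot>\<^bsub>M\<^esub> v \<oplus>\<^bsub>M\<^esub> \<zero>\<^bsub>M\<^esub> \<in> lspan I (v # vs)"
    by (intro lspan_ConsI) auto
  then show ?case using Cons by (simp del: lspan.simps)
qed simp

lemma lspan_add:
  assumes I: "ideal I R" and vs: "set vs \<subseteq> carrier M" and x: "x \<in> lspan I vs" "y \<in> lspan I vs"
  shows "x \<oplus>\<^bsub>M\<^esub> y \<in> lspan I vs"
  using vs x
proof (induction vs arbitrary: x y)
  case (Cons v vs)
  interpret I: ideal I R by (rule I)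
  obtain a w b u where xy: "x = a \<odot>\<^bsub>M\<^esub> v \<oplus>\<^bsub>M\<^esub> w" "y = b \<odot>\<^bsub>M\<^esub> v \<oplus>\<^bsub>M\<^esub> u"
    and m: "a \<in> I" "b \<in> I" "w \<in> lspan I vs" "u \<in> lspan I vs" using Cons.prems by auto
  have c: "a \<in> carrier R" "b \<in> carrier R" "v \<in> carrier M" "w \<in> carrier M" "u \<in> carrier M"
    using m I.Icarr Cons.prems lspan_closed[of I vs] I.a_subset by auto
  have "x \<oplus>\<^bsub>M\<^esub> y = (a \<oplus> b) \<odot>\<^bsub>M\<^esub> v \<oplus>\<^bsub>M\<^esub> (w \<oplus>\<^bsub>M\<^esub> u)"
    using c by (simp add: xy smult_l_distr M.a_ac)
  moreover have "a \<oplus> b \<in> I" "w \<oplus>\<^bsub>M\<^esub> u \<in> lspan I vs" using Cons m by auto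
  ultimately show ?case by auto
qed simp

lemma lspan_smult:
  assumes I: "ideal I R" and vs: "set vs \<subseteq> carrier M" and x: "x \<in> lspan I vs" and r: "r \<in> carrier R"
  shows "r \<odot>\<^bsub>M\<^esub> x \<in> lspan I vs"
  using vs x
proof (induction vs arbitrary: x)
  case Nil
  then show ?case using r by simp
next
  case (Cons v vs)
  interpret I: ideal I R by (rule I)
  obtain a w where x: "x = a \<odot>\<^bsub>M\<^esub> v \<oplus>\<^bsub>M\<^esub> w" and m: "a \<in> I" "w \<in> lspan I vs" using Cons.prems by auto
  have c: "a \<in> carrier R" "v \<in> carrier M" "w \<in> carrier M"
    using m I.Icarr Cons.prems lspan_closed[of I vs] I.a_subset by auto
  have "r \<odot>\<^bsub>M\<^esub> x = (r \<otimes> a) \<odot>\<^bsub>M\<^esub> v \<oplus>\<^bsub>M\<^esub> r \<odot>\<^bsub>M\<^esub> w"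
    using c r by (simp add: x smult_r_distr smult_assoc1)
  moreover have "r \<otimes> a \<in> I" "r \<odot>\<^bsub>M\<^esub> w \<in> lspan I vs" using Cons m r by (auto simp: I.I_l_closed)
  ultimately show ?case by auto
qed

lemma lspan_base:
  "\<lbrakk>\<zero> \<in> I; set vs \<subseteq> carrier M; v \<in> set vs; I \<subseteq> carrier R; a \<in> I\<rbrakk> \<Longrightarrow> a \<odot>\<^bsub>M\<^esub> v \<in> lspan I vs"
proof (induction vs)
  case (Cons u vs)
  have av: "a \<odot>\<^bsub>M\<^esub> v \<in> carrier M" "u \<in> carrier M" using Cons.prems by auto
  show ?case
  proof (cases "u = v")
    case True
    have "a \<odot>\<^bsub>M\<^esub> v \<oplus>\<^bsub>M\<^esub> \<zero>\<^bsub>M\<^esub> \<in> lspan I (u # vs)"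
      using True Cons.prems lspan_zero[of I vs] lspan_ConsI[of a I _ vs v] by simp
    then show ?thesis using av by (simp del: lspan.simps)
  next
    case False
    then have "a \<odot>\<^bsub>M\<^esub> v \<in> lspan I vs" using Cons by auto
    then have "\<zero> \<odot>\<^bsub>M\<^esub> u \<oplus>\<^bsub>M\<^esub> a \<odot>\<^bsub>M\<^esub> v \<in> lspan I (u # vs)"
      using Cons.prems by (intro lspan_ConsI) auto
    then show ?thesis using av by (simp del: lspan.simps)
  qed
qed simp

lemma spn_base: "\<lbrakk>set vs \<subseteq> carrier M; v \<in> set vs\<rbrakk> \<Longrightarrow> v \<in> spn vs"
  using lspan_base[of "carrier R" vs v \<one>] by (auto simp: subset_iff)

text \<open>Coefficients stay in \<open>I\<close> when the vectors are rewritten over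
  \<open>ws\<close>, because an ideal absorbs the ring coefficients that this introduces.\<close>

lemma lspan_least:
  assumes I: "ideal I R" and vs: "set vs \<subseteq> spn ws" and ws: "set ws \<subseteq> carrier M"
  shows "lspan I vs \<subseteq> lspan I ws"
proof -
  interpret I: ideal I R by (rule I)
  have *: "a \<odot>\<^bsub>M\<^esub> v \<in> lspan I us" if "v \<in> spn us" "a \<in> I" "set us \<subseteq> carrier M" for a v us
    using that
  proof (induction us arbitrary: v)
    case (Cons u us)
    obtain b w where v: "v = b \<odot>\<^bsub>M\<^esub> u \<oplus>\<^bsub>M\<^esub> w" and m: "b \<in> carrier R" "w \<in> spn us" using Cons.prems by auto
    have c: "a \<in> carrier R" "u \<in> carrier M" "w \<in> carrier M"
      using m I.Icarr Cons.prems lspan_closed[of "carrier R" us] by auto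
    have "a \<odot>\<^bsub>M\<^esub> v = (a \<otimes> b) \<odot>\<^bsub>M\<^esub> u \<oplus>\<^bsub>M\<^esub> a \<odot>\<^bsub>M\<^esub> w"
      using c m by (simp add: v smult_r_distr smult_assoc1)
    moreover have "a \<odot>\<^bsub>M\<^esub> w \<in> lspan I us" using Cons m by simp
    ultimately show ?case using Cons.prems m lspan_ConsI[of "a \<otimes> b" I _ us u]
      by (simp add: I.I_r_closed del: lspan.simps)
  qed (auto simp: I.Icarr)
  have "x \<in> lspan I ws" if "x \<in> lspan I vs" for x
    using vs that
  proof (induction vs arbitrary: x)
    case Nil then show ?case using ws I.zero_closed by (simp add: lspan_zero)
  next
    case (Cons v vs)
    then obtain a w where "x = a \<odot>\<^bsub>M\<^esub> v \<oplus>\<^bsub>M\<^esub> w" "a \<in> I" "w \<in> lspan I ws" by auto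
    then show ?case using * Cons.prems ws lspan_add[OF I] by simp
  qed
  then show ?thesis by blast
qed

lemma spn_least: "\<lbrakk>set vs \<subseteq> spn ws; set ws \<subseteq> carrier M\<rbrakk> \<Longrightarrow> spn vs \<subseteq> spn ws"
  using lspan_least[OF oneideal] .

lemma spn_eqI: "\<lbrakk>set vs \<subseteq> spn ws; set ws \<subseteq> spn vs; set vs \<subseteq> carrier M; set ws \<subseteq> carrier M\<rbrakk> \<Longrightarrow> spn vs = spn ws"
  using spn_least by blast

lemma spn_closed: "set vs \<subseteq> carrier M \<Longrightarrow> spn vs \<subseteq> carrier M"
  by (simp add: lspan_closed)

lemma spn_add: "\<lbrakk>set vs \<subseteq> carrier M; x \<in> spn vs; y \<in> spn vs\<rbrakk> \<Longrightarrow> x \<oplus>\<^bsub>M\<^esub> y \<in> spn vs"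
  using lspan_add[OF oneideal] .

lemma spn_smult: "\<lbrakk>set vs \<subseteq> carrier M; x \<in> spn vs; r \<in> carrier R\<rbrakk> \<Longrightarrow> r \<odot>\<^bsub>M\<^esub> x \<in> spn vs"
  using lspan_smult[OF oneideal] .

lemma spn_mono:
  assumes "set vs \<subseteq> set ws" "set ws \<subseteq> carrier M" shows "spn vs \<subseteq> spn ws"
  using assms by (intro spn_least) (auto intro: spn_base)

lemma spn_set_cong: "\<lbrakk>set vs = set ws; set ws \<subseteq> carrier M\<rbrakk> \<Longrightarrow> spn vs = spn ws"
  using spn_mono[of vs ws] spn_mono[of ws vs] by auto

lemma spn_append_cong:
  assumes "spn vs = spn vs'" "set vs \<subseteq> carrier M" "set vs' \<subseteq> carrier M" "set ws \<subseteq> carrier M"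
  shows "spn (vs @ ws) = spn (vs' @ ws)"
proof (rule spn_eqI)
  have "set vs \<subseteq> spn vs'" "set vs' \<subseteq> spn vs" using assms spn_base by blast+
  moreover have "spn vs' \<subseteq> spn (vs' @ ws)"
    by (rule spn_mono) (use assms in auto)
  moreover have "spn vs \<subseteq> spn (vs @ ws)"
    by (rule spn_mono) (use assms in auto)
  moreover have "spn ws \<subseteq> spn (vs' @ ws)"
    by (rule spn_mono) (use assms in auto)
  moreover have "spn ws \<subseteq> spn (vs @ ws)"
    by (rule spn_mono) (use assms in auto)
  moreover have "set ws \<subseteq> spn ws" using assms spn_base by blast
  ultimately show "set (vs @ ws) \<subseteq> spn (vs' @ ws)" "set (vs' @ ws) \<subseteq> spn (vs @ ws)"
    using assms(1) by auto
qed (use assms in auto)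

lemma two_comb_add:
  "\<lbrakk>a \<in> carrier R; b \<in> carrier R; c \<in> carrier R; d \<in> carrier R; v \<in> carrier M; w \<in> carrier M\<rbrakk> \<Longrightarrow>
   (a \<odot>\<^bsub>M\<^esub> v \<oplus>\<^bsub>M\<^esub> b \<odot>\<^bsub>M\<^esub> w) \<oplus>\<^bsub>M\<^esub> (c \<odot>\<^bsub>M\<^esub> v \<oplus>\<^bsub>M\<^esub> d \<odot>\<^bsub>M\<^esub> w) = (a \<oplus> c) \<odot>\<^bsub>M\<^esub> v \<oplus>\<^bsub>M\<^esub> (b \<oplus> d) \<odot>\<^bsub>M\<^esub> w"
  by (simp add: smult_l_distr M.a_ac)

lemma two_comb_smult:
  "\<lbrakk>r \<in> carrier R; a \<in> carrier R; b \<in> carrier R; v \<in> carrier M; w \<in> carrier M\<rbrakk> \<Longrightarrow>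
   r \<odot>\<^bsub>M\<^esub> (a \<odot>\<^bsub>M\<^esub> v \<oplus>\<^bsub>M\<^esub> b \<odot>\<^bsub>M\<^esub> w) = (r \<otimes> a) \<odot>\<^bsub>M\<^esub> v \<oplus>\<^bsub>M\<^esub> (r \<otimes> b) \<odot>\<^bsub>M\<^esub> w"
  by (simp add: smult_r_distr smult_assoc1)

lemma smult_inv_cancel: "\<lbrakk>s \<in> Units R; v \<in> carrier M\<rbrakk> \<Longrightarrow> inv s \<odot>\<^bsub>M\<^esub> (s \<odot>\<^bsub>M\<^esub> v) = v"
  using smult_assoc1[of "inv s" s v] by (simp add: Units_closed)

end

text \<open>Weaker than \<open>inner_product_space\<close>: orthogonal sums, tensor products and
  coordinate spaces are first built as form spaces and then shown to be non-degenerate by exhibiting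
  a dual basis.\<close>

locale form_space = module R V for R (structure) and V :: "('a, 'b, 'v) form_module_scheme" +
  assumes bilinear: "bilinear_map R V V (self_module R) (form V)"
    and symmetric: "\<lbrakk>v \<in> carrier V; w \<in> carrier V\<rbrakk> \<Longrightarrow> form V v w = form V w v"
begin

lemma form_closed [simp]: "\<lbrakk>x \<in> carrier V; y \<in> carrier V\<rbrakk> \<Longrightarrow> form V x y \<in> carrier R"
  using bilinear by (auto simp: bilinear_map_def linear_maps_def hom_def self_module_def)

lemma form_add_r: "\<lbrakk>x \<in> carrier V; y \<in> carrier V; z \<in> carrier V\<rbrakk> \<Longrightarrow> form V x (y \<oplus>\<^bsub>V\<^esub> z) = form V x y \<oplus> form V x z"
  using bilinear by (auto simp: bilinear_map_def linear_maps_def hom_def self_module_def)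

lemma form_smult_r: "\<lbrakk>x \<in> carrier V; y \<in> carrier V; a \<in> carrier R\<rbrakk> \<Longrightarrow> form V x (a \<odot>\<^bsub>V\<^esub> y) = a \<otimes> form V x y"
  using bilinear by (auto simp: bilinear_map_def linear_maps_def hom_def self_module_def)

lemma form_add_l: "\<lbrakk>x \<in> carrier V; y \<in> carrier V; z \<in> carrier V\<rbrakk> \<Longrightarrow> form V (y \<oplus>\<^bsub>V\<^esub> z) x = form V y x \<oplus> form V z x"
  using bilinear by (auto simp: bilinear_map_def linear_maps_def hom_def self_module_def)

lemma form_smult_l: "\<lbrakk>x \<in> carrier V; y \<in> carrier V; a \<in> carrier R\<rbrakk> \<Longrightarrow> form V (a \<odot>\<^bsub>V\<^esub> y) x = a \<otimes> form V y x"
  using bilinear by (auto simp: bilinear_map_def linear_maps_def hom_def self_module_def)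

lemma form_zero_r [simp]: "x \<in> carrier V \<Longrightarrow> form V x \<zero>\<^bsub>V\<^esub> = \<zero>"
  using form_smult_r[of x x \<zero>] by simp

lemma form_zero_l [simp]: "x \<in> carrier V \<Longrightarrow> form V \<zero>\<^bsub>V\<^esub> x = \<zero>"
  using form_smult_l[of x x \<zero>] by simp

lemmas form_lin = form_add_r form_add_l form_smult_r form_smult_l

text \<open>Only earlier against later entries are compared, which makes \<open>orth_Cons\<close> a
  plain recursion; symmetry of the form gives the other half. Unit norms make such a family linearly
  independent and each of its members an orthogonal summand.\<close>

definition orth :: "'b list \<Rightarrow> bool" where
  "orth es \<longleftrightarrow> set es \<subseteq> carrier V \<and> (\<forall>e\<in>set es. form V e e \<in> Units R)
     \<and> sorted_wrt (\<lambda>x y. form V x y = \<zero>) es"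

lemma orth_Nil [simp]: "orth []" by (simp add: orth_def)

lemma orth_Cons: "orth (e # es) \<longleftrightarrow>
    e \<in> carrier V \<and> form V e e \<in> Units R \<and> (\<forall>w\<in>set es. form V e w = \<zero>) \<and> orth es"
  by (auto simp: orth_def)

lemma orth_append: "orth (es @ fs) \<longleftrightarrow> orth es \<and> orth fs \<and> (\<forall>e\<in>set es. \<forall>f\<in>set fs. form V e f = \<zero>)"
  by (auto simp: orth_def sorted_wrt_append)

lemma orthD: "orth es \<Longrightarrow> set es \<subseteq> carrier V" "orth es \<Longrightarrow> e \<in> set es \<Longrightarrow> form V e e \<in> Units R"
  by (auto simp: orth_def)

lemma orth_insert: "orth (xs @ y # ys) \<longleftrightarrow> orth (y # xs @ ys)"
proof -
  have "form V x y = form V y x" if "orth (xs @ ys)" "y \<in> carrier V" "x \<in> set (xs @ ys)" for x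
    using that by (intro symmetric) (auto simp: orth_def)
  then show ?thesis by (auto simp: orth_append orth_Cons)
qed

lemma orth_perm: "\<lbrakk>mset es = mset fs; orth es\<rbrakk> \<Longrightarrow> orth fs"
proof (induction es arbitrary: fs)
  case (Cons e es)
  then obtain xs ys where fs: "fs = xs @ e # ys" by (metis split_list list.set_intros(1) set_mset_mset)
  then have m: "mset es = mset (xs @ ys)" using Cons.prems by simp
  then have "orth (xs @ ys)" using Cons by (simp add: orth_Cons)
  moreover have "set es = set (xs @ ys)" using m by (metis set_mset_mset)
  ultimately show ?case unfolding fs orth_insert using Cons.prems by (simp add: orth_Cons)
qed simp

lemma form_spn_zero:
  assumes "x \<in> carrier V" "set es \<subseteq> carrier V" "\<forall>e\<in>set es. form V x e = \<zero>" "w \<in> spn es"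
  shows "form V x w = \<zero>"
  using assms(2-4)
proof (induction es arbitrary: w)
  case (Cons e es)
  then obtain a u where w: "w = a \<odot>\<^bsub>V\<^esub> e \<oplus>\<^bsub>V\<^esub> u" "a \<in> carrier R" "u \<in> spn es" by auto
  then have "u \<in> carrier V" "form V x u = \<zero>" using Cons spn_closed[of es] by auto
  then show ?case using w Cons.prems assms(1) by (simp add: form_lin)
qed (use assms in simp)

text \<open>Orthogonality to \<open>fs\<close> is a property of the span of \<open>es\<close>, so a
  part of a family may be exchanged without looking at the rest. This makes moves in a plane
  local.\<close>

lemma orth_append_cong:
  assumes "orth es" "orth es'" "spn es = spn es'" "orth (es @ fs)"
  shows "orth (es' @ fs)"
proof -
  have "form V e f = \<zero>" if e: "e \<in> set es'" and f: "f \<in> set fs" for e f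
  proof -
    have c: "e \<in> carrier V" "f \<in> carrier V" "set es \<subseteq> carrier V" "set es' \<subseteq> carrier V" "set fs \<subseteq> carrier V"
      using e f assms(1,2,4) by (auto simp: orth_append dest: orthD)
    have "e \<in> spn es" using assms(3) e c spn_base by blast
    moreover have "\<forall>x\<in>set es. form V f x = \<zero>"
      using assms(4) f c symmetric by (auto simp: orth_append subset_iff)
    ultimately have "form V f e = \<zero>" using form_spn_zero c by blast
    then show ?thesis using symmetric c by simp
  qed
  then show ?thesis using assms by (simp add: orth_append)
qed

text \<open>The coordinate of \<open>x\<close> along \<open>f\<close> is \<open>form f x\<close>
  divided by the unit \<open>form f f\<close>. The tail thus spans the orthogonal complement of
  \<open>f\<close>, which depends only on \<open>f\<close> and the whole span; this permits the
  induction in \<open>cls_unique\<close>.\<close>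

lemma orth_tail_spn:
  assumes "orth (f # es)"
  shows "spn es = {x \<in> spn (f # es). form V f x = \<zero>}"
proof -
  have c: "f \<in> carrier V" "set es \<subseteq> carrier V" "form V f f \<in> Units R" "\<forall>e\<in>set es. form V f e = \<zero>"
    using assms orthD by (auto simp: orth_Cons)
  note z = form_spn_zero[OF c(1,2,4)]
  have "x \<in> spn es" if x: "x \<in> spn (f # es)" "form V f x = \<zero>" for x
  proof -
    obtain a u where w: "x = a \<odot>\<^bsub>V\<^esub> f \<oplus>\<^bsub>V\<^esub> u" "a \<in> carrier R" "u \<in> spn es" using x by auto
    then have u: "u \<in> carrier V" using spn_closed c by blast
    have "form V f x = a \<otimes> form V f f" using w u c z by (simp add: form_lin)
    then have "a = \<zero>" using x c w unit_mult_zero by simp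
    then show ?thesis using w u c by simp
  qed
  moreover have "spn es \<subseteq> spn (f # es)" using c by (intro spn_mono) auto
  ultimately show ?thesis using z by auto
qed

end

subsection \<open>Orthogonal bases of the same space\<close>

locale diagonal_form = diagonal_invariant \<mm> R c + form_space R V
  for \<mm> and R (structure) and c :: "'a \<Rightarrow> 'g::comm_monoid_add"
    and V :: "('a, 'b, 'v) form_module_scheme"
begin

declare lspan.simps(2) [simp del]

definition cls :: "'b list \<Rightarrow> 'g" where "cls es = (\<Sum>e\<leftarrow>es. c (form V e e))"

text \<open>Equality of \<open>cls\<close> is built in, so that a chain of moves yields equality of
  the invariants by transitivity alone.\<close>

definition eqv :: "'b list \<Rightarrow> 'b list \<Rightarrow> bool" where
  "eqv es fs \<longleftrightarrow> orth es \<and> orth fs \<and> spn es = spn fs \<and> cls es = cls fs"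

lemma cls_simps [simp]: "cls [] = 0" "cls (e # es) = c (form V e e) + cls es" "cls (es @ fs) = cls es + cls fs"
  by (auto simp: cls_def)

lemma eqv_refl: "orth es \<Longrightarrow> eqv es es" by (simp add: eqv_def)

lemma eqv_trans [trans]: "\<lbrakk>eqv es fs; eqv fs gs\<rbrakk> \<Longrightarrow> eqv es gs" by (simp add: eqv_def)

lemma eqv_perm: "\<lbrakk>orth es; mset es = mset fs\<rbrakk> \<Longrightarrow> eqv es fs"
proof -
  assume a: "orth es" "mset es = mset fs"
  have "orth fs" by (rule orth_perm[OF a(2,1)])
  moreover have "set es = set fs" by (rule mset_eq_setD[OF a(2)])
  moreover have "cls es = cls fs"
  proof -
    have "mset (map (\<lambda>e. c (form V e e)) es) = mset (map (\<lambda>e. c (form V e e)) fs)" using a(2) by simp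
    then show ?thesis unfolding cls_def sum_mset_sum_list[symmetric] by simp
  qed
  ultimately show ?thesis using a spn_set_cong[of es fs] orthD(1)[of fs] by (simp add: eqv_def)
qed

lemma eqv_append: "\<lbrakk>eqv es es'; orth (es @ zs)\<rbrakk> \<Longrightarrow> eqv (es @ zs) (es' @ zs)"
  using orth_append_cong[of es es' zs] spn_append_cong[of es es' zs]
    orthD(1)[of es] orthD(1)[of es'] orthD(1)[of zs]
  by (simp add: eqv_def orth_append)

lemma eqv_scale:
  assumes "orth [v]" "x \<in> Units R" shows "eqv [v] [x \<odot>\<^bsub>V\<^esub> v]"
proof -
  have c: "v \<in> carrier V" "form V v v \<in> Units R" "x \<in> carrier R" using assms by (auto simp: orth_Cons)
  have n: "form V (x \<odot>\<^bsub>V\<^esub> v) (x \<odot>\<^bsub>V\<^esub> v) = x \<otimes> x \<otimes> form V v v" using c by (simp add: form_lin m_assoc)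
  have "spn [v] = spn [x \<odot>\<^bsub>V\<^esub> v]"
  proof (rule spn_eqI)
    have "inv x \<odot>\<^bsub>V\<^esub> (x \<odot>\<^bsub>V\<^esub> v) \<in> spn [x \<odot>\<^bsub>V\<^esub> v]"
      using spn_smult[of "[x \<odot>\<^bsub>V\<^esub> v]" _ "inv x"] c assms spn_base[of "[x \<odot>\<^bsub>V\<^esub> v]"] by simp
    then show "set [v] \<subseteq> spn [x \<odot>\<^bsub>V\<^esub> v]" using smult_inv_cancel assms c by simp
    show "set [x \<odot>\<^bsub>V\<^esub> v] \<subseteq> spn [v]" using spn_smult[of "[v]" v x] spn_base[of "[v]" v] c by auto
  qed (use c in auto)
  then show ?thesis using c assms n c_square by (simp add: eqv_def orth_Cons)
qed

lemma eqv_scale_Cons: "\<lbrakk>orth (v # vs); x \<in> Units R\<rbrakk> \<Longrightarrow> eqv (v # vs) (x \<odot>\<^bsub>V\<^esub> v # vs)"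
  using eqv_append[OF eqv_scale, of v x vs] by (auto simp: orth_Cons)

lemma form_add_orth:
  assumes "v \<in> carrier V" "w \<in> carrier V" "form V v w = \<zero>" "x \<in> carrier R"
  shows "form V (v \<oplus>\<^bsub>V\<^esub> x \<odot>\<^bsub>V\<^esub> w) (v \<oplus>\<^bsub>V\<^esub> x \<odot>\<^bsub>V\<^esub> w) = form V v v \<oplus> form V w w \<otimes> x \<otimes> x"
proof -
  have "form V w v = \<zero>" using assms symmetric[of w v] by simp
  then show ?thesis using assms by (simp add: form_lin m_ac)
qed

text \<open>The base change from \<open>v\<close>, \<open>w\<close> to \<open>p\<close>,
  \<open>q\<close> has determinant \<open>form v v + form w w x^2\<close>, which is the norm of
  \<open>p\<close>; so \<open>p\<close> belongs to an orthogonal basis of the plane as soon as its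
  norm is a unit. Equality of \<open>cls\<close> is \<open>c_add_square\<close>. The last equation
  is part of the inverse base change and is what \<open>eqv_break\<close> needs.\<close>

lemma eqv_pair:
  fixes v w x
  defines "p \<equiv> v \<oplus>\<^bsub>V\<^esub> x \<odot>\<^bsub>V\<^esub> w"
    and "q \<equiv> (\<ominus> (form V w w \<otimes> x)) \<odot>\<^bsub>V\<^esub> v \<oplus>\<^bsub>V\<^esub> form V v v \<odot>\<^bsub>V\<^esub> w"
  assumes o: "orth [v, w]" and x: "x \<in> carrier R" and s: "form V p p \<in> Units R"
  shows "eqv [v, w] [p, q]"
    and "form V p p = form V v v \<oplus> form V w w \<otimes> x \<otimes> x"
    and "form V q q = form V p p \<otimes> form V v v \<otimes> form V w w"
    and "form V p p \<odot>\<^bsub>V\<^esub> v = form V v v \<odot>\<^bsub>V\<^esub> p \<oplus>\<^bsub>V\<^esub> (\<ominus> x) \<odot>\<^bsub>V\<^esub> q"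
proof -
  define a b where "a = form V v v" and "b = form V w w"
  have cV: "v \<in> carrier V" "w \<in> carrier V" and U: "a \<in> Units R" "b \<in> Units R"
    and o1: "form V v w = \<zero>" using o by (auto simp: orth_Cons a_def b_def)
  have o2: "form V w v = \<zero>" using o1 cV symmetric[of w v] by simp
  have cR: "a \<in> carrier R" "b \<in> carrier R" "x \<in> carrier R" using U x by auto
  have pq: "p = \<one> \<odot>\<^bsub>V\<^esub> v \<oplus>\<^bsub>V\<^esub> x \<odot>\<^bsub>V\<^esub> w" "q = (\<ominus> (b \<otimes> x)) \<odot>\<^bsub>V\<^esub> v \<oplus>\<^bsub>V\<^esub> a \<odot>\<^bsub>V\<^esub> w"
    using cV by (auto simp: p_def q_def a_def b_def)
  have cpq: "p \<in> carrier V" "q \<in> carrier V" using cV cR by (auto simp: pq)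
  have fp: "form V p p = a \<oplus> b \<otimes> x \<otimes> x"
    using form_add_orth[OF cV o1 x] by (simp add: p_def a_def b_def)
  show "form V p p = form V v v \<oplus> form V w w \<otimes> x \<otimes> x" using fp by (simp add: a_def b_def)
  define t where "t = form V p p"
  have tU: "t \<in> Units R" and tR: "t \<in> carrier R" using s by (auto simp: t_def)
  have fq: "form V q q = t \<otimes> a \<otimes> b"
  proof -
    have "form V q q = \<ominus> (b \<otimes> x) \<otimes> (\<ominus> (b \<otimes> x) \<otimes> a) \<oplus> a \<otimes> (a \<otimes> b)"
      using cV cR o1 o2 by (simp add: pq form_lin a_def[symmetric] b_def[symmetric])
    also have "\<dots> = (a \<oplus> b \<otimes> x \<otimes> x) \<otimes> a \<otimes> b" using cR by algebra
    finally show ?thesis by (simp add: t_def fp)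
  qed
  show "form V q q = form V p p \<otimes> form V v v \<otimes> form V w w" using fq by (simp add: t_def a_def b_def)
  have fpq: "form V p q = \<zero>"
  proof -
    have "form V p q = \<ominus> (b \<otimes> x) \<otimes> a \<oplus> a \<otimes> (x \<otimes> b)"
      using cV cR o1 o2 by (simp add: pq form_lin a_def[symmetric] b_def[symmetric])
    also have "\<dots> = \<zero>" using cR by algebra
    finally show ?thesis .
  qed
  have ev: "t \<odot>\<^bsub>V\<^esub> v = a \<odot>\<^bsub>V\<^esub> p \<oplus>\<^bsub>V\<^esub> (\<ominus> x) \<odot>\<^bsub>V\<^esub> q"
  proof -
    have "a \<odot>\<^bsub>V\<^esub> p \<oplus>\<^bsub>V\<^esub> (\<ominus> x) \<odot>\<^bsub>V\<^esub> q =
      (a \<otimes> \<one> \<oplus> \<ominus> x \<otimes> \<ominus> (b \<otimes> x)) \<odot>\<^bsub>V\<^esub> v \<oplus>\<^bsub>V\<^esub> (a \<otimes> x \<oplus> \<ominus> x \<otimes> a) \<odot>\<^bsub>V\<^esub> w"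
      using cV cR by (simp add: pq(1) pq(2) two_comb_smult two_comb_add del: r_one smult_one)
    also have "a \<otimes> \<one> \<oplus> \<ominus> x \<otimes> \<ominus> (b \<otimes> x) = t" unfolding t_def fp using cR by algebra
    also have "a \<otimes> x \<oplus> \<ominus> x \<otimes> a = \<zero>" using cR by algebra
    finally show ?thesis using cV tR by simp
  qed
  then show "form V p p \<odot>\<^bsub>V\<^esub> v = form V v v \<odot>\<^bsub>V\<^esub> p \<oplus>\<^bsub>V\<^esub> (\<ominus> x) \<odot>\<^bsub>V\<^esub> q"
    by (simp add: t_def a_def)
  have ew: "t \<odot>\<^bsub>V\<^esub> w = (b \<otimes> x) \<odot>\<^bsub>V\<^esub> p \<oplus>\<^bsub>V\<^esub> \<one> \<odot>\<^bsub>V\<^esub> q"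
  proof -
    have "(b \<otimes> x) \<odot>\<^bsub>V\<^esub> p \<oplus>\<^bsub>V\<^esub> \<one> \<odot>\<^bsub>V\<^esub> q =
      (b \<otimes> x \<otimes> \<one> \<oplus> \<one> \<otimes> \<ominus> (b \<otimes> x)) \<odot>\<^bsub>V\<^esub> v \<oplus>\<^bsub>V\<^esub> (b \<otimes> x \<otimes> x \<oplus> \<one> \<otimes> a) \<odot>\<^bsub>V\<^esub> w"
      using cV cR by (simp add: pq(1) pq(2) two_comb_smult two_comb_add del: r_one l_one smult_one)
    also have "b \<otimes> x \<otimes> x \<oplus> \<one> \<otimes> a = t" unfolding t_def fp using cR by algebra
    also have "b \<otimes> x \<otimes> \<one> \<oplus> \<one> \<otimes> \<ominus> (b \<otimes> x) = \<zero>" using cR by algebra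
    finally show ?thesis using cV tR by simp
  qed
  have spn: "spn [v, w] = spn [p, q]"
  proof (rule spn_eqI)
    have pqs: "p \<in> spn [p, q]" "q \<in> spn [p, q]" using spn_base[of "[p, q]"] cpq by auto
    have set: "set [p, q] \<subseteq> carrier V" using cpq by simp
    have "t \<odot>\<^bsub>V\<^esub> v \<in> spn [p, q]" "t \<odot>\<^bsub>V\<^esub> w \<in> spn [p, q]"
      unfolding ev ew using pqs cR by (intro spn_add[OF set] spn_smult[OF set]; simp)+
    then have "inv t \<odot>\<^bsub>V\<^esub> (t \<odot>\<^bsub>V\<^esub> v) \<in> spn [p, q]" "inv t \<odot>\<^bsub>V\<^esub> (t \<odot>\<^bsub>V\<^esub> w) \<in> spn [p, q]"
      using spn_smult[OF set _ Units_inv_closed[OF tU]] by simp_all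
    then show "set [v, w] \<subseteq> spn [p, q]" using smult_inv_cancel[OF tU] cV by simp
    have vws: "v \<in> spn [v, w]" "w \<in> spn [v, w]" using spn_base[of "[v, w]"] cV by auto
    have set2: "set [v, w] \<subseteq> carrier V" using cV by simp
    have "p \<in> spn [v, w]" "q \<in> spn [v, w]"
      unfolding pq using vws cR by (intro spn_add[OF set2] spn_smult[OF set2]; simp)+
    then show "set [p, q] \<subseteq> spn [v, w]" by simp
  qed (use cV cpq in auto)
  have "orth [p, q]" using cpq tU U fpq fq by (simp add: orth_Cons t_def)
  moreover have "cls [v, w] = cls [p, q]"
    using c_add_square[OF U x] tU unfolding t_def fp
    by (simp add: fq t_def fp a_def[symmetric] b_def[symmetric])
  ultimately show "eqv [v, w] [p, q]" using o spn by (simp add: eqv_def)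
qed

lemma eqv_step:
  assumes o: "orth (v # w # zs)" and x: "x \<in> carrier R"
    and s: "form V (v \<oplus>\<^bsub>V\<^esub> x \<odot>\<^bsub>V\<^esub> w) (v \<oplus>\<^bsub>V\<^esub> x \<odot>\<^bsub>V\<^esub> w) \<in> Units R"
  obtains z where "eqv (v # w # zs) ((v \<oplus>\<^bsub>V\<^esub> x \<odot>\<^bsub>V\<^esub> w) # z # zs)"
proof -
  have "orth [v, w]" using o by (simp add: orth_Cons)
  from eqv_append[OF eqv_pair(1)[OF this x s], of zs] that show ?thesis using o by simp
qed

text \<open>Every partial sum after the start must have unit norm, so that each addition is a move
  of \<open>eqv_pair\<close>. The norm of the start itself is supplied by
  \<open>orth\<close>.\<close>

fun units_along :: "'b \<Rightarrow> ('a \<times> 'b) list \<Rightarrow> bool" where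
  "units_along v [] = True"
| "units_along v ((x, w) # r) \<longleftrightarrow> x \<in> carrier R \<and>
     form V (v \<oplus>\<^bsub>V\<^esub> x \<odot>\<^bsub>V\<^esub> w) (v \<oplus>\<^bsub>V\<^esub> x \<odot>\<^bsub>V\<^esub> w) \<in> Units R \<and> units_along (v \<oplus>\<^bsub>V\<^esub> x \<odot>\<^bsub>V\<^esub> w) r"

abbreviation add_along :: "'b \<Rightarrow> ('a \<times> 'b) list \<Rightarrow> 'b" where
  "add_along \<equiv> foldl (\<lambda>v (x, w). v \<oplus>\<^bsub>V\<^esub> x \<odot>\<^bsub>V\<^esub> w)"

text \<open>Each move uses up the next \<open>w\<close> and leaves some vector \<open>z\<close> in
  its place. It is pushed behind the remaining vectors of the path, which are still untouched basis
  vectors and ready for their own moves.\<close>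

lemma eqv_along:
  assumes "orth (v # map snd r @ us)" "units_along v r"
  shows "\<exists>zs. length zs = length r \<and> eqv (v # map snd r @ us) (add_along v r # zs @ us)"
  using assms
proof (induction r arbitrary: v us)
  case Nil
  then show ?case by (simp add: eqv_refl)
next
  case (Cons xw r)
  obtain x w where xw: "xw = (x, w)" by (cases xw)
  let ?v = "v \<oplus>\<^bsub>V\<^esub> x \<odot>\<^bsub>V\<^esub> w"
  obtain z where z: "eqv (v # w # map snd r @ us) (?v # z # map snd r @ us)"
    using eqv_step[of v w "map snd r @ us" x] Cons.prems by (auto simp: xw)
  have "eqv (?v # z # map snd r @ us) (?v # map snd r @ z # us)"
    using z by (intro eqv_perm) (auto simp: eqv_def)
  note z = eqv_trans[OF z this]
  then have "orth (?v # map snd r @ z # us)" by (simp add: eqv_def)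
  from Cons.IH[OF this] obtain zs where zs: "length zs = length r"
    "eqv (?v # map snd r @ z # us) (add_along ?v r # zs @ z # us)"
    using Cons.prems by (auto simp: xw)
  have "eqv (v # map snd (xw # r) @ us) (add_along v (xw # r) # (zs @ [z]) @ us)"
    using eqv_trans[OF z zs(2)] by (simp add: xw)
  then show ?case using zs(1) by (intro exI[of _ "zs @ [z]"]) simp
qed

end

section \<open>Sums of orthogonal vectors and the case of residue characteristic 2\<close>

context form_space
begin

abbreviation vsum :: "'b list \<Rightarrow> 'b" where
  "vsum vs \<equiv> foldr (\<lambda>v w. v \<oplus>\<^bsub>V\<^esub> w) vs \<zero>\<^bsub>V\<^esub>"

lemma vsum_closed [simp]: "set vs \<subseteq> carrier V \<Longrightarrow> vsum vs \<in> carrier V"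
  by (induction vs) auto

lemma vsum_insert:
  "\<lbrakk>set xs \<subseteq> carrier V; y \<in> carrier V; set ys \<subseteq> carrier V\<rbrakk> \<Longrightarrow> vsum (xs @ y # ys) = y \<oplus>\<^bsub>V\<^esub> vsum (xs @ ys)"
proof (induction xs)
  case (Cons x xs)
  then have "vsum (xs @ ys) \<in> carrier V" by (intro vsum_closed) auto
  then show ?case using Cons by (simp add: M.a_lcomm)
qed simp

lemma vsum_perm: "\<lbrakk>mset es = mset fs; set es \<subseteq> carrier V\<rbrakk> \<Longrightarrow> vsum es = vsum fs"
proof (induction es arbitrary: fs)
  case (Cons e es)
  have "e \<in> set fs" using mset_eq_setD[OF Cons.prems(1)] by auto
  then obtain xs ys where fs: "fs = xs @ e # ys" by (meson split_list)
  then have m: "mset es = mset (xs @ ys)" using Cons.prems by simp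
  then have "set es = set (xs @ ys)" by (rule mset_eq_setD)
  then have "set xs \<subseteq> carrier V" "set ys \<subseteq> carrier V" "e \<in> carrier V" using Cons.prems by auto
  then show ?case using Cons.IH[OF m] Cons.prems by (simp only: fs vsum_insert) simp
qed simp

lemma form_vsum_zero:
  "\<lbrakk>x \<in> carrier V; set vs \<subseteq> carrier V; \<forall>v\<in>set vs. form V x v = \<zero>\<rbrakk> \<Longrightarrow> form V x (vsum vs) = \<zero>"
  by (induction vs) (auto simp: form_lin)

lemma orth_vsum_Cons:
  assumes "orth (v # vs)"
  shows "form V v (vsum vs) = \<zero>" "form V (vsum vs) v = \<zero>"
proof -
  have c: "v \<in> carrier V" "set vs \<subseteq> carrier V" "\<forall>w\<in>set vs. form V v w = \<zero>"
    using assms by (auto simp: orth_Cons orth_def)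
  show "form V v (vsum vs) = \<zero>" using form_vsum_zero[OF c] .
  then show "form V (vsum vs) v = \<zero>" using symmetric[of "vsum vs" v] c by simp
qed

end

context local_ring
begin

text \<open>Here \<open>x\<close> is congruent to \<open>- u\<close>. In residue characteristic 2
  signs disappear modulo \<open>\<mm>\<close>, so below a sum in \<open>\<mm>\<close> is used as a
  congruence between its two terms.\<close>

lemma Units_if_add_nonunit:
  assumes "x \<oplus> u \<in> \<mm>" "u \<in> Units R" "x \<in> carrier R" shows "x \<in> Units R"
proof -
  have u: "u \<in> carrier R" using assms by auto
  have "\<ominus> u \<oplus> (x \<oplus> u) \<in> Units R" using assms by (simp add: Units_add_nonunit Units_minus)
  moreover have "\<ominus> u \<oplus> (x \<oplus> u) = x" using u assms(3) by algebra
  ultimately show ?thesis by simp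
qed

end

text \<open>If \<open>a + b\<close> is a non-unit, then \<open>a + b y^2\<close> is congruent to
  \<open>b (y - 1) (y + 1)\<close>, and \<open>y + 1\<close> is congruent to \<open>y - 1\<close> in
  residue characteristic 2. The \<open>y\<close> of \<open>residue_field\<close>, distinct from 0
  and 1 modulo \<open>\<mm>\<close>, therefore works.\<close>

lemma (in diagonal_invariant) ex_unit_sum:
  assumes two: "\<one> \<oplus> \<one> \<in> \<mm>" and a: "a \<in> Units R" and b: "b \<in> Units R"
  obtains y where "y \<in> Units R" "a \<oplus> b \<otimes> y \<otimes> y \<in> Units R"
proof (cases "a \<oplus> b \<in> Units R")
  case True
  then show ?thesis using that[of \<one>] b by (simp add: Units_closed)
next
  case False
  have c: "a \<in> carrier R" "b \<in> carrier R" using a b by auto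
  have ab: "a \<oplus> b \<in> \<mm>" using False c by (intro nonunit) auto
  obtain y where y: "y \<in> Units R" "y \<ominus> \<one> \<in> Units R" using residue_field by blast
  have cy: "y \<in> carrier R" using y by auto
  have "y \<oplus> \<one> \<in> Units R"
  proof -
    have "(y \<ominus> \<one>) \<oplus> (\<one> \<oplus> \<one>) \<in> Units R" by (rule Units_add_nonunit[OF y(2) two])
    moreover have "(y \<ominus> \<one>) \<oplus> (\<one> \<oplus> \<one>) = y \<oplus> \<one>" using cy by algebra
    ultimately show ?thesis by simp
  qed
  then have "b \<otimes> ((y \<ominus> \<one>) \<otimes> (y \<oplus> \<one>)) \<in> Units R" using b y by simp
  then have "b \<otimes> ((y \<ominus> \<one>) \<otimes> (y \<oplus> \<one>)) \<oplus> (a \<oplus> b) \<in> Units R" by (rule Units_add_nonunit[OF _ ab])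
  moreover have "b \<otimes> ((y \<ominus> \<one>) \<otimes> (y \<oplus> \<one>)) \<oplus> (a \<oplus> b) = a \<oplus> b \<otimes> y \<otimes> y" using c cy by algebra
  ultimately show ?thesis using that[of y] y by simp
qed

context diagonal_form
begin

lemma norm_vsum_Cons:
  assumes "orth (v # vs)"
  shows "form V (vsum (v # vs)) (vsum (v # vs)) = form V v v \<oplus> form V (vsum vs) (vsum vs)"
proof -
  have c: "v \<in> carrier V" "vsum vs \<in> carrier V"
    using assms vsum_closed[of vs] by (auto simp: orth_Cons orth_def)
  then show ?thesis using orth_vsum_Cons[OF assms] by (simp add: form_lin)
qed

text \<open>
  In residue characteristic 2 the square of \<open>form w f\<close>, \<open>f = vsum vs\<close>, is additive in \<open>w\<close>
  modulo \<open>\<mm>\<close>, as is the norm of \<open>w\<close>; so it suffices that they are proportional on the basis.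
\<close>

lemma characteristic_vector:
  assumes two: "\<one> \<oplus> \<one> \<in> \<mm>" and a: "a \<in> carrier R"
    and "orth vs" "\<forall>v\<in>set vs. form V v v \<oplus> a \<in> \<mm>" "w \<in> spn vs"
  shows "a \<otimes> form V w w \<oplus> form V w (vsum vs) \<otimes> form V w (vsum vs) \<in> \<mm>"
  using assms(3-)
proof (induction vs arbitrary: w)
  case Nil
  then show ?case using a by simp
next
  case (Cons v vs)
  define f where "f = vsum vs"
  obtain y u where w: "w = y \<odot>\<^bsub>V\<^esub> v \<oplus>\<^bsub>V\<^esub> u" and y: "y \<in> carrier R" and u: "u \<in> spn vs"
    using Cons.prems by (auto simp: lspan.simps)
  have vs: "set vs \<subseteq> carrier V" "v \<in> carrier V" "orth vs" "\<forall>x\<in>set vs. form V v x = \<zero>"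
    using Cons.prems by (auto simp: orth_Cons orth_def)
  have uV: "u \<in> carrier V" and fV: "f \<in> carrier V" using u spn_closed[OF vs(1)] vs by (auto simp: f_def)
  have vu: "form V v u = \<zero>" using form_spn_zero[OF vs(2,1,4) u] .
  have uv: "form V u v = \<zero>" using vu symmetric[of u v] uV vs by simp
  have vf: "form V v f = \<zero>" using orth_vsum_Cons(1)[OF Cons.prems(1)] by (simp add: f_def)
  define A N F where "A = form V v v" and "N = form V u u" and "F = form V u f"
  have cc: "A \<in> carrier R" "N \<in> carrier R" "F \<in> carrier R" using vs uV fV by (auto simp: A_def N_def F_def)
  have IH: "a \<otimes> N \<oplus> F \<otimes> F \<in> \<mm>" using Cons.IH[OF vs(3) _ u] Cons.prems(2) by (simp add: N_def F_def f_def)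
  have A: "A \<oplus> a \<in> \<mm>" using Cons.prems by (simp add: A_def)
  have ww: "form V w w = y \<otimes> y \<otimes> A \<oplus> N"
    using vs uV y vu uv by (simp add: w form_lin A_def N_def m_assoc)
  have wf: "form V w (vsum (v # vs)) = y \<otimes> A \<oplus> F"
    using vs uV y vu uv fV vf by (simp add: w form_lin A_def F_def f_def[symmetric])
  \<comment> \<open>The cross term of the square is a multiple of 2, and
    \<open>a y^2 A + (y A)^2\<close> has the factor \<open>A + a\<close>.\<close>
  have "a \<otimes> (y \<otimes> y \<otimes> A \<oplus> N) \<oplus> (y \<otimes> A \<oplus> F) \<otimes> (y \<otimes> A \<oplus> F) =
    y \<otimes> y \<otimes> A \<otimes> (A \<oplus> a) \<oplus> (a \<otimes> N \<oplus> F \<otimes> F) \<oplus> (\<one> \<oplus> \<one>) \<otimes> (y \<otimes> A \<otimes> F)"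
    using a y cc by algebra
  also have "\<dots> \<in> \<mm>" using IH A two y cc by (simp add: I_l_closed I_r_closed)
  finally show ?case unfolding ww wf .
qed

lemma units_along_append:
  "units_along v (r @ s) \<longleftrightarrow> units_along v r \<and> units_along (add_along v r) s"
proof (induction r arbitrary: v)
  case (Cons xw r)
  then show ?case by (cases xw) simp
qed simp

lemma add_along_eq:
  "\<lbrakk>v \<in> carrier V; \<forall>(x, w)\<in>set r. x \<in> carrier R \<and> w \<in> carrier V\<rbrakk>
    \<Longrightarrow> add_along v r = v \<oplus>\<^bsub>V\<^esub> vsum (map (\<lambda>(x, w). x \<odot>\<^bsub>V\<^esub> w) r)"
proof (induction r arbitrary: v)
  case (Cons xw r)
  obtain x w where xw: "xw = (x, w)" by (cases xw)
  have "vsum (map (\<lambda>(x, w). x \<odot>\<^bsub>V\<^esub> w) r) \<in> carrier V" using Cons.prems by (intro vsum_closed) auto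
  then show ?case using Cons by (simp add: xw M.a_assoc)
qed simp

lemma add_along_ones:
  assumes "v \<in> carrier V" "set ws \<subseteq> carrier V"
  shows "add_along v (map (Pair \<one>) ws) = v \<oplus>\<^bsub>V\<^esub> vsum ws"
proof -
  have "map (\<lambda>(x, w). x \<odot>\<^bsub>V\<^esub> w) (map (Pair \<one>) ws) = ws"
    using assms(2) by (induction ws) auto
  then show ?thesis using add_along_eq[of v "map (Pair \<one>) ws"] assms by (auto simp: subset_iff)
qed

lemma orth_add_orth:
  assumes "orth (u # v # r)" "x \<in> carrier R" "form V (u \<oplus>\<^bsub>V\<^esub> x \<odot>\<^bsub>V\<^esub> v) (u \<oplus>\<^bsub>V\<^esub> x \<odot>\<^bsub>V\<^esub> v) \<in> Units R"
  shows "orth ((u \<oplus>\<^bsub>V\<^esub> x \<odot>\<^bsub>V\<^esub> v) # r)"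
proof -
  have c: "u \<in> carrier V" "v \<in> carrier V" "set r \<subseteq> carrier V" "orth r"
    "\<forall>w\<in>set r. form V u w = \<zero>" "\<forall>w\<in>set r. form V v w = \<zero>"
    using assms(1) orthD(1)[of r] by (simp_all add: orth_Cons)
  have "form V (u \<oplus>\<^bsub>V\<^esub> x \<odot>\<^bsub>V\<^esub> v) w = \<zero>" if "w \<in> set r" for w
    using that c assms(2) subsetD[OF c(3) that] by (simp add: form_lin)
  then show ?thesis using c assms(2,3) by (simp add: orth_Cons)
qed

text \<open>Modulo \<open>\<mm>\<close> each step adds \<open>p + q\<close>, and in residue
  characteristic 2 this exchanges \<open>p\<close> and \<open>q\<close>. The disjunction in the last
  hypothesis is the invariant of the induction.\<close>

lemma units_along_alternating:
  assumes two: "\<one> \<oplus> \<one> \<in> \<mm>" and p: "p \<in> Units R" and q: "q \<in> Units R"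
    and "orth (u # r)" "\<forall>v\<in>set r. form V v v \<oplus> (p \<oplus> q) \<in> \<mm>"
    "form V u u \<oplus> p \<in> \<mm> \<or> form V u u \<oplus> q \<in> \<mm>"
  shows "units_along u (map (Pair \<one>) r)"
  using assms(4-)
proof (induction r arbitrary: u)
  case (Cons v r)
  have c: "p \<in> carrier R" "q \<in> carrier R" using p q by auto
  have uv: "u \<in> carrier V" "v \<in> carrier V" "form V u v = \<zero>"
    using Cons.prems by (auto simp: orth_Cons)
  define A N where "A = form V v v" and "N = form V u u"
  have cc: "A \<in> carrier R" "N \<in> carrier R" using uv by (auto simp: A_def N_def)
  have n: "form V (u \<oplus>\<^bsub>V\<^esub> \<one> \<odot>\<^bsub>V\<^esub> v) (u \<oplus>\<^bsub>V\<^esub> \<one> \<odot>\<^bsub>V\<^esub> v) = N \<oplus> A"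
    using form_add_orth[OF uv, of \<one>] uv by (simp add: A_def N_def)
  have A: "A \<oplus> (p \<oplus> q) \<in> \<mm>" using Cons.prems by (simp add: A_def)
  have flip: "N \<oplus> A \<oplus> s \<in> \<mm>" if "N \<oplus> r \<in> \<mm>" "r \<in> carrier R" "s \<in> carrier R" "A \<oplus> (r \<oplus> s) \<in> \<mm>" for r s
  proof -
    have "N \<oplus> A \<oplus> s = (N \<oplus> r) \<oplus> (A \<oplus> (r \<oplus> s)) \<oplus> (\<one> \<oplus> \<one>) \<otimes> (\<ominus> r)" using that(2,3) cc by algebra
    also have "\<dots> \<in> \<mm>" using that two by (simp add: I_r_closed)
    finally show ?thesis .
  qed
  have qp: "A \<oplus> (q \<oplus> p) \<in> \<mm>"
  proof -
    have "A \<oplus> (q \<oplus> p) = A \<oplus> (p \<oplus> q)" using c cc by algebra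
    then show ?thesis using A by simp
  qed
  have NA: "N \<oplus> A \<oplus> p \<in> \<mm> \<or> N \<oplus> A \<oplus> q \<in> \<mm>"
    using Cons.prems(3)[folded N_def] flip[OF _ c(1) c(2) A] flip[OF _ c(2) c(1) qp] by blast
  then have U: "N \<oplus> A \<in> Units R" using Units_if_add_nonunit[of _ p] Units_if_add_nonunit[of _ q] p q cc by auto
  have "orth ((u \<oplus>\<^bsub>V\<^esub> \<one> \<odot>\<^bsub>V\<^esub> v) # r)" using orth_add_orth[OF Cons.prems(1), of \<one>] U n by simp
  then show ?case using Cons.IH[of "u \<oplus>\<^bsub>V\<^esub> \<one> \<odot>\<^bsub>V\<^esub> v"] Cons.prems(2) NA U n by simp
qed simp

end

section \<open>Moving a basis until it contains a given vector of unit norm\<close>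

context diagonal_form
begin

lemma eqv_Cons: "\<lbrakk>eqv es es'; orth (e # es)\<rbrakk> \<Longrightarrow> eqv (e # es) (e # es')"
proof -
  assume a: "eqv es es'" "orth (e # es)"
  have "eqv (e # es) (es @ [e])" by (intro eqv_perm a(2)) simp
  also have "eqv \<dots> (es' @ [e])" using calculation by (intro eqv_append a(1)) (simp add: eqv_def)
  also have "eqv \<dots> (e # es')" using calculation by (intro eqv_perm) (auto simp: eqv_def)
  finally show ?thesis .
qed

text \<open>
  Splits \<open>v\<close> into two orthogonal vectors with the help of the unused basis vector \<open>z\<close>.
\<close>

lemma eqv_break:
  assumes o: "orth (v # z # us)" and y: "y \<in> Units R"
    and s: "form V v v \<oplus> form V z z \<otimes> y \<otimes> y \<in> Units R"
  obtains p q where "eqv (v # z # us) (p # q # us)" "v = p \<oplus>\<^bsub>V\<^esub> q"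
proof -
  have cV: "v \<in> carrier V" "z \<in> carrier V" "form V v z = \<zero>" "form V v v \<in> Units R" and o2: "orth [v, z]"
    using o by (auto simp: orth_Cons)
  have yR: "y \<in> carrier R" using y by auto
  define p where "p = v \<oplus>\<^bsub>V\<^esub> y \<odot>\<^bsub>V\<^esub> z"
  define q where "q = (\<ominus> (form V z z \<otimes> y)) \<odot>\<^bsub>V\<^esub> v \<oplus>\<^bsub>V\<^esub> form V v v \<odot>\<^bsub>V\<^esub> z"
  define t where "t = form V p p"
  have t: "t \<in> Units R" using form_add_orth[OF cV(1,2,3) yR] s by (simp add: t_def p_def)
  note pr = eqv_pair[OF o2 yR, folded p_def q_def, folded t_def, OF t]
  have cpq: "p \<in> carrier V" "q \<in> carrier V" using cV yR by (auto simp: p_def q_def)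
  \<comment> \<open>The inverse base change \<open>t v = form v v p - y q\<close> has unit
    coefficients because \<open>y\<close> is a unit, so \<open>p\<close> and \<open>q\<close> can be
    rescaled until \<open>v\<close> is their sum.\<close>
  define \<alpha> \<beta> where "\<alpha> = inv t \<otimes> form V v v" and "\<beta> = inv t \<otimes> (\<ominus> y)"
  have U: "\<alpha> \<in> Units R" "\<beta> \<in> Units R" using t cV y by (auto simp: \<alpha>_def \<beta>_def Units_minus)
  have "v = inv t \<odot>\<^bsub>V\<^esub> (t \<odot>\<^bsub>V\<^esub> v)" using smult_inv_cancel[OF t cV(1)] by simp
  also have "\<dots> = \<alpha> \<odot>\<^bsub>V\<^esub> p \<oplus>\<^bsub>V\<^esub> \<beta> \<odot>\<^bsub>V\<^esub> q"
    unfolding pr(4) using cpq t cV yR by (simp add: two_comb_smult \<alpha>_def \<beta>_def)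
  finally have v: "v = \<alpha> \<odot>\<^bsub>V\<^esub> p \<oplus>\<^bsub>V\<^esub> \<beta> \<odot>\<^bsub>V\<^esub> q" .
  have e1: "eqv (v # z # us) (p # q # us)" using eqv_append[OF pr(1), of us] o by simp
  have "eqv (p # q # us) (\<alpha> \<odot>\<^bsub>V\<^esub> p # q # us)"
    using e1 by (intro eqv_scale_Cons U) (simp add: eqv_def)
  note e2 = eqv_trans[OF e1 this]
  have "eqv (q # us) (\<beta> \<odot>\<^bsub>V\<^esub> q # us)"
    using e2 by (intro eqv_scale_Cons U) (simp add: eqv_def orth_Cons)
  then have "eqv (\<alpha> \<odot>\<^bsub>V\<^esub> p # q # us) (\<alpha> \<odot>\<^bsub>V\<^esub> p # \<beta> \<odot>\<^bsub>V\<^esub> q # us)"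
    using e2 by (intro eqv_Cons) (simp_all add: eqv_def)
  from that[OF eqv_trans[OF e2 this] v] show ?thesis .
qed

text \<open>Two vectors whose norms have a unit sum are merged, and the induction continues with a
  shorter sum. The last hypothesis excludes a genuine obstruction: over a field of characteristic 2,
  with three orthogonal vectors of norm 1, every vector orthogonal to their sum has norm 0, so no
  orthogonal basis contains the sum.\<close>

lemma eqv_vsum:
  assumes "orth (vs @ zs)" "form V (vsum vs) (vsum vs) \<in> Units R"
    "zs \<noteq> [] \<or> (\<exists>w\<in>spn vs. form V w (vsum vs) = \<zero> \<and> form V w w \<in> Units R)"
  shows "\<exists>es. eqv (vs @ zs) (vsum vs # es)"
  using assms
proof (induction "length vs" arbitrary: vs zs rule: less_induct)
  case less
  have vV: "set vs \<subseteq> carrier V" and ov: "orth vs" and zV: "set zs \<subseteq> carrier V"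
    using less.prems(1) orthD(1)[of vs] orthD(1)[of zs] by (simp_all add: orth_append)
  show ?case
  proof (cases "\<exists>v w rest. mset vs = mset (v # w # rest) \<and> form V v v \<oplus> form V w w \<in> Units R")
    case True
    then obtain v w rest where m: "mset vs = mset (v # w # rest)" and s: "form V v v \<oplus> form V w w \<in> Units R"
      by blast
    have e1: "eqv (vs @ zs) (v # w # rest @ zs)" by (intro eqv_perm less.prems) (simp add: m)
    then have o: "orth (v # w # rest @ zs)" by (simp add: eqv_def)
    have c: "v \<in> carrier V" "w \<in> carrier V" "set rest \<subseteq> carrier V" "form V v w = \<zero>"
      using o by (auto simp: orth_def sorted_wrt_append)
    have s1: "form V (v \<oplus>\<^bsub>V\<^esub> \<one> \<odot>\<^bsub>V\<^esub> w) (v \<oplus>\<^bsub>V\<^esub> \<one> \<odot>\<^bsub>V\<^esub> w) \<in> Units R"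
      using form_add_orth[OF c(1,2,4), of \<one>] s c by simp
    from eqv_step[OF o one_closed s1] obtain z
      where e2: "eqv (v # w # rest @ zs) ((v \<oplus>\<^bsub>V\<^esub> \<one> \<odot>\<^bsub>V\<^esub> w) # z # rest @ zs)" .
    have e3: "eqv ((v \<oplus>\<^bsub>V\<^esub> \<one> \<odot>\<^bsub>V\<^esub> w) # z # rest @ zs) (((v \<oplus>\<^bsub>V\<^esub> w) # rest) @ z # zs)"
      using e2 c by (intro eqv_perm) (auto simp: eqv_def)
    have vs: "vsum ((v \<oplus>\<^bsub>V\<^esub> w) # rest) = vsum vs"
      using vsum_perm[OF m vV] c by (simp add: M.a_assoc)
    have l: "length ((v \<oplus>\<^bsub>V\<^esub> w) # rest) < length vs" using mset_eq_length[OF m] by simp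
    have "orth (((v \<oplus>\<^bsub>V\<^esub> w) # rest) @ z # zs)" using e3 by (simp add: eqv_def)
    from less.hyps[OF l this] less.prems(2) obtain es
      where "eqv (((v \<oplus>\<^bsub>V\<^esub> w) # rest) @ z # zs) (vsum vs # es)" unfolding vs by auto
    then show ?thesis using eqv_trans[OF eqv_trans[OF e1 e2] eqv_trans[OF e3]] by blast
  next
    case False
    have nopair: "form V v v \<oplus> form V w w \<in> \<mm>" if "mset vs = mset (v # w # rest)" for v w rest
    proof -
      have "v \<in> carrier V" "w \<in> carrier V" using vV mset_eq_setD[OF that] by auto
      then show ?thesis using False that by (intro nonunit) auto
    qed
    \<comment> \<open>With at most two vectors nothing is left to do: the norm of the sum is a unit,
      so a pair would have been merged.\<close>
    consider "vs = []" | v where "vs = [v]" | v w where "vs = [v, w]" | v w x r where "vs = v # w # x # r"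
      by (metis list.exhaust)
    then show ?thesis
    proof cases
      case 1
      then show ?thesis using less.prems(2) by (simp add: Units_iff)
    next
      case (2 v)
      then show ?thesis using less.prems(1) vV by (auto intro: eqv_refl)
    next
      case (3 v w)
      have "form V (vsum vs) (vsum vs) = form V v v \<oplus> form V w w"
        using norm_vsum_Cons[of v "[w]"] ov vV by (simp add: 3)
      then show ?thesis using nopair[of v w "[]"] less.prems(2) by (simp add: 3 Units_iff)
    next
      case (4 v w x r)
      \<comment> \<open>No two norms have a unit sum, so the residue characteristic is 2 and all norms are congruent.\<close>
      define a where "a = form V v v"
      have a: "a \<in> Units R" and vwx: "v \<in> carrier V" "w \<in> carrier V" "x \<in> carrier V"
        using ov by (auto simp: 4 orth_Cons a_def)
      have aR: "a \<in> carrier R" using a by auto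
      have near: "form V u u \<oplus> a \<in> \<mm>" if u: "u \<in> set (w # x # r)" for u
      proof -
        obtain xs ys where "w # x # r = xs @ u # ys" using u by (meson split_list)
        then have "mset vs = mset (u # v # (xs @ ys))" by (simp add: 4)
        then show ?thesis unfolding a_def by (rule nopair)
      qed
      \<comment> \<open>A third vector is needed here: from three norms with pairwise sums in
        \<open>\<mm>\<close> one obtains \<open>2 a\<close> in \<open>\<mm>\<close>.\<close>
      have two: "\<one> \<oplus> \<one> \<in> \<mm>"
      proof -
        let ?b = "form V w w" and ?c = "form V x x"
        have "?b \<oplus> ?c \<in> \<mm>" by (rule nopair[of _ _ "v # r"]) (simp add: 4)
        then have "\<ominus> (?b \<oplus> ?c) \<in> \<mm>"
          using a_subgroup subgroup.m_inv_closed[of \<mm> "add_monoid R"] by (simp add: a_inv_def)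
        then have "(?b \<oplus> a) \<oplus> (?c \<oplus> a) \<oplus> \<ominus> (?b \<oplus> ?c) \<in> \<mm>" using near by simp
        moreover have "(?b \<oplus> a) \<oplus> (?c \<oplus> a) \<oplus> \<ominus> (?b \<oplus> ?c) = (\<one> \<oplus> \<one>) \<otimes> a"
        proof -
          have "?b \<in> carrier R" "?c \<in> carrier R" using vwx by auto
          then show ?thesis using aR by algebra
        qed
        ultimately have "(\<one> \<oplus> \<one>) \<otimes> a \<notin> Units R" by (simp add: Units_iff)
        then show ?thesis using Units_mult_iff[of "\<one> \<oplus> \<one>" a] a aR by (intro nonunit) auto
      qed
      show ?thesis
      proof (cases zs)
        \<comment> \<open>All norms are congruent to \<open>a\<close>, so \<open>a form u u\<close>
          is congruent to the square of \<open>form u (vsum vs)\<close>, which is 0. This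
          contradicts the unit norm of \<open>u\<close>.\<close>
        case Nil
        then obtain u where u: "u \<in> spn vs" "form V u (vsum vs) = \<zero>" "form V u u \<in> Units R"
          using less.prems(3) by blast
        have "a \<oplus> a = (\<one> \<oplus> \<one>) \<otimes> a" using aR by algebra
        then have "a \<oplus> a \<in> \<mm>" using two aR by (simp add: I_r_closed)
        then have "\<forall>v\<in>set vs. form V v v \<oplus> a \<in> \<mm>" using near by (auto simp: 4 a_def)
        from characteristic_vector[OF two aR ov this u(1)] have "a \<otimes> form V u u \<in> \<mm>"
          using u a by (simp add: Units_closed)
        then show ?thesis using a u Units_m_closed[of a "form V u u"] by (simp add: Units_iff)
      next
        case (Cons z zs')
        have z: "form V z z \<in> Units R" "z \<in> carrier V" "form V v z = \<zero>"
          using less.prems(1) by (auto simp: Cons 4 orth_append orth_Cons)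
        \<comment> \<open>With \<open>v = p + q\<close>, summing up in the order \<open>p\<close>, \<open>w\<close>, \<open>x\<close>, \<open>r\<close>, \<open>q\<close> gives partial sums whose
          norms are alternately congruent to those of \<open>p\<close> and \<open>q\<close>.\<close>
        obtain y where y: "y \<in> Units R" "a \<oplus> form V z z \<otimes> y \<otimes> y \<in> Units R"
          by (rule ex_unit_sum[OF two a z(1)])
        let ?ws = "w # x # r"
        have e0: "eqv (vs @ zs) (v # z # ?ws @ zs')"
          by (intro eqv_perm less.prems) (simp add: 4 Cons)
        then have "orth (v # z # ?ws @ zs')" by (simp add: eqv_def)
        from eqv_break[OF this y(1)] y(2) obtain p q
          where e1: "eqv (v # z # ?ws @ zs') (p # q # ?ws @ zs')" and v: "v = p \<oplus>\<^bsub>V\<^esub> q"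
          unfolding a_def by blast
        have e2: "eqv (p # q # ?ws @ zs') (p # ?ws @ q # zs')"
          using e1 by (intro eqv_perm) (auto simp: eqv_def)
        then have o: "orth (p # ?ws @ q # zs')" by (simp add: eqv_def)
        have cpq: "p \<in> carrier V" "q \<in> carrier V" "form V p q = \<zero>" "set ?ws \<subseteq> carrier V"
          and Upq: "form V p p \<in> Units R" "form V q q \<in> Units R" and op: "orth (p # ?ws)"
          using o by (auto simp: orth_def sorted_wrt_append)
        have apq: "a = form V p p \<oplus> form V q q"
          using form_add_orth[OF cpq(1-3), of \<one>] cpq Upq by (simp add: a_def v Units_closed)
        have pp: "form V p p \<oplus> form V p p \<in> \<mm>"
        proof -
          have "form V p p \<oplus> form V p p = (\<one> \<oplus> \<one>) \<otimes> form V p p"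
            using Upq Units_closed[of "form V p p"] by (simp add: l_distr)
          then show ?thesis using two Upq by (simp add: I_r_closed Units_closed)
        qed
        have al: "units_along p (map (Pair \<one>) ?ws)"
          using near pp by (intro units_along_alternating[OF two Upq op]) (auto simp: apq)
        have f: "add_along p (map (Pair \<one>) ?ws @ [(\<one>, q)]) = vsum vs"
        proof -
          have vs: "vsum ?ws \<in> carrier V" using vsum_closed[OF cpq(4)] .
          have "add_along p (map (Pair \<one>) ?ws @ [(\<one>, q)]) = p \<oplus>\<^bsub>V\<^esub> vsum ?ws \<oplus>\<^bsub>V\<^esub> q"
            using add_along_ones[OF cpq(1,4)] cpq by simp
          also have "\<dots> = v \<oplus>\<^bsub>V\<^esub> vsum ?ws" unfolding v using cpq vs by (simp add: M.a_ac del: foldr.simps)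
          finally show ?thesis by (simp add: 4)
        qed
        \<comment> \<open>The last addition, that of \<open>q\<close>, ends at
          \<open>vsum vs\<close> itself, whose norm is a unit by assumption.\<close>
        have "units_along p (map (Pair \<one>) ?ws @ [(\<one>, q)])"
          using al less.prems(2) f by (simp add: units_along_append del: list.map)
        moreover have "orth (p # map snd (map (Pair \<one>) ?ws @ [(\<one>, q)]) @ zs')"
          using o by (simp add: comp_def)
        ultimately obtain es where
          "eqv (p # map snd (map (Pair \<one>) ?ws @ [(\<one>, q)]) @ zs') (vsum vs # es @ zs')"
          using eqv_along f by metis
        then have "eqv (p # ?ws @ q # zs') (vsum vs # es @ zs')" by (simp add: comp_def)
        then show ?thesis using eqv_trans[OF eqv_trans[OF e0 e1] eqv_trans[OF e2]] by blast
      qed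
    qed
  qed
qed

text \<open>Basis vectors with a unit coordinate in \<open>f\<close> are rescaled, by (1), until the
  coordinate is 1; they form \<open>vs\<close>. The remaining ones are kept in \<open>zl\<close>
  together with their coordinates from \<open>\<mm>\<close>.\<close>

lemma orth_split:
  assumes "orth es" "f \<in> spn es"
  shows "\<exists>vs zl. (\<forall>(x, z)\<in>set zl. x \<in> \<mm>) \<and> eqv es (vs @ map snd zl)
    \<and> f = vsum vs \<oplus>\<^bsub>V\<^esub> vsum (map (\<lambda>(x, z). x \<odot>\<^bsub>V\<^esub> z) zl)"
  using assms
proof (induction es arbitrary: f)
  case Nil
  then show ?case by (intro exI[of _ "[]"]) (simp add: eqv_refl)
next
  case (Cons e es)
  obtain x u where f: "f = x \<odot>\<^bsub>V\<^esub> e \<oplus>\<^bsub>V\<^esub> u" and x: "x \<in> carrier R" and u: "u \<in> spn es"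
    using Cons.prems by (auto simp: lspan.simps)
  have e: "e \<in> carrier V" and oes: "orth es" using Cons.prems by (auto simp: orth_Cons)
  from Cons.IH[OF oes u] obtain vs zl where zl: "\<forall>(x, z)\<in>set zl. x \<in> \<mm>"
    and ev: "eqv es (vs @ map snd zl)"
    and us: "u = vsum vs \<oplus>\<^bsub>V\<^esub> vsum (map (\<lambda>(x, z). x \<odot>\<^bsub>V\<^esub> z) zl)" by blast
  define s where "s = vsum (map (\<lambda>(x, z). x \<odot>\<^bsub>V\<^esub> z) zl)"
  have "set (vs @ map snd zl) \<subseteq> carrier V" using ev by (intro orthD) (simp add: eqv_def)
  then have c: "set vs \<subseteq> carrier V" "\<forall>(x, z)\<in>set zl. x \<in> \<mm> \<and> z \<in> carrier V" using zl by auto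
  then have vV: "vsum vs \<in> carrier V" by simp
  have sV: "s \<in> carrier V"
    unfolding s_def using c(2) by (intro vsum_closed) (auto intro!: smult_closed Icarr)
  have e1: "eqv (e # es) (e # vs @ map snd zl)" by (rule eqv_Cons[OF ev Cons.prems(1)])
  then have o1: "orth (e # vs @ map snd zl)" by (simp add: eqv_def)
  show ?case
  proof (cases "x \<in> Units R")
    case True
    have "eqv (e # es) ((x \<odot>\<^bsub>V\<^esub> e # vs) @ map snd zl)"
      using eqv_trans[OF e1 eqv_scale_Cons[OF o1 True]] by simp
    moreover have "f = vsum (x \<odot>\<^bsub>V\<^esub> e # vs) \<oplus>\<^bsub>V\<^esub> s"
      using e x vV sV by (simp add: f us s_def[symmetric] M.a_assoc)
    ultimately show ?thesis using zl unfolding s_def by blast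
  next
    case False
    then have xm: "x \<in> \<mm>" using x by (intro nonunit)
    have "eqv (e # vs @ map snd zl) (vs @ map snd ((x, e) # zl))" by (intro eqv_perm o1) simp
    then have "eqv (e # es) (vs @ map snd ((x, e) # zl))" using eqv_trans[OF e1] by blast
    moreover have "f = vsum vs \<oplus>\<^bsub>V\<^esub> vsum (map (\<lambda>(x, z). x \<odot>\<^bsub>V\<^esub> z) ((x, e) # zl))"
      using e x vV sV by (simp add: f us s_def[symmetric] M.a_lcomm)
    moreover have "\<forall>(x, z)\<in>set ((x, e) # zl). x \<in> \<mm>" using zl xm by simp
    ultimately show ?thesis by blast
  qed
qed

lemma form_vsum_nonunit:
  "\<lbrakk>\<forall>(x, z)\<in>set zl. x \<in> \<mm> \<and> z \<in> carrier V; w \<in> carrier V\<rbrakk>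
    \<Longrightarrow> form V (vsum (map (\<lambda>(x, z). x \<odot>\<^bsub>V\<^esub> z) zl)) w \<in> \<mm>"
proof (induction zl)
  case (Cons p zl)
  obtain x z where p: "p = (x, z)" by (cases p)
  have "vsum (map (\<lambda>(x, z). x \<odot>\<^bsub>V\<^esub> z) zl) \<in> carrier V"
    using Cons.prems by (intro vsum_closed) (auto intro!: smult_closed Icarr)
  then show ?case using Cons by (simp add: p form_lin I_r_closed)
qed simp

text \<open>Adding \<open>x z\<close> with \<open>x\<close> in \<open>\<mm>\<close> changes the norm
  by an element of \<open>\<mm>\<close>, so no intermediate norm can fail to be a unit.\<close>

lemma units_along_nonunits:
  "\<lbrakk>orth (v # map snd zl); \<forall>(x, z)\<in>set zl. x \<in> \<mm>\<rbrakk> \<Longrightarrow> units_along v zl"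
proof (induction zl arbitrary: v)
  case (Cons p zl)
  obtain x z where p: "p = (x, z)" by (cases p)
  have c: "v \<in> carrier V" "z \<in> carrier V" "form V v z = \<zero>" "form V v v \<in> Units R" "x \<in> \<mm>"
    using Cons.prems by (auto simp: p orth_Cons)
  have s: "form V (v \<oplus>\<^bsub>V\<^esub> x \<odot>\<^bsub>V\<^esub> z) (v \<oplus>\<^bsub>V\<^esub> x \<odot>\<^bsub>V\<^esub> z) \<in> Units R"
    using form_add_orth[OF c(1-3)] c by (simp add: Units_add_nonunit I_l_closed)
  have "orth ((v \<oplus>\<^bsub>V\<^esub> x \<odot>\<^bsub>V\<^esub> z) # map snd zl)"
    using orth_add_orth[OF _ _ s] Cons.prems(1) c by (simp add: p)
  then show ?case using Cons s c by (simp add: p)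
qed simp

text \<open>Induction on \<open>fs\<close>: the basis \<open>es\<close> is moved until it starts
  with the first vector \<open>f\<close> of \<open>fs\<close>. The two tails then span the same
  complement of \<open>f\<close>, by \<open>orth_tail_spn\<close>.\<close>

theorem cls_unique:
  assumes "orth es" "orth fs" "spn es = spn fs"
  shows "cls es = cls fs"
  using assms
proof (induction fs arbitrary: es)
  case Nil
  show ?case
  proof (cases es)
    case (Cons e r)
    then have "e \<in> spn es" using Nil spn_base[of es e] orthD(1)[of es] by simp
    then have "e = \<zero>\<^bsub>V\<^esub>" using Nil by simp
    then show ?thesis using Nil Cons by (simp add: orth_Cons Units_iff)
  qed simp
next
  case (Cons f fs)
  have f: "f \<in> carrier V" "form V f f \<in> Units R" and ofs: "orth fs" "orth (f # fs)"
    using Cons.prems by (auto simp: orth_Cons)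
  have esV: "set es \<subseteq> carrier V" using Cons.prems orthD by blast
  have fes: "f \<in> spn es" using Cons.prems spn_base[of "f # fs" f] orthD(1)[OF ofs(2)] by simp
  show ?case
  proof (cases fs)
    \<comment> \<open>Rank one is treated apart, because there is no second vector of
      \<open>fs\<close> to serve as the witness that \<open>eqv_vsum\<close> may ask for. Every
      vector of \<open>es\<close> is a unit multiple of \<open>f\<close>, and two such multiples
      cannot be orthogonal.\<close>
    case Nil
    have mult: "\<exists>x\<in>Units R. e = x \<odot>\<^bsub>V\<^esub> f" if "e \<in> set es" for e
    proof -
      have "e \<in> spn [f]" using spn_base[OF esV that] Cons.prems(3) Nil by simp
      then obtain x where x: "x \<in> carrier R" "e = x \<odot>\<^bsub>V\<^esub> f" using f by (auto simp: lspan.simps)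
      have "form V e e = x \<otimes> (x \<otimes> form V f f)" using x f by (simp add: form_lin)
      then have "x \<in> Units R" using orthD(2)[OF Cons.prems(1) that] x f by (simp add: Units_mult_iff)
      then show ?thesis using x by blast
    qed
    show ?thesis
    proof (cases es)
      case Nil
      then have "f = \<zero>\<^bsub>V\<^esub>" using fes by simp
      then show ?thesis using f by (simp add: Units_iff)
    next
      case es: (Cons e r)
      obtain x where x: "x \<in> Units R" "e = x \<odot>\<^bsub>V\<^esub> f" using mult[of e] es by auto
      show ?thesis
      proof (cases r)
        case Nil
        have "form V e e = x \<otimes> x \<otimes> form V f f" using x f by (simp add: form_lin Units_closed m_assoc)
        then show ?thesis using c_square[OF x(1) f(2)] by (simp add: es Nil \<open>fs = []\<close>)
      next
        case (Cons e' r')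
        obtain y where y: "y \<in> Units R" "e' = y \<odot>\<^bsub>V\<^esub> f" using mult[of e'] es Cons by auto
        have "form V e e' = y \<otimes> (x \<otimes> form V f f)" using x y f by (simp add: form_lin Units_closed)
        moreover have "form V e e' = \<zero>" using \<open>orth es\<close> by (simp add: es Cons orth_Cons)
        ultimately have "\<zero> \<in> Units R" using x y f by (metis Units_m_closed)
        then show ?thesis by (simp add: Units_iff)
      qed
    qed
  next
    case fs: (Cons w fs')
    obtain vs zl where zl: "\<forall>(x, z)\<in>set zl. x \<in> \<mm>" and ev: "eqv es (vs @ map snd zl)"
      and fsum: "f = vsum vs \<oplus>\<^bsub>V\<^esub> vsum (map (\<lambda>(x, z). x \<odot>\<^bsub>V\<^esub> z) zl)"
      using orth_split[OF Cons.prems(1) fes] by blast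
    define s where "s = vsum (map (\<lambda>(x, z). x \<odot>\<^bsub>V\<^esub> z) zl)"
    have o1: "orth (vs @ map snd zl)" using ev by (simp add: eqv_def)
    then have cV: "set vs \<subseteq> carrier V" "set (map snd zl) \<subseteq> carrier V"
      using orthD(1)[OF o1] by auto
    have zl2: "\<forall>(x, z)\<in>set zl. x \<in> \<mm> \<and> z \<in> carrier V" using zl cV(2) by auto
    have sV: "s \<in> carrier V"
      unfolding s_def using zl2 by (intro vsum_closed) (auto intro!: smult_closed Icarr)
    have "vs \<noteq> []"
    proof
      assume "vs = []"
      then have "f = s" using fsum sV by (simp add: s_def)
      then have "form V f f \<in> \<mm>" using form_vsum_nonunit[OF zl2 f(1)] by (simp add: s_def)
      then show False using f by (simp add: Units_iff)
    qed
    then obtain v vs' where vs: "vs = v # vs'" by (cases vs) auto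
    have vV: "v \<in> carrier V" "set vs' \<subseteq> carrier V" using cV by (auto simp: vs)
    \<comment> \<open>The whole part of \<open>f\<close> with coefficients in \<open>\<mm>\<close>
      is added to the single vector \<open>v\<close>. Afterwards \<open>f\<close> is a plain sum of
      orthogonal basis vectors, as \<open>eqv_vsum\<close> expects.\<close>
    have e1: "eqv (vs @ map snd zl) (v # map snd zl @ vs')" by (intro eqv_perm o1) (simp add: vs)
    then have o2: "orth (v # map snd zl @ vs')" by (simp add: eqv_def)
    then have "units_along v zl" using zl by (intro units_along_nonunits) (simp_all add: orth_Cons orth_append)
    from eqv_along[OF o2 this] obtain zs
      where e2: "eqv (v # map snd zl @ vs') (add_along v zl # zs @ vs')" by blast
    have al: "add_along v zl = v \<oplus>\<^bsub>V\<^esub> s"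
      unfolding s_def using zl2 by (intro add_along_eq vV) (auto intro: Icarr)
    have e3: "eqv (add_along v zl # zs @ vs') (((v \<oplus>\<^bsub>V\<^esub> s) # vs') @ zs)"
      unfolding al[symmetric] using e2 by (intro eqv_perm) (auto simp: eqv_def)
    have fs2: "vsum ((v \<oplus>\<^bsub>V\<^esub> s) # vs') = f"
      using vV sV by (simp add: fsum vs s_def[symmetric] M.a_ac)
    have e4: "eqv es (((v \<oplus>\<^bsub>V\<^esub> s) # vs') @ zs)"
      using eqv_trans[OF eqv_trans[OF ev e1] eqv_trans[OF e2 e3]] .
    \<comment> \<open>If no basis vector is left over, the second vector \<open>w\<close> of the
      other basis is a unit norm vector orthogonal to \<open>f\<close> in the same span, so
      \<open>f\<close> is not characteristic.\<close>
    have "zs \<noteq> [] \<or> (\<exists>w\<in>spn ((v \<oplus>\<^bsub>V\<^esub> s) # vs'). form V w f = \<zero> \<and> form V w w \<in> Units R)"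
    proof (cases "zs = []")
      case True
      have "w \<in> spn es" using Cons.prems(3) spn_base[of "f # fs" w] orthD(1)[OF ofs(2)] fs by simp
      then have "w \<in> spn ((v \<oplus>\<^bsub>V\<^esub> s) # vs')" using e4 True by (simp add: eqv_def)
      moreover have "form V w w \<in> Units R" "w \<in> carrier V" "form V f w = \<zero>"
        using ofs by (auto simp: fs orth_Cons)
      ultimately show ?thesis using symmetric[of w f] f by auto
    qed simp
    then obtain es' where e5: "eqv (((v \<oplus>\<^bsub>V\<^esub> s) # vs') @ zs) (f # es')"
      using eqv_vsum[of "(v \<oplus>\<^bsub>V\<^esub> s) # vs'" zs] e4 f unfolding fs2 by (auto simp: eqv_def)
    have e6: "eqv es (f # es')" using eqv_trans[OF e4 e5] .
    then have o6: "orth (f # es')" and s6: "spn (f # es') = spn (f # fs)"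
      using Cons.prems by (auto simp: eqv_def)
    have "spn es' = spn fs" using orth_tail_spn[OF o6] orth_tail_spn[OF ofs(2)] s6 by simp
    then have "cls es' = cls fs" using Cons.IH[of es'] o6 ofs by (simp add: orth_Cons)
    then show ?thesis using e6 by (simp add: eqv_def)
  qed
qed

end

subsection \<open>Existence of orthogonal bases\<close>

text \<open>
  Names for \<open>r_neg\<close> and \<open>a_comm\<close> that are not shadowed inside a module.
\<close>

lemma (in cring) add_uminus_self: "x \<in> carrier R \<Longrightarrow> x \<oplus> \<ominus> x = \<zero>"
  by (rule r_neg)

lemma (in cring) add_commute: "\<lbrakk>x \<in> carrier R; y \<in> carrier R\<rbrakk> \<Longrightarrow> x \<oplus> y = y \<oplus> x"
  by (rule a_comm)

context module
begin

lemma lspan_append: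
  assumes I: "ideal I R" and "x \<in> lspan I (vs @ ws)" "set vs \<subseteq> carrier M" "set ws \<subseteq> carrier M"
  obtains y z where "y \<in> lspan I vs" "z \<in> lspan I ws" "x = y \<oplus>\<^bsub>M\<^esub> z"
  using assms(2-)
proof (induction vs arbitrary: x thesis)
  case Nil
  have "x \<in> carrier M" using Nil lspan_closed[of I ws] ideal.Icarr[OF I] by auto
  then show ?case using Nil(1)[of "\<zero>\<^bsub>M\<^esub>" x] Nil by simp
next
  case (Cons v vs)
  then obtain a w where x: "x = a \<odot>\<^bsub>M\<^esub> v \<oplus>\<^bsub>M\<^esub> w" "a \<in> I" "w \<in> lspan I (vs @ ws)" by auto
  then obtain y z where yz: "y \<in> lspan I vs" "z \<in> lspan I ws" "w = y \<oplus>\<^bsub>M\<^esub> z"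
    using Cons.IH[of w] Cons.prems by auto
  have "I \<subseteq> carrier R" using ideal.Icarr[OF I] by blast
  then have "a \<in> carrier R" "y \<in> carrier M" "z \<in> carrier M" "v \<in> carrier M"
    using x(2) yz(1,2) Cons.prems(3,4) lspan_closed[of I vs] lspan_closed[of I ws] by auto
  then have "x = (a \<odot>\<^bsub>M\<^esub> v \<oplus>\<^bsub>M\<^esub> y) \<oplus>\<^bsub>M\<^esub> z" using x yz by (simp add: M.a_assoc)
  moreover have "a \<odot>\<^bsub>M\<^esub> v \<oplus>\<^bsub>M\<^esub> y \<in> lspan I (v # vs)" using x yz by auto
  ultimately show ?case using Cons.prems(1) yz by blast
qed

end

section \<open>Nakayama's lemma\<close>

locale local_module = local_ring \<mm> R + module R M for \<mm> and R :: "('a, 'r) ring_scheme" (structure) and M :: "('a, 'b, 'm) module_scheme"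
begin

text \<open>Generators are eliminated one at a time: \<open>g = a g + w\<close> with
  \<open>a\<close> in \<open>\<mm>\<close> gives \<open>g\<close> as the inverse of
  \<open>1 - a\<close> times \<open>w\<close>, so \<open>g\<close> lies in the
  \<open>\<mm>\<close>-span of the others and can be substituted in their equations.\<close>

lemma Nakayama:
  assumes "set gs \<subseteq> carrier M" "set gs \<subseteq> lspan \<mm> gs"
  shows "set gs \<subseteq> {\<zero>\<^bsub>M\<^esub>}"
  using assms
proof (induction gs)
  case (Cons g gs)
  have c: "g \<in> carrier M" "set gs \<subseteq> carrier M" using Cons.prems by auto
  note id = ideal_axioms
  have mR: "\<mm> \<subseteq> carrier R" by (auto intro: Icarr)
  obtain a w where g: "g = a \<odot>\<^bsub>M\<^esub> g \<oplus>\<^bsub>M\<^esub> w" and a: "a \<in> \<mm>" and w: "w \<in> lspan \<mm> gs"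
    using Cons.prems by auto
  have aR: "a \<in> carrier R" and wM: "w \<in> carrier M" using a w lspan_closed[OF mR c(2)] by (auto intro: Icarr)
  define u where "u = \<one> \<ominus> a"
  have u: "u \<in> Units R"
    using a aR Units_add_nonunit[of \<one> "\<ominus> a"] a_subgroup subgroup.m_inv_closed[of \<mm> "add_monoid R" a]
    by (simp add: u_def a_minus_def a_inv_def)
  have uR: "u \<in> carrier R" using u by auto
  have "u \<odot>\<^bsub>M\<^esub> g = \<one> \<odot>\<^bsub>M\<^esub> g \<oplus>\<^bsub>M\<^esub> (\<ominus> a) \<odot>\<^bsub>M\<^esub> g"
    using aR c by (simp add: u_def a_minus_def smult_l_distr)
  also have "\<dots> = (a \<odot>\<^bsub>M\<^esub> g \<oplus>\<^bsub>M\<^esub> w) \<oplus>\<^bsub>M\<^esub> (\<ominus> a) \<odot>\<^bsub>M\<^esub> g" using g c by simp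
  also have "\<dots> = w" using aR c wM by (simp add: smult_l_minus M.a_ac M.r_neg M.r_neg1)
  finally have "inv u \<odot>\<^bsub>M\<^esub> w = g" using smult_inv_cancel[OF u c(1)] by simp
  then have gm: "g \<in> lspan \<mm> gs" using lspan_smult[OF id c(2) w] u by fastforce
  have "set gs \<subseteq> lspan \<mm> gs"
  proof
    fix h assume "h \<in> set gs"
    then obtain b w' where h: "h = b \<odot>\<^bsub>M\<^esub> g \<oplus>\<^bsub>M\<^esub> w'" "b \<in> \<mm>" "w' \<in> lspan \<mm> gs" using Cons.prems by auto
    then show "h \<in> lspan \<mm> gs"
      using lspan_add[OF id c(2)] lspan_smult[OF id c(2) gm] Icarr by simp
  qed
  then have z: "set gs \<subseteq> {\<zero>\<^bsub>M\<^esub>}" using Cons.IH c by simp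
  have "lspan \<mm> gs \<subseteq> {\<zero>\<^bsub>M\<^esub>}" using z
    by (induction gs) (auto simp: Icarr)
  then show ?case using z gm by auto
qed simp

end

section \<open>Orthogonalisation over a local ring\<close>

locale local_form = local_ring \<mm> R + form_space R V
  for \<mm> and R :: "('a, 'r) ring_scheme" (structure) and V :: "('a, 'b, 'v) form_module_scheme"
begin

sublocale local_module \<mm> R V ..

declare lspan.simps(2) [simp del]

text \<open>Gram-Schmidt; the only divisions are by norms of members of \<open>es\<close>, which are
  units.\<close>

lemma orth_project:
  assumes "orth es" "h \<in> carrier V"
  shows "\<exists>h'\<in>carrier V. (\<forall>e\<in>set es. form V e h' = \<zero>) \<and> h \<in> spn (h' # es)"
  using assms(1)
proof (induction es)
  case Nil
  then show ?case using assms spn_base[of "[h]" h] by auto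
next
  case (Cons e es)
  have c: "e \<in> carrier V" "form V e e \<in> Units R" "set es \<subseteq> carrier V" "\<forall>w\<in>set es. form V e w = \<zero>" "orth es"
    using Cons.prems orthD(1)[of es] by (auto simp: orth_Cons)
  from Cons.IH[OF c(5)] obtain k where k: "k \<in> carrier V" "\<forall>w\<in>set es. form V w k = \<zero>" "h \<in> spn (k # es)"
    by blast
  define t where "t = inv (form V e e) \<otimes> form V e k"
  have t: "t \<in> carrier R" using c k by (simp add: t_def)
  define h' where "h' = k \<oplus>\<^bsub>V\<^esub> (\<ominus> t) \<odot>\<^bsub>V\<^esub> e"
  have h': "h' \<in> carrier V" using k t c by (simp add: h'_def)
  have "form V e h' = \<zero>"
  proof -
    have "\<ominus> t \<otimes> form V e e = \<ominus> form V e k"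
    proof -
      have "t \<otimes> form V e e = form V e e \<otimes> inv (form V e e) \<otimes> form V e k"
        using c k unfolding t_def by (simp add: m_ac Units_closed del: Units_r_inv Units_l_inv)
      then show ?thesis using c k t by (simp add: l_minus Units_closed)
    qed
    then show ?thesis using c k t by (simp add: h'_def form_lin add_uminus_self)
  qed
  moreover have "form V w h' = \<zero>" if "w \<in> set es" for w
  proof -
    have "w \<in> carrier V" using that c by auto
    then show ?thesis using that c k t symmetric[of w e] by (simp add: h'_def form_lin)
  qed
  moreover have "h \<in> spn (h' # e # es)"
  proof -
    have S: "set (h' # e # es) \<subseteq> carrier V" using h' c by simp
    have "k = h' \<oplus>\<^bsub>V\<^esub> t \<odot>\<^bsub>V\<^esub> e" using k c t by (simp add: h'_def smult_l_minus M.a_assoc M.l_neg)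
    moreover have "h' \<oplus>\<^bsub>V\<^esub> t \<odot>\<^bsub>V\<^esub> e \<in> spn (h' # e # es)"
      by (intro spn_add[OF S] spn_smult[OF S] spn_base[OF S] t) auto
    ultimately have "k \<in> spn (h' # e # es)" by simp
    then have "set (k # es) \<subseteq> spn (h' # e # es)" using spn_base[OF S] by auto
    then show ?thesis using spn_least[OF _ S] k by blast
  qed
  ultimately show ?case using h' by auto
qed

lemma orth_spn_zero:
  assumes "orth es" "u \<in> spn es" "\<forall>e\<in>set es. form V u e = \<zero>"
  shows "u = \<zero>\<^bsub>V\<^esub>"
  using assms
proof (induction es arbitrary: u)
  case (Cons e es)
  have c: "e \<in> carrier V" "set es \<subseteq> carrier V" "orth es" using Cons.prems orthD(1)[of es] by (auto simp: orth_Cons)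
  have u: "u \<in> carrier V" using Cons.prems(2) spn_closed[of "e # es"] c by auto
  have "form V e u = \<zero>" using Cons.prems(3) symmetric[of e u] c u by simp
  then have "u \<in> spn es" using orth_tail_spn[OF Cons.prems(1)] Cons.prems(2) by simp
  then show ?case using Cons c by simp
qed simp

lemma form_nonunit_spn:
  assumes "x \<in> carrier V" "set es \<subseteq> carrier V" "\<forall>e\<in>set es. form V x e \<in> \<mm>" "w \<in> spn es"
  shows "form V x w \<in> \<mm>"
  using assms(2-4)
proof (induction es arbitrary: w)
  case (Cons e es)
  then obtain a u where w: "w = a \<odot>\<^bsub>V\<^esub> e \<oplus>\<^bsub>V\<^esub> u" "a \<in> carrier R" "u \<in> spn es" by (auto simp: lspan.simps)
  then have "u \<in> carrier V" "form V x u \<in> \<mm>" using Cons spn_closed[of es] by auto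
  then show ?case using w Cons.prems assms(1) by (simp add: form_lin I_l_closed)
qed (use assms in simp)

text \<open>
  The hypothesis on \<open>ys\<close> replaces non-degeneracy: if all products with \<open>x\<close> lie in \<open>\<mm>\<close>, so do the
  coordinates of \<open>x\<close> in a dual basis.
\<close>

lemma ex_orth_basis:
  assumes ys: "set ys \<subseteq> carrier V"
    and frame: "\<And>x. \<lbrakk>x \<in> carrier V; \<forall>y\<in>carrier V. form V y x \<in> \<mm>\<rbrakk> \<Longrightarrow> x \<in> lspan \<mm> ys"
    and "orth es" "es \<noteq> []" "set gs \<subseteq> carrier V" "spn (es @ gs) = carrier V"
  shows "\<exists>fs. orth fs \<and> spn fs = carrier V"
  using assms(3-)
proof (induction "length gs" arbitrary: es gs rule: less_induct)
  case less
  have esV: "set es \<subseteq> carrier V" using less.prems orthD by blast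
  have "\<forall>g\<in>set gs. \<exists>h\<in>carrier V. (\<forall>e\<in>set es. form V e h = \<zero>) \<and> g \<in> spn (h # es)"
    using orth_project[OF less.prems(1)] less.prems(3) by blast
  then obtain p where p: "\<forall>g\<in>set gs. p g \<in> carrier V \<and> (\<forall>e\<in>set es. form V e (p g) = \<zero>) \<and> g \<in> spn (p g # es)"
    by metis
  define hs where "hs = map p gs"
  have len: "length hs = length gs" by (simp add: hs_def)
  have hsV: "set hs \<subseteq> carrier V" and perp: "\<And>e h. \<lbrakk>e \<in> set es; h \<in> set hs\<rbrakk> \<Longrightarrow> form V e h = \<zero>"
    using p by (auto simp: hs_def)
  have full: "carrier V \<subseteq> spn (es @ hs)"
  proof -
    have S: "set (es @ hs) \<subseteq> carrier V" using esV hsV by simp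
    have "g \<in> spn (es @ hs)" if g: "g \<in> set gs" for g
    proof -
      have "set (p g # es) \<subseteq> spn (es @ hs)"
        using spn_base[OF S] g by (auto simp: hs_def)
      then show ?thesis using spn_least[OF _ S] p g by blast
    qed
    then have "set (es @ gs) \<subseteq> spn (es @ hs)" using spn_base[OF S] by auto
    then show ?thesis using spn_least[OF _ S] less.prems(4) by blast
  qed
  \<comment> \<open>A round may change \<open>es\<close> itself. It is enough that the new vectors
    span everything and that fewer of them remain to be treated.\<close>
  have step: ?case if "orth es'" "es' \<noteq> []" "set gs' \<subseteq> carrier V" "length gs' < length gs"
      "set (es @ hs) \<subseteq> spn (es' @ gs')" for es' gs'
  proof -
    have S: "set (es' @ gs') \<subseteq> carrier V" using that orthD(1) by auto
    have "spn (es @ hs) \<subseteq> spn (es' @ gs')" by (rule spn_least[OF that(5) S])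
    then have "spn (es' @ gs') = carrier V" using full spn_closed[OF S] by blast
    then show ?thesis using less.hyps[OF that(4,1,2,3)] by blast
  qed
  show ?case
  proof (cases "\<exists>g\<in>set hs. form V g g \<in> Units R")
    case True
    then obtain xs g zs where g: "hs = xs @ g # zs" "form V g g \<in> Units R" by (meson split_list)
    have "orth (g # es)"
      using g hsV less.prems(1) perp symmetric esV by (auto simp: orth_Cons subset_iff)
    moreover have S: "set ((g # es) @ xs @ zs) \<subseteq> carrier V" using hsV esV g by auto
    moreover have "set (es @ hs) \<subseteq> spn ((g # es) @ xs @ zs)"
      using spn_base[OF S] by (auto simp: g)
    ultimately show ?thesis using len g by (intro step[of "g # es" "xs @ zs"]) auto
  next
    case False
    then have norms: "form V g g \<in> \<mm>" if "g \<in> set hs" for g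
      using that hsV by (intro nonunit) auto
    show ?thesis
    proof (cases "\<exists>g\<in>set hs. \<exists>h\<in>set hs. form V g h \<in> Units R")
      case True
      then obtain g h where gh: "g \<in> set hs" "h \<in> set hs" "form V g h \<in> Units R" by blast
      have "g \<noteq> h" using gh norms by (auto simp: Units_iff)
      obtain xs zs where hs: "hs = xs @ h # zs" using gh by (meson split_list)
      have g': "g \<in> set (xs @ zs)" using gh \<open>g \<noteq> h\<close> by (auto simp: hs)
      obtain e es1 where es: "es = e # es1" using less.prems(2) by (cases es) auto
      have c: "e \<in> carrier V" "g \<in> carrier V" "h \<in> carrier V" "form V e e \<in> Units R"
        "set es1 \<subseteq> carrier V" "orth es1" "\<forall>w\<in>set es1. form V e w = \<zero>"
        using less.prems(1) esV hsV gh by (auto simp: es orth_Cons)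
      have perp2: "form V e g = \<zero>" "form V e h = \<zero>" "form V g e = \<zero>" "form V h e = \<zero>"
        using perp gh symmetric c by (auto simp: es)
      have hg: "form V h g = form V g h" using symmetric c by simp
      \<comment> \<open>All norms in the complement are non-units, so \<open>e\<close> itself is traded in: \<open>e + g\<close> and \<open>h\<close>
        made orthogonal to it both have unit norm.\<close>
      define q where "q = e \<oplus>\<^bsub>V\<^esub> g"
      have qV: "q \<in> carrier V" using c by (simp add: q_def)
      have qq: "form V q q \<in> Units R"
        using c perp2 norms[OF gh(1)] by (simp add: q_def form_lin Units_add_nonunit)
      define t where "t = inv (form V q q) \<otimes> form V g h"
      have tU: "t \<in> Units R" using qq gh by (simp add: t_def)
      then have t: "t \<in> carrier R" by auto
      have tq: "t \<otimes> form V q q = form V g h"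
      proof -
        have "t \<otimes> form V q q = form V q q \<otimes> inv (form V q q) \<otimes> form V g h"
          using qq c qV unfolding t_def by (simp add: m_ac Units_closed del: Units_r_inv Units_l_inv)
        then show ?thesis using qq c by simp
      qed
      define r where "r = h \<oplus>\<^bsub>V\<^esub> (\<ominus> t) \<odot>\<^bsub>V\<^esub> q"
      have rV: "r \<in> carrier V" using c t qV by (simp add: r_def)
      have qh: "form V q h = form V g h" using c perp2 by (simp add: q_def form_lin)
      have qr: "form V q r = \<zero>"
      proof -
        have "form V q r = form V g h \<oplus> \<ominus> (t \<otimes> form V q q)"
          using c t qV by (simp add: r_def form_lin qh l_minus)
        then show ?thesis using tq c by (simp add: add_uminus_self)
      qed
      have hr: "form V h r = form V h h \<oplus> \<ominus> (t \<otimes> form V g h)"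
        using c t qV symmetric[of h q] by (simp add: r_def form_lin qh l_minus)
      have "form V r r = form V h r \<oplus> \<ominus> t \<otimes> form V q r"
      proof -
        have "form V r r = form V (h \<oplus>\<^bsub>V\<^esub> (\<ominus> t) \<odot>\<^bsub>V\<^esub> q) r" by (simp add: r_def)
        then show ?thesis using c t qV rV by (simp add: form_lin)
      qed
      \<comment> \<open>The norm of \<open>h\<close> lies in \<open>\<mm>\<close>, and
        \<open>t form g h\<close> is a product of units.\<close>
      then have "form V r r = \<ominus> (t \<otimes> form V g h) \<oplus> form V h h"
        using qr c t hr by (simp add: add_commute)
      then have rr: "form V r r \<in> Units R"
        using norms[OF gh(2)] tU gh by (simp add: Units_add_nonunit Units_minus)
      have es1: "form V w q = \<zero>" "form V w r = \<zero>" if "w \<in> set es1" for w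
      proof -
        have w: "w \<in> carrier V" using that c by auto
        have "form V w g = \<zero>" "form V w h = \<zero>" "form V w e = \<zero>"
          using perp gh that symmetric[of w e] w c by (auto simp: es)
        then show "form V w q = \<zero>" using w c by (simp add: q_def form_lin)
        then show "form V w r = \<zero>" using w c t qV \<open>form V w h = \<zero>\<close> by (simp add: r_def form_lin)
      qed
      have "orth (q # r # es1)"
        using qV rV qq rr qr c es1 symmetric by (auto simp: orth_Cons subset_iff)
      moreover have S: "set ((q # r # es1) @ xs @ zs) \<subseteq> carrier V" using hsV c qV rV hs by auto
      \<comment> \<open>The vector \<open>g\<close> stays among the remaining ones, so that
        \<open>e = q - g\<close> can be recovered. It is not orthogonal to \<open>q\<close> in
        general, but the next round projects again.\<close>
      moreover have "set (es @ hs) \<subseteq> spn ((q # r # es1) @ xs @ zs)"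
      proof -
        note b = spn_base[OF S]
        have "e = q \<oplus>\<^bsub>V\<^esub> (\<ominus> \<one>) \<odot>\<^bsub>V\<^esub> g" using c by (simp add: q_def smult_l_minus M.a_assoc M.r_neg)
        moreover have "q \<oplus>\<^bsub>V\<^esub> (\<ominus> \<one>) \<odot>\<^bsub>V\<^esub> g \<in> spn ((q # r # es1) @ xs @ zs)"
          using g' by (intro spn_add[OF S] spn_smult[OF S] b) auto
        ultimately have 1: "e \<in> spn ((q # r # es1) @ xs @ zs)" by simp
        have "h = r \<oplus>\<^bsub>V\<^esub> t \<odot>\<^bsub>V\<^esub> q" using c t qV by (simp add: r_def smult_l_minus M.a_assoc M.l_neg)
        moreover have "r \<oplus>\<^bsub>V\<^esub> t \<odot>\<^bsub>V\<^esub> q \<in> spn ((q # r # es1) @ xs @ zs)"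
          using t by (intro spn_add[OF S] spn_smult[OF S] b) auto
        ultimately have 2: "h \<in> spn ((q # r # es1) @ xs @ zs)" by simp
        show ?thesis using 1 2 b by (auto simp: es hs)
      qed
      ultimately show ?thesis using len hs by (intro step[of "q # r # es1" "xs @ zs"]) auto
    next
      case False
      have small: "form V g h \<in> \<mm>" if "g \<in> set hs" "h \<in> set hs" for g h
        using that False hsV by (intro nonunit form_closed) auto
      \<comment> \<open>Now each member of \<open>hs\<close> has all its products in
        \<open>\<mm>\<close>, so \<open>frame\<close> gives it coefficients in \<open>\<mm>\<close>,
        and Nakayama's lemma will make it vanish.\<close>
      have "set hs \<subseteq> lspan \<mm> hs"
      proof
        fix g assume g: "g \<in> set hs"
        have gV: "g \<in> carrier V" using g hsV by auto
        have S: "set (es @ hs) \<subseteq> carrier V" using esV hsV by simp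
        have ge: "form V g e = \<zero>" if "e \<in> set es" for e
          using perp[OF that g] symmetric[of e g] that esV gV by auto
        have "\<forall>y\<in>set (es @ hs). form V g y \<in> \<mm>" using ge small g by auto
        then have "form V g y \<in> \<mm>" if "y \<in> carrier V" for y
          using form_nonunit_spn[OF gV S] full that by blast
        then have "\<forall>y\<in>carrier V. form V y g \<in> \<mm>" using symmetric gV by simp
        then have "g \<in> lspan \<mm> ys" using frame gV by blast
        then have "g \<in> lspan \<mm> (es @ hs)"
          using lspan_least[OF ideal_axioms _ S, of ys] ys full by blast
        from lspan_append[OF ideal_axioms this esV hsV] obtain u w
          where uw: "u \<in> lspan \<mm> es" "w \<in> lspan \<mm> hs" "g = u \<oplus>\<^bsub>V\<^esub> w" .
        have "lspan \<mm> es \<subseteq> spn es" "lspan \<mm> hs \<subseteq> spn hs" by (intro lspan_mono; auto intro: Icarr)+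
        then have u: "u \<in> spn es" "u \<in> carrier V" and w: "w \<in> spn hs" "w \<in> carrier V"
          using uw spn_closed[OF esV] spn_closed[OF hsV] by auto
        \<comment> \<open>The component \<open>u\<close> in the span of \<open>es\<close> is
          orthogonal to \<open>es\<close>, because \<open>g\<close> and \<open>w\<close> are; hence
          it is 0 and the coefficients over \<open>hs\<close> alone suffice.\<close>
        have "form V u e = \<zero>" if e: "e \<in> set es" for e
        proof -
          have eV: "e \<in> carrier V" using e esV by auto
          have "form V e w = \<zero>" using form_spn_zero[OF eV hsV _ w(1)] perp e by blast
          moreover have "form V e g = \<zero>" using perp e g by blast
          ultimately have "form V e u = \<zero>" using u w eV by (simp add: uw(3) form_lin)
          then show ?thesis using symmetric u eV by simp
        qed
        then have "u = \<zero>\<^bsub>V\<^esub>" using orth_spn_zero[OF less.prems(1) u(1)] by blast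
        then show "g \<in> lspan \<mm> hs" using uw w by simp
      qed
      then have z: "set hs \<subseteq> {\<zero>\<^bsub>V\<^esub>}" by (rule Nakayama[OF hsV])
      have "set (es @ hs) \<subseteq> spn es"
        using z spn_base[OF esV] lspan_zero[OF _ esV, of "carrier R"] by auto
      then have "spn es = carrier V" using spn_least[OF _ esV] full spn_closed[OF esV] by blast
      then show ?thesis using less.prems(1) by blast
    qed
  qed
qed

end

subsection \<open>Linear and bilinear maps\<close>

lemma linear_mapsI:
  assumes "\<And>x. x \<in> carrier V \<Longrightarrow> f x \<in> carrier W"
    and "\<And>x y. \<lbrakk>x \<in> carrier V; y \<in> carrier V\<rbrakk> \<Longrightarrow> f (x \<oplus>\<^bsub>V\<^esub> y) = f x \<oplus>\<^bsub>W\<^esub> f y"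
    and "\<And>a x. \<lbrakk>a \<in> carrier R; x \<in> carrier V\<rbrakk> \<Longrightarrow> f (a \<odot>\<^bsub>V\<^esub> x) = a \<odot>\<^bsub>W\<^esub> f x"
  shows "f \<in> linear_maps R V W"
  using assms by (auto simp: linear_maps_def hom_def)

lemma linear_mapsD:
  assumes "f \<in> linear_maps R V W"
  shows "x \<in> carrier V \<Longrightarrow> f x \<in> carrier W"
    and "\<lbrakk>x \<in> carrier V; y \<in> carrier V\<rbrakk> \<Longrightarrow> f (x \<oplus>\<^bsub>V\<^esub> y) = f x \<oplus>\<^bsub>W\<^esub> f y"
    and "\<lbrakk>a \<in> carrier R; x \<in> carrier V\<rbrakk> \<Longrightarrow> f (a \<odot>\<^bsub>V\<^esub> x) = a \<odot>\<^bsub>W\<^esub> f x"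
  using assms by (auto simp: linear_maps_def hom_def)

lemma linear_maps_comp:
  assumes "f \<in> linear_maps R V W" "g \<in> linear_maps R W U"
  shows "(\<lambda>x. g (f x)) \<in> linear_maps R V U"
  by (rule linear_mapsI) (simp_all add: linear_mapsD[OF assms(1)] linear_mapsD[OF assms(2)])

lemma linear_maps_id: "(\<lambda>x. x) \<in> linear_maps R V V"
  by (rule linear_mapsI) simp_all

text \<open>The test modules of \<open>projective_module\<close> and \<open>tensor_product\<close>
  are plain \<open>module\<close> records, so spaces with a form become tests only after
  truncation.\<close>

lemma linear_maps_truncate [simp]:
  "linear_maps R V (module.truncate W) = linear_maps R V W"
  "linear_maps R (module.truncate V) W = linear_maps R V W"
  by (auto simp: linear_maps_def hom_def module.truncate_def)

lemma truncate_simps [simp]: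
  "carrier (module.truncate W) = carrier W" "smult (module.truncate W) = smult W"
  "add (module.truncate W) = add W" "ring.zero (module.truncate W) = ring.zero W"
  by (auto simp: module.truncate_def)

lemma finsum_record_cong:
  "\<lbrakk>carrier V = carrier W; add V = add W; ring.zero V = ring.zero W\<rbrakk> \<Longrightarrow> finsum V = finsum W"
  by (intro ext) (simp add: finsum_def finprod_def)

lemma abelian_group_record_cong:
  assumes "abelian_group V" "carrier W = carrier V" "add W = add V" "ring.zero W = ring.zero V"
  shows "abelian_group W"
proof -
  interpret V: abelian_group V by fact
  show ?thesis
    by (rule abelian_groupI) (auto simp: assms(2-) V.a_assoc intro: V.a_comm V.add.l_inv_ex)
qed

lemma module_truncate:
  assumes "module R V" shows "module R (module.truncate V)"
proof -
  interpret module R V by (rule assms)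
  show ?thesis
  proof (rule moduleI)
    show "abelian_group (module.truncate V)"
      by (rule abelian_group_record_cong[OF M.abelian_group_axioms]) simp_all
  qed (simp_all add: smult_l_distr smult_r_distr smult_assoc1 R.is_cring)
qed

lemma bilinear_mapI:
  assumes "\<And>x y. \<lbrakk>x \<in> carrier V; y \<in> carrier W\<rbrakk> \<Longrightarrow> t x y \<in> carrier P"
    and "\<And>x y z. \<lbrakk>x \<in> carrier V; y \<in> carrier V; z \<in> carrier W\<rbrakk> \<Longrightarrow> t (x \<oplus>\<^bsub>V\<^esub> y) z = t x z \<oplus>\<^bsub>P\<^esub> t y z"
    and "\<And>x y z. \<lbrakk>x \<in> carrier V; y \<in> carrier W; z \<in> carrier W\<rbrakk> \<Longrightarrow> t x (y \<oplus>\<^bsub>W\<^esub> z) = t x y \<oplus>\<^bsub>P\<^esub> t x z"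
    and "\<And>a x y. \<lbrakk>a \<in> carrier R; x \<in> carrier V; y \<in> carrier W\<rbrakk> \<Longrightarrow> t (a \<odot>\<^bsub>V\<^esub> x) y = a \<odot>\<^bsub>P\<^esub> t x y"
    and "\<And>a x y. \<lbrakk>a \<in> carrier R; x \<in> carrier V; y \<in> carrier W\<rbrakk> \<Longrightarrow> t x (a \<odot>\<^bsub>W\<^esub> y) = a \<odot>\<^bsub>P\<^esub> t x y"
  shows "bilinear_map R V W P t"
  unfolding bilinear_map_def by (intro conjI ballI linear_mapsI assms)

lemma bilinear_mapD:
  assumes "bilinear_map R V W P t"
  shows "x \<in> carrier V \<Longrightarrow> t x \<in> linear_maps R W P"
    and "y \<in> carrier W \<Longrightarrow> (\<lambda>x. t x y) \<in> linear_maps R V P"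
  using assms by (auto simp: bilinear_map_def)

lemma bilinear_map_closed:
  "\<lbrakk>bilinear_map R V W P t; x \<in> carrier V; y \<in> carrier W\<rbrakk> \<Longrightarrow> t x y \<in> carrier P"
  by (rule linear_mapsD(1)[OF bilinear_mapD(1)])

lemma bilinear_map_compose:
  assumes "bilinear_map R V W P t" "f \<in> linear_maps R V' V" "g \<in> linear_maps R W' W" "h \<in> linear_maps R P P'"
  shows "bilinear_map R V' W' P' (\<lambda>x y. h (t (f x) (g y)))"
  unfolding bilinear_map_def
proof (intro conjI ballI)
  fix x assume "x \<in> carrier V'"
  then have "t (f x) \<in> linear_maps R W P" by (intro bilinear_mapD(1)[OF assms(1)] linear_mapsD(1)[OF assms(2)])
  then show "(\<lambda>y. h (t (f x) (g y))) \<in> linear_maps R W' P'"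
    by (intro linear_maps_comp[OF _ assms(4)] linear_maps_comp[OF assms(3)])
next
  fix y assume "y \<in> carrier W'"
  then have "(\<lambda>x. t x (g y)) \<in> linear_maps R V P" by (intro bilinear_mapD(2)[OF assms(1)] linear_mapsD(1)[OF assms(3)])
  then show "(\<lambda>x. h (t (f x) (g y))) \<in> linear_maps R V' P'"
    using linear_maps_comp[OF assms(2), of "\<lambda>x. t x (g y)"] linear_maps_comp[OF _ assms(4)] by blast
qed

lemma self_module_simps [simp]:
  "carrier (self_module R) = carrier R" "add (self_module R) = add R" "ring.zero (self_module R) = ring.zero R"
  "smult (self_module R) = monoid.mult R"
  by (auto simp: self_module_def)

lemma finsum_self_module [simp]: "finsum (self_module R) = finsum R"
  by (rule finsum_record_cong) simp_all

lemma (in cring) module_self_module: "module R (self_module R)"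
proof (rule moduleI)
  show "abelian_group (self_module R)"
    by (rule abelian_group_record_cong[OF abelian_group_axioms]) simp_all
qed (simp_all add: is_cring l_distr r_distr m_assoc)

section \<open>Linear combinations, bases and coordinates\<close>

definition comb :: "('a, 'b, 'm) module_scheme \<Rightarrow> 'i set \<Rightarrow> ('i \<Rightarrow> 'b) \<Rightarrow> ('i \<Rightarrow> 'a) \<Rightarrow> 'b" where
  "comb V I b c = (\<Oplus>\<^bsub>V\<^esub>i\<in>I. c i \<odot>\<^bsub>V\<^esub> b i)"

text \<open>Any finite index set is allowed, so that disjoint sums and products of index sets can
  index orthogonal sums and tensor products. Extensional coefficient families make the coordinates
  unique as functions.\<close>

definition is_basis :: "('a, 'r) ring_scheme \<Rightarrow> ('a, 'b, 'm) module_scheme \<Rightarrow> 'i set \<Rightarrow> ('i \<Rightarrow> 'b) \<Rightarrow> bool" where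
  "is_basis R V I b \<longleftrightarrow> finite I \<and> b \<in> I \<rightarrow> carrier V
    \<and> bij_betw (comb V I b) (I \<rightarrow>\<^sub>E carrier R) (carrier V)"

context module
begin

lemma comb_empty [simp]: "comb M {} b c = \<zero>\<^bsub>M\<^esub>" by (simp add: comb_def)

lemma comb_insert:
  "\<lbrakk>finite I; i \<notin> I; b \<in> insert i I \<rightarrow> carrier M; c \<in> insert i I \<rightarrow> carrier R\<rbrakk>
    \<Longrightarrow> comb M (insert i I) b c = c i \<odot>\<^bsub>M\<^esub> b i \<oplus>\<^bsub>M\<^esub> comb M I b c"
  unfolding comb_def by (subst M.finsum_insert) (auto simp: Pi_iff)

lemma comb_closed: "\<lbrakk>b \<in> I \<rightarrow> carrier M; c \<in> I \<rightarrow> carrier R\<rbrakk> \<Longrightarrow> comb M I b c \<in> carrier M"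
  unfolding comb_def by (intro M.finsum_closed) (auto simp: Pi_iff)

lemma comb_cong:
  "\<lbrakk>b \<in> I \<rightarrow> carrier M; c \<in> I \<rightarrow> carrier R; \<And>i. i \<in> I \<Longrightarrow> b' i = b i; \<And>i. i \<in> I \<Longrightarrow> c' i = c i\<rbrakk>
    \<Longrightarrow> comb M I b' c' = comb M I b c"
  unfolding comb_def by (intro M.finsum_cong') (auto simp: Pi_iff)

lemma comb_add:
  assumes "b \<in> I \<rightarrow> carrier M" "c \<in> I \<rightarrow> carrier R" "d \<in> I \<rightarrow> carrier R"
  shows "comb M I b (\<lambda>i. c i \<oplus> d i) = comb M I b c \<oplus>\<^bsub>M\<^esub> comb M I b d"
proof -
  have "comb M I b (\<lambda>i. c i \<oplus> d i) = (\<Oplus>\<^bsub>M\<^esub>i\<in>I. c i \<odot>\<^bsub>M\<^esub> b i \<oplus>\<^bsub>M\<^esub> d i \<odot>\<^bsub>M\<^esub> b i)"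
    unfolding comb_def using assms by (intro M.finsum_cong') (auto simp: Pi_iff smult_l_distr)
  then show ?thesis unfolding comb_def using assms by (subst (asm) M.finsum_addf) (auto simp: Pi_iff)
qed

lemma comb_add_vectors:
  assumes "b \<in> I \<rightarrow> carrier M" "b' \<in> I \<rightarrow> carrier M" "c \<in> I \<rightarrow> carrier R"
  shows "comb M I (\<lambda>i. b i \<oplus>\<^bsub>M\<^esub> b' i) c = comb M I b c \<oplus>\<^bsub>M\<^esub> comb M I b' c"
proof -
  have "comb M I (\<lambda>i. b i \<oplus>\<^bsub>M\<^esub> b' i) c = (\<Oplus>\<^bsub>M\<^esub>i\<in>I. c i \<odot>\<^bsub>M\<^esub> b i \<oplus>\<^bsub>M\<^esub> c i \<odot>\<^bsub>M\<^esub> b' i)"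
    unfolding comb_def using assms by (intro M.finsum_cong') (auto simp: Pi_iff smult_r_distr)
  then show ?thesis unfolding comb_def using assms by (subst (asm) M.finsum_addf) (auto simp: Pi_iff)
qed

lemma comb_smult:
  assumes "finite I" "b \<in> I \<rightarrow> carrier M" "c \<in> I \<rightarrow> carrier R" "a \<in> carrier R"
  shows "comb M I b (\<lambda>i. a \<otimes> c i) = a \<odot>\<^bsub>M\<^esub> comb M I b c"
    and "comb M I (\<lambda>i. a \<odot>\<^bsub>M\<^esub> b i) c = a \<odot>\<^bsub>M\<^esub> comb M I b c"
proof -
  have e: "a \<odot>\<^bsub>M\<^esub> comb M I b c = (\<Oplus>\<^bsub>M\<^esub>i\<in>I. a \<odot>\<^bsub>M\<^esub> (c i \<odot>\<^bsub>M\<^esub> b i))"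
    unfolding comb_def using assms by (subst finsum_smult_ldistr) (auto simp: Pi_iff)
  show "comb M I b (\<lambda>i. a \<otimes> c i) = a \<odot>\<^bsub>M\<^esub> comb M I b c"
    unfolding e unfolding comb_def using assms by (intro M.finsum_cong') (auto simp: Pi_iff smult_assoc1)
  have "a \<odot>\<^bsub>M\<^esub> (c i \<odot>\<^bsub>M\<^esub> b i) = c i \<odot>\<^bsub>M\<^esub> (a \<odot>\<^bsub>M\<^esub> b i)" if "i \<in> I" for i
    using assms that by (auto simp: Pi_iff smult_assoc1[symmetric] m_comm)
  then show "comb M I (\<lambda>i. a \<odot>\<^bsub>M\<^esub> b i) c = a \<odot>\<^bsub>M\<^esub> comb M I b c"
    unfolding e unfolding comb_def using assms by (intro M.finsum_cong') (auto simp: Pi_iff)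
qed

lemma comb_zero:
  "\<lbrakk>finite I; \<And>i. i \<in> I \<Longrightarrow> c i = \<zero>; b \<in> I \<rightarrow> carrier M\<rbrakk> \<Longrightarrow> comb M I b c = \<zero>\<^bsub>M\<^esub>"
proof (induction I rule: finite_induct)
  case (insert i I)
  have "comb M (insert i I) b c = c i \<odot>\<^bsub>M\<^esub> b i \<oplus>\<^bsub>M\<^esub> comb M I b c"
    using insert by (intro comb_insert) simp_all
  moreover have "comb M I b c = \<zero>\<^bsub>M\<^esub>" using insert by simp
  ultimately show ?case using insert by simp
qed simp

lemma comb_delta:
  assumes "finite I" "b \<in> I \<rightarrow> carrier M" "i \<in> I"
  shows "comb M I b (\<lambda>j. if j = i then \<one> else \<zero>) = b i"
proof -
  have "comb M (I - {i}) b (\<lambda>j. if j = i then \<one> else \<zero>) = \<zero>\<^bsub>M\<^esub>"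
    using assms by (intro comb_zero) (simp_all add: Pi_iff)
  moreover have "comb M (insert i (I - {i})) b (\<lambda>j. if j = i then \<one> else \<zero>) =
      \<one> \<odot>\<^bsub>M\<^esub> b i \<oplus>\<^bsub>M\<^esub> comb M (I - {i}) b (\<lambda>j. if j = i then \<one> else \<zero>)"
    using assms comb_insert[of "I - {i}" i b "\<lambda>j. if j = i then \<one> else \<zero>"] by (simp add: Pi_iff)
  moreover have "b i \<in> carrier M" using assms by auto
  ultimately show ?thesis using assms(3) by (simp add: insert_absorb)
qed

lemma is_basisI:
  assumes I: "finite I" "b \<in> I \<rightarrow> carrier M"
    and span: "\<And>x. x \<in> carrier M \<Longrightarrow> \<exists>c\<in>I \<rightarrow> carrier R. x = comb M I b c"
    and indep: "\<And>c. \<lbrakk>c \<in> I \<rightarrow> carrier R; comb M I b c = \<zero>\<^bsub>M\<^esub>\<rbrakk> \<Longrightarrow> \<forall>i\<in>I. c i = \<zero>"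
  shows "is_basis R M I b"
  unfolding is_basis_def bij_betw_def
proof (intro conjI I)
  show "inj_on (comb M I b) (I \<rightarrow>\<^sub>E carrier R)"
  proof (rule inj_onI)
    fix c d assume cd: "c \<in> I \<rightarrow>\<^sub>E carrier R" "d \<in> I \<rightarrow>\<^sub>E carrier R" "comb M I b c = comb M I b d"
    then have cP: "c \<in> I \<rightarrow> carrier R" "d \<in> I \<rightarrow> carrier R" by (simp_all add: PiE_def)
    have nd: "(\<lambda>i. \<ominus> \<one> \<otimes> d i) \<in> I \<rightarrow> carrier R" using cP by (simp add: Pi_iff)
    have "comb M I b (\<lambda>i. c i \<oplus> \<ominus> \<one> \<otimes> d i) = comb M I b c \<oplus>\<^bsub>M\<^esub> (\<ominus> \<one>) \<odot>\<^bsub>M\<^esub> comb M I b d"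
      using comb_add[OF I(2) cP(1) nd] comb_smult(1)[OF I cP(2), of "\<ominus> \<one>"] by simp
    also have "\<dots> = \<zero>\<^bsub>M\<^esub>"
      using comb_closed[OF I(2) cP(2)] cd(3) by (simp add: smult_l_minus M.r_neg)
    finally have "\<forall>i\<in>I. c i \<oplus> \<ominus> \<one> \<otimes> d i = \<zero>" using cP nd by (intro indep) (simp_all add: Pi_iff)
    then have "c i = d i" if "i \<in> I" for i
    proof -
      have ci: "c i \<in> carrier R" "d i \<in> carrier R" using cP that by (simp_all add: Pi_iff)
      have "c i = (c i \<oplus> \<ominus> \<one> \<otimes> d i) \<oplus> d i" using ci by algebra
      then show ?thesis using \<open>\<forall>i\<in>I. c i \<oplus> \<ominus> \<one> \<otimes> d i = \<zero>\<close> that ci by simp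
    qed
    then show "c = d" by (rule PiE_ext[OF cd(1,2)])
  qed
  show "comb M I b ` (I \<rightarrow>\<^sub>E carrier R) = carrier M"
  proof
    show "comb M I b ` (I \<rightarrow>\<^sub>E carrier R) \<subseteq> carrier M" using comb_closed[OF I(2)] by (auto simp: PiE_def)
    show "carrier M \<subseteq> comb M I b ` (I \<rightarrow>\<^sub>E carrier R)"
    proof
      fix x assume "x \<in> carrier M"
      then obtain c where c: "c \<in> I \<rightarrow> carrier R" "x = comb M I b c" using span by blast
      then have "x = comb M I b (restrict c I)"
        using comb_cong[OF I(2) c(1), of b "restrict c I"] by simp
      then show "x \<in> comb M I b ` (I \<rightarrow>\<^sub>E carrier R)"
        using c(1) by (simp add: restrict_PiE_iff Pi_iff)
    qed
  qed
qed

end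

definition coord :: "('a, 'r) ring_scheme \<Rightarrow> ('a, 'b, 'm) module_scheme \<Rightarrow> 'i set \<Rightarrow> ('i \<Rightarrow> 'b) \<Rightarrow> 'b \<Rightarrow> 'i \<Rightarrow> 'a" where
  "coord R V I b = inv_into (I \<rightarrow>\<^sub>E carrier R) (comb V I b)"

context module
begin

context
  fixes I :: "'i set" and b
  assumes basis: "is_basis R M I b"
begin

lemma basisD: "finite I" "b \<in> I \<rightarrow> carrier M" "i \<in> I \<Longrightarrow> b i \<in> carrier M"
  using basis unfolding is_basis_def by (simp_all add: Pi_iff)

lemma coord_PiE: "x \<in> carrier M \<Longrightarrow> coord R M I b x \<in> I \<rightarrow>\<^sub>E carrier R"
  using inv_into_into[of x "comb M I b" "I \<rightarrow>\<^sub>E carrier R"] basis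
  by (simp add: is_basis_def coord_def bij_betw_def)

lemma coord_closed: "\<lbrakk>x \<in> carrier M; i \<in> I\<rbrakk> \<Longrightarrow> coord R M I b x i \<in> carrier R"
  by (rule PiE_mem[OF coord_PiE])

lemma coord_Pi: "x \<in> carrier M \<Longrightarrow> coord R M I b x \<in> I \<rightarrow> carrier R"
  by (simp add: Pi_iff coord_closed)

lemma comb_coord: "x \<in> carrier M \<Longrightarrow> comb M I b (coord R M I b x) = x"
  using f_inv_into_f[of x "comb M I b" "I \<rightarrow>\<^sub>E carrier R"] basis
  by (simp add: is_basis_def coord_def bij_betw_def)

lemma coord_eqI:
  assumes "c \<in> I \<rightarrow> carrier R" "i \<in> I"
  shows "coord R M I b (comb M I b c) i = c i"
proof -
  have "comb M I b c = comb M I b (restrict c I)"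
    using comb_cong[OF basisD(2) assms(1), of b "restrict c I"] by simp
  moreover have "coord R M I b (comb M I b (restrict c I)) = restrict c I"
    unfolding coord_def using basis assms
    by (intro inv_into_f_f) (simp_all add: is_basis_def bij_betw_def)
  ultimately show ?thesis using assms by simp
qed

lemma coord_basis: "\<lbrakk>i \<in> I; j \<in> I\<rbrakk> \<Longrightarrow> coord R M I b (b i) j = (if j = i then \<one> else \<zero>)"
  using coord_eqI[of "\<lambda>j. if j = i then \<one> else \<zero>" j] comb_delta[OF basisD(1,2), of i]
  by (simp add: Pi_iff)

lemma coord_add:
  assumes "x \<in> carrier M" "y \<in> carrier M" "i \<in> I"
  shows "coord R M I b (x \<oplus>\<^bsub>M\<^esub> y) i = coord R M I b x i \<oplus> coord R M I b y i"
proof -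
  let ?c = "coord R M I b"
  have p: "?c x \<in> I \<rightarrow> carrier R" "?c y \<in> I \<rightarrow> carrier R" using assms coord_Pi by blast+
  have "x \<oplus>\<^bsub>M\<^esub> y = comb M I b (\<lambda>i. ?c x i \<oplus> ?c y i)"
    using comb_add[OF basisD(2) p] comb_coord assms by simp
  then show ?thesis using coord_eqI[of "\<lambda>i. ?c x i \<oplus> ?c y i"] p assms by (auto simp: Pi_iff)
qed

lemma coord_smult:
  assumes "x \<in> carrier M" "a \<in> carrier R" "i \<in> I"
  shows "coord R M I b (a \<odot>\<^bsub>M\<^esub> x) i = a \<otimes> coord R M I b x i"
proof -
  let ?c = "coord R M I b"
  have p: "?c x \<in> I \<rightarrow> carrier R" using assms coord_Pi by blast
  have "a \<odot>\<^bsub>M\<^esub> x = comb M I b (\<lambda>i. a \<otimes> ?c x i)"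
    using comb_smult(1)[OF basisD(1,2) p] comb_coord assms by simp
  then show ?thesis using coord_eqI[of "\<lambda>i. a \<otimes> ?c x i"] p assms by (auto simp: Pi_iff)
qed

lemma coord_linear: "i \<in> I \<Longrightarrow> (\<lambda>x. coord R M I b x i) \<in> linear_maps R M (self_module R)"
  by (rule linear_mapsI) (simp_all add: coord_add coord_smult coord_closed)

lemma linear_extend:
  assumes W: "module R W" and d: "d \<in> I \<rightarrow> carrier W"
  shows "(\<lambda>x. comb W I d (coord R M I b x)) \<in> linear_maps R M W"
    and "i \<in> I \<Longrightarrow> comb W I d (coord R M I b (b i)) = d i"
proof -
  interpret W: module R W by (rule W)
  have p: "x \<in> carrier M \<Longrightarrow> coord R M I b x \<in> I \<rightarrow> carrier R" for x by (rule coord_Pi)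
  show "(\<lambda>x. comb W I d (coord R M I b x)) \<in> linear_maps R M W"
  proof (rule linear_mapsI)
    fix x y assume xy: "x \<in> carrier M" "y \<in> carrier M"
    show "comb W I d (coord R M I b x) \<in> carrier W" using W.comb_closed d p xy by blast
    have "comb W I d (coord R M I b (x \<oplus>\<^bsub>M\<^esub> y)) = comb W I d (\<lambda>i. coord R M I b x i \<oplus> coord R M I b y i)"
      using d xy by (intro W.comb_cong) (simp_all add: coord_add coord_closed)
    then show "comb W I d (coord R M I b (x \<oplus>\<^bsub>M\<^esub> y)) = comb W I d (coord R M I b x) \<oplus>\<^bsub>W\<^esub> comb W I d (coord R M I b y)"
      using W.comb_add[OF d p p] xy by simp
  next
    fix a x assume ax: "a \<in> carrier R" "x \<in> carrier M"
    have "comb W I d (coord R M I b (a \<odot>\<^bsub>M\<^esub> x)) = comb W I d (\<lambda>i. a \<otimes> coord R M I b x i)"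
      using d ax by (intro W.comb_cong) (simp_all add: coord_smult coord_closed)
    then show "comb W I d (coord R M I b (a \<odot>\<^bsub>M\<^esub> x)) = a \<odot>\<^bsub>W\<^esub> comb W I d (coord R M I b x)"
      using W.comb_smult(1)[OF basisD(1) d] p ax by simp
  qed
  show "comb W I d (coord R M I b (b i)) = d i" if i: "i \<in> I"
  proof -
    have "comb W I d (coord R M I b (b i)) = comb W I d (\<lambda>j. if j = i then \<one> else \<zero>)"
      using i d by (intro W.comb_cong) (simp_all add: coord_basis)
    then show ?thesis using W.comb_delta[OF basisD(1) d i] by simp
  qed
qed

end

lemma linear_comb:
  assumes W: "module R W" and f: "f \<in> linear_maps R M W" and "finite I" "b \<in> I \<rightarrow> carrier M" "c \<in> I \<rightarrow> carrier R"
  shows "f (comb M I b c) = comb W I (\<lambda>i. f (b i)) c"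
proof -
  interpret W: module R W by (rule W)
  note l = linear_mapsD[OF f]
  show ?thesis using assms(3-)
  proof (induction I rule: finite_induct)
    case empty
    have "f \<zero>\<^bsub>M\<^esub> = \<zero> \<odot>\<^bsub>W\<^esub> f \<zero>\<^bsub>M\<^esub>" using l(3)[of \<zero> "\<zero>\<^bsub>M\<^esub>"] by simp
    then show ?case using l(1) by simp
  next
    case (insert i I)
    then have c: "c i \<in> carrier R" "b i \<in> carrier M" "comb M I b c \<in> carrier M"
      using comb_closed[of b I c] by (auto simp: Pi_iff)
    have "comb M (insert i I) b c = c i \<odot>\<^bsub>M\<^esub> b i \<oplus>\<^bsub>M\<^esub> comb M I b c"
      by (rule comb_insert[OF insert(1,2,4,5)])
    moreover have "comb W (insert i I) (\<lambda>i. f (b i)) c = c i \<odot>\<^bsub>W\<^esub> f (b i) \<oplus>\<^bsub>W\<^esub> comb W I (\<lambda>i. f (b i)) c"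
      using insert l(1) by (intro W.comb_insert) (simp_all add: Pi_iff)
    ultimately show ?case using insert c l by simp
  qed
qed

lemma linear_eq_on_basis:
  assumes "is_basis R M I b" "module R W" "f \<in> linear_maps R M W" "g \<in> linear_maps R M W"
    "\<And>i. i \<in> I \<Longrightarrow> f (b i) = g (b i)" "x \<in> carrier M"
  shows "f x = g x"
proof -
  interpret W: module R W by fact
  note bD = basisD[OF assms(1)]
  have c: "coord R M I b x \<in> I \<rightarrow> carrier R" by (rule coord_Pi[OF assms(1,6)])
  have "f x = comb W I (\<lambda>i. f (b i)) (coord R M I b x)"
    using linear_comb[OF assms(2,3) bD(1,2) c] comb_coord[OF assms(1,6)] by simp
  also have "\<dots> = comb W I (\<lambda>i. g (b i)) (coord R M I b x)"
    using bD(3) c by (intro W.comb_cong) (simp_all add: assms(5) linear_mapsD(1)[OF assms(4)])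
  also have "\<dots> = g x"
    using linear_comb[OF assms(2,4) bD(1,2) c] comb_coord[OF assms(1,6)] by simp
  finally show ?thesis .
qed

end

lemma bilinear_eq_on_bases:
  assumes mod: "module R V" "module R W" "module R P" and bas: "is_basis R V I b" "is_basis R W J d"
    and bil: "bilinear_map R V W P s" "bilinear_map R V W P t"
    and eq: "\<And>i j. \<lbrakk>i \<in> I; j \<in> J\<rbrakk> \<Longrightarrow> s (b i) (d j) = t (b i) (d j)"
    and xy: "x \<in> carrier V" "y \<in> carrier W"
  shows "s x y = t x y"
proof -
  have "s (b i) y = t (b i) y" if "i \<in> I" for i
  proof -
    have "b i \<in> carrier V" using module.basisD(3)[OF mod(1) bas(1) that] .
    then show ?thesis
      using module.linear_eq_on_basis[OF mod(2) bas(2) mod(3) bilinear_mapD(1)[OF bil(1)] bilinear_mapD(1)[OF bil(2)]] eq that xy by blast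
  qed
  then show ?thesis
    using module.linear_eq_on_basis[OF mod(1) bas(1) mod(3) bilinear_mapD(2)[OF bil(1)] bilinear_mapD(2)[OF bil(2)]] xy by blast
qed

lemma bilinear_extend:
  assumes mod: "module R V" "module R W" "module R P" and bas: "is_basis R V I b" "is_basis R W J d"
    and p: "\<And>i j. \<lbrakk>i \<in> I; j \<in> J\<rbrakk> \<Longrightarrow> p i j \<in> carrier P"
  obtains t where "bilinear_map R V W P t" "\<And>i j. \<lbrakk>i \<in> I; j \<in> J\<rbrakk> \<Longrightarrow> t (b i) (d j) = p i j"
proof -
  interpret V: module R V by fact
  interpret W: module R W by fact
  interpret P: module R P by fact
  define L where "L i y = comb P J (p i) (coord R W J d y)" for i y
  have L: "L i \<in> linear_maps R W P" "j \<in> J \<Longrightarrow> L i (d j) = p i j" if "i \<in> I" for i j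
    using W.linear_extend[OF bas(2) mod(3), of "p i"] p that by (auto simp: L_def[abs_def])
  define t where "t x y = comb P I (\<lambda>i. L i y) (coord R V I b x)" for x y
  have LP: "(\<lambda>i. L i y) \<in> I \<rightarrow> carrier P" if "y \<in> carrier W" for y
    using linear_mapsD(1)[OF L(1)] that by auto
  have c: "coord R V I b x \<in> I \<rightarrow> carrier R" if "x \<in> carrier V" for x
    by (rule V.coord_Pi[OF bas(1) that])
  note bf = V.basisD(1)[OF bas(1)]
  have "bilinear_map R V W P t"
    unfolding bilinear_map_def
  proof (intro conjI ballI)
    fix y assume "y \<in> carrier W"
    then show "(\<lambda>x. t x y) \<in> linear_maps R V P"
      using V.linear_extend(1)[OF bas(1) mod(3) LP] by (simp add: t_def)
  next
    fix x assume x: "x \<in> carrier V"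
    show "t x \<in> linear_maps R W P"
    proof (rule linear_mapsI)
      fix y z assume yz: "y \<in> carrier W" "z \<in> carrier W"
      show "t x y \<in> carrier P" using P.comb_closed[OF LP c] x yz by (simp add: t_def)
      have "t x (y \<oplus>\<^bsub>W\<^esub> z) = comb P I (\<lambda>i. L i y \<oplus>\<^bsub>P\<^esub> L i z) (coord R V I b x)"
        unfolding t_def
      proof (rule P.comb_cong)
        show "(\<lambda>i. L i y \<oplus>\<^bsub>P\<^esub> L i z) \<in> I \<rightarrow> carrier P"
          using LP[OF yz(1)] LP[OF yz(2)] by (simp add: Pi_iff)
      qed (use c[OF x] yz in \<open>simp_all add: linear_mapsD(2)[OF L(1)]\<close>)
      then show "t x (y \<oplus>\<^bsub>W\<^esub> z) = t x y \<oplus>\<^bsub>P\<^esub> t x z"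
        using P.comb_add_vectors[OF LP LP c] x yz by (simp add: t_def)
    next
      fix a y assume ay: "a \<in> carrier R" "y \<in> carrier W"
      have "t x (a \<odot>\<^bsub>W\<^esub> y) = comb P I (\<lambda>i. a \<odot>\<^bsub>P\<^esub> L i y) (coord R V I b x)"
        unfolding t_def
      proof (rule P.comb_cong)
        show "(\<lambda>i. a \<odot>\<^bsub>P\<^esub> L i y) \<in> I \<rightarrow> carrier P"
          using LP[OF ay(2)] ay by (simp add: Pi_iff)
      qed (use c[OF x] ay in \<open>simp_all add: linear_mapsD(3)[OF L(1)]\<close>)
      then show "t x (a \<odot>\<^bsub>W\<^esub> y) = a \<odot>\<^bsub>P\<^esub> t x y"
        using P.comb_smult(2)[OF bf LP c] x ay by (simp add: t_def)
    qed
  qed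
  moreover have "t (b i) (d j) = p i j" if "i \<in> I" "j \<in> J" for i j
    using V.linear_extend(2)[OF bas(1) mod(3) LP[OF W.basisD(3)[OF bas(2) that(2)]] that(1)] L(2)[OF that]
    by (simp add: t_def)
  ultimately show ?thesis using that by blast
qed

subsection \<open>Bases\<close>

context module
begin

lemma basis_indep:
  assumes "is_basis R M I b" "c \<in> I \<rightarrow> carrier R" "comb M I b c = \<zero>\<^bsub>M\<^esub>" "i \<in> I"
  shows "c i = \<zero>"
proof -
  note bD = basisD[OF assms(1)]
  have "comb M I b (\<lambda>_. \<zero>) = \<zero>\<^bsub>M\<^esub>" by (rule comb_zero[OF bD(1) refl bD(2)])
  then have "coord R M I b (comb M I b c) i = coord R M I b (comb M I b (\<lambda>_. \<zero>)) i" using assms(3) by simp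
  then show ?thesis
    using coord_eqI[OF assms(1,2,4)] coord_eqI[OF assms(1) _ assms(4), of "\<lambda>_. \<zero>"] by (simp add: Pi_iff)
qed

lemma comb_reindex:
  assumes "inj_on \<pi> J" "b \<in> \<pi> ` J \<rightarrow> carrier M" "c \<in> \<pi> ` J \<rightarrow> carrier R"
  shows "comb M (\<pi> ` J) b c = comb M J (\<lambda>j. b (\<pi> j)) (\<lambda>j. c (\<pi> j))"
  unfolding comb_def by (rule M.finsum_reindex[OF _ assms(1)]) (use assms in \<open>simp add: Pi_iff\<close>)

lemma is_basis_reindex:
  assumes b: "is_basis R M I b" and \<pi>: "bij_betw \<pi> J I"
  shows "is_basis R M J (\<lambda>j. b (\<pi> j))"
proof (rule is_basisI)
  note bD = basisD[OF b]
  have I: "I = \<pi> ` J" and inj: "inj_on \<pi> J" using \<pi> by (simp_all add: bij_betw_def)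
  show "finite J" using bD(1) \<pi> bij_betw_finite by blast
  show "(\<lambda>j. b (\<pi> j)) \<in> J \<rightarrow> carrier M" using bD(3) by (simp add: Pi_iff I)
  have re: "comb M I b c = comb M J (\<lambda>j. b (\<pi> j)) (\<lambda>j. c (\<pi> j))" if "c \<in> I \<rightarrow> carrier R" for c
    using comb_reindex[OF inj] bD(2) that by (simp add: I)
  show "\<exists>c\<in>J \<rightarrow> carrier R. x = comb M J (\<lambda>j. b (\<pi> j)) c" if x: "x \<in> carrier M" for x
  proof (rule bexI)
    show "x = comb M J (\<lambda>j. b (\<pi> j)) (\<lambda>j. coord R M I b x (\<pi> j))"
      using re[OF coord_Pi[OF b x]] comb_coord[OF b x] by simp
    show "(\<lambda>j. coord R M I b x (\<pi> j)) \<in> J \<rightarrow> carrier R"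
      using coord_closed[OF b x] by (simp add: Pi_iff I)
  qed
  show "\<forall>j\<in>J. c j = \<zero>" if c: "c \<in> J \<rightarrow> carrier R" "comb M J (\<lambda>j. b (\<pi> j)) c = \<zero>\<^bsub>M\<^esub>" for c
  proof
    fix j assume j: "j \<in> J"
    let ?c = "\<lambda>i. c (inv_into J \<pi> i)"
    have cp: "?c \<in> I \<rightarrow> carrier R"
      using c(1) inv_into_into[of _ \<pi> J] by (simp add: Pi_iff I)
    have "comb M J (\<lambda>j. b (\<pi> j)) (\<lambda>j. ?c (\<pi> j)) = comb M J (\<lambda>j. b (\<pi> j)) c"
      using c(1) bD(3) inj by (intro comb_cong) (simp_all add: Pi_iff I)
    then have "comb M I b ?c = \<zero>\<^bsub>M\<^esub>" using re[OF cp] c(2) by simp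
    from basis_indep[OF b cp this, of "\<pi> j"] show "c j = \<zero>" using j inj by (simp add: I)
  qed
qed

lemma comb_Plus:
  assumes "finite I" "finite J" "b \<in> I <+> J \<rightarrow> carrier M" "c \<in> I <+> J \<rightarrow> carrier R"
  shows "comb M (I <+> J) b c =
    comb M I (\<lambda>i. b (Inl i)) (\<lambda>i. c (Inl i)) \<oplus>\<^bsub>M\<^esub> comb M J (\<lambda>j. b (Inr j)) (\<lambda>j. c (Inr j))"
proof -
  have p: "b \<in> Inl ` I \<rightarrow> carrier M" "b \<in> Inr ` J \<rightarrow> carrier M"
    "c \<in> Inl ` I \<rightarrow> carrier R" "c \<in> Inr ` J \<rightarrow> carrier R"
    using assms(3,4) by (auto simp: Pi_iff)
  have "comb M (I <+> J) b c = comb M (Inl ` I \<union> Inr ` J) b c" by (simp add: Plus_def)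
  also have "\<dots> = comb M (Inl ` I) b c \<oplus>\<^bsub>M\<^esub> comb M (Inr ` J) b c"
    unfolding comb_def by (rule M.finsum_Un_disjoint) (use assms(1,2) p in \<open>auto simp: Pi_iff\<close>)
  also have "\<dots> = comb M I (\<lambda>i. b (Inl i)) (\<lambda>i. c (Inl i)) \<oplus>\<^bsub>M\<^esub> comb M J (\<lambda>j. b (Inr j)) (\<lambda>j. c (Inr j))"
    using comb_reindex[of Inl I b c] comb_reindex[of Inr J b c] p by simp
  finally show ?thesis .
qed

lemma comb_zero_vectors:
  assumes "finite I" "c \<in> I \<rightarrow> carrier R" shows "comb M I (\<lambda>_. \<zero>\<^bsub>M\<^esub>) c = \<zero>\<^bsub>M\<^esub>"
proof -
  have "comb M I (\<lambda>_. \<zero>\<^bsub>M\<^esub>) c = comb M I (\<lambda>_. \<zero>\<^bsub>M\<^esub>) (\<lambda>_. \<zero>)"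
    unfolding comb_def using assms by (intro M.finsum_cong') (simp_all add: Pi_iff)
  then show ?thesis using comb_zero[OF assms(1) refl, of "\<lambda>_. \<zero>\<^bsub>M\<^esub>"] by simp
qed

end

lemma is_basis_image:
  assumes "module R V" "module R W" "is_basis R V I b" "f \<in> linear_maps R V W" "bij_betw f (carrier V) (carrier W)"
  shows "is_basis R W I (\<lambda>i. f (b i))"
proof -
  interpret V: module R V by fact
  note bD = V.basisD[OF assms(3)]
  have "bij_betw (\<lambda>c. f (comb V I b c)) (I \<rightarrow>\<^sub>E carrier R) (carrier W)"
    using bij_betw_trans[of "comb V I b", OF _ assms(5)] assms(3) by (simp add: is_basis_def comp_def)
  moreover have "f (comb V I b c) = comb W I (\<lambda>i. f (b i)) c" if "c \<in> I \<rightarrow>\<^sub>E carrier R" for c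
    using V.linear_comb[OF assms(2,4) bD(1,2)] that by (simp add: PiE_def)
  ultimately have "bij_betw (comb W I (\<lambda>i. f (b i))) (I \<rightarrow>\<^sub>E carrier R) (carrier W)"
    using bij_betw_cong[of "I \<rightarrow>\<^sub>E carrier R" "\<lambda>c. f (comb V I b c)" "comb W I (\<lambda>i. f (b i))"] by simp
  then show ?thesis using bD linear_mapsD(1)[OF assms(4)] by (simp add: is_basis_def Pi_iff)
qed

lemma linear_bij_of_bases:
  assumes mod: "module R V" "module R W" and bas: "is_basis R V I b" "is_basis R W I d"
  obtains f where "f \<in> linear_maps R V W" "bij_betw f (carrier V) (carrier W)" "\<And>i. i \<in> I \<Longrightarrow> f (b i) = d i"
proof -
  interpret V: module R V by fact
  interpret W: module R W by fact
  note bD = V.basisD[OF bas(1)] and dD = W.basisD[OF bas(2)]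
  obtain f where f: "f \<in> linear_maps R V W" "\<And>i. i \<in> I \<Longrightarrow> f (b i) = d i"
    using V.linear_extend[OF bas(1) mod(2) dD(2)] by blast
  obtain g where g: "g \<in> linear_maps R W V" "\<And>i. i \<in> I \<Longrightarrow> g (d i) = b i"
    using W.linear_extend[OF bas(2) mod(1) bD(2)] by blast
  have gf: "g (f x) = x" if "x \<in> carrier V" for x
    by (rule V.linear_eq_on_basis[OF bas(1) mod(1) linear_maps_comp[OF f(1) g(1)] linear_maps_id _ that]) (simp add: f g)
  have fg: "f (g y) = y" if "y \<in> carrier W" for y
    by (rule W.linear_eq_on_basis[OF bas(2) mod(2) linear_maps_comp[OF g(1) f(1)] linear_maps_id _ that]) (simp add: f g)
  have "bij_betw f (carrier V) (carrier W)"
    by (rule bij_betw_byWitness[where f' = g]) (use gf fg linear_mapsD(1)[OF f(1)] linear_mapsD(1)[OF g(1)] in auto)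
  then show ?thesis using that f by blast
qed

subsection \<open>The coordinate module\<close>

text \<open>The form is a parameter because it is itself obtained by bilinear extension over this
  module; \<open>undefined\<close> stands in for it until it exists.\<close>

definition coord_space :: "('a, 'r) ring_scheme \<Rightarrow> 'i set \<Rightarrow> (('i \<Rightarrow> 'a) \<Rightarrow> ('i \<Rightarrow> 'a) \<Rightarrow> 'a) \<Rightarrow> ('a, 'i \<Rightarrow> 'a) form_module" where
  "coord_space R I t = \<lparr>carrier = I \<rightarrow>\<^sub>E carrier R, monoid.mult = \<lambda>x y. x, one = \<lambda>i\<in>I. \<zero>\<^bsub>R\<^esub>,
     ring.zero = \<lambda>i\<in>I. \<zero>\<^bsub>R\<^esub>, add = \<lambda>x y. \<lambda>i\<in>I. x i \<oplus>\<^bsub>R\<^esub> y i, smult = \<lambda>a x. \<lambda>i\<in>I. a \<otimes>\<^bsub>R\<^esub> x i, form = t\<rparr>"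

lemma coord_space_simps [simp]:
  "carrier (coord_space R I t) = I \<rightarrow>\<^sub>E carrier R" "ring.zero (coord_space R I t) = (\<lambda>i\<in>I. \<zero>\<^bsub>R\<^esub>)"
  "add (coord_space R I t) = (\<lambda>x y. \<lambda>i\<in>I. x i \<oplus>\<^bsub>R\<^esub> y i)"
  "smult (coord_space R I t) = (\<lambda>a x. \<lambda>i\<in>I. a \<otimes>\<^bsub>R\<^esub> x i)" "form (coord_space R I t) = t"
  by (simp_all add: coord_space_def)

definition unit_vec :: "('a, 'r) ring_scheme \<Rightarrow> 'i set \<Rightarrow> 'i \<Rightarrow> 'i \<Rightarrow> 'a" where
  "unit_vec R I i = (\<lambda>j\<in>I. if j = i then \<one>\<^bsub>R\<^esub> else \<zero>\<^bsub>R\<^esub>)"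

context cring
begin

lemma module_coord_space: "module R (coord_space R I t)"
proof (rule moduleI)
  let ?K = "coord_space R I t"
  have e: "x = y" if "x \<in> I \<rightarrow>\<^sub>E carrier R" "y \<in> I \<rightarrow>\<^sub>E carrier R" "\<And>i. i \<in> I \<Longrightarrow> x i = y i" for x y :: "'c \<Rightarrow> 'a"
    using PiE_ext[OF that] .
  have m: "x i \<in> carrier R" if "x \<in> I \<rightarrow>\<^sub>E carrier R" "i \<in> I" for x :: "'c \<Rightarrow> 'a" and i
    using PiE_mem[OF that] .
  show "abelian_group ?K"
  proof (rule abelian_groupI)
    fix x assume x: "x \<in> carrier ?K"
    show "\<exists>y\<in>carrier ?K. y \<oplus>\<^bsub>?K\<^esub> x = \<zero>\<^bsub>?K\<^esub>"
      using x m by (intro bexI[of _ "\<lambda>i\<in>I. \<ominus> x i"]) (simp_all add: l_neg restrict_PiE_iff cong: restrict_cong)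
    show "\<zero>\<^bsub>?K\<^esub> \<oplus>\<^bsub>?K\<^esub> x = x" using x m by (intro e) (simp_all add: restrict_PiE_iff)
  qed (use m in \<open>simp_all add: restrict_PiE_iff a_ac cong: restrict_cong\<close>)
  fix x assume x: "x \<in> carrier ?K"
  show "\<one> \<odot>\<^bsub>?K\<^esub> x = x" using x m by (intro e) (simp_all add: restrict_PiE_iff)
qed (use PiE_mem[of _ I "\<lambda>_. carrier R"] in \<open>simp_all add: is_cring restrict_PiE_iff Pi_iff l_distr r_distr m_assoc cong: restrict_cong\<close>)

lemma unit_vec_basis:
  assumes I: "finite I" shows "is_basis R (coord_space R I t) I (unit_vec R I)"
proof -
  let ?K = "coord_space R I t"
  interpret K: module R ?K by (rule module_coord_space)
  interpret S: module R "self_module R" by (rule module_self_module)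
  have u: "unit_vec R I \<in> I \<rightarrow> carrier ?K" by (simp add: unit_vec_def Pi_iff restrict_PiE_iff)
  have ev: "(\<lambda>x. x i) \<in> linear_maps R ?K (self_module R)" if "i \<in> I" for i
    using that by (intro linear_mapsI) (auto dest: PiE_mem)
  have comb: "comb ?K I (unit_vec R I) c i = c i" if c: "c \<in> I \<rightarrow> carrier R" and i: "i \<in> I" for c i
  proof -
    have "comb ?K I (unit_vec R I) c i = comb (self_module R) I (\<lambda>j. unit_vec R I j i) c"
      using K.linear_comb[OF module_self_module ev[OF i] I u c] .
    also have "\<dots> = comb (self_module R) I c (\<lambda>j. if j = i then \<one> else \<zero>)"
      unfolding comb_def using c i
      by (intro S.finsum_cong') (simp_all add: unit_vec_def Pi_iff eq_commute)
    also have "\<dots> = c i" using S.comb_delta[OF I _ i, of c] c by simp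
    finally show ?thesis .
  qed
  show ?thesis
  proof (rule K.is_basisI[OF I u])
    fix x assume x: "x \<in> carrier ?K"
    then have p: "x \<in> I \<rightarrow> carrier R" by (simp add: PiE_def)
    have "x = comb ?K I (unit_vec R I) x"
      using x K.comb_closed[OF u p] comb[OF p] by (intro PiE_ext[of x I "\<lambda>_. carrier R"]) simp_all
    then show "\<exists>c\<in>I \<rightarrow> carrier R. x = comb ?K I (unit_vec R I) c" using p by blast
  next
    fix c assume c: "c \<in> I \<rightarrow> carrier R" "comb ?K I (unit_vec R I) c = \<zero>\<^bsub>?K\<^esub>"
    then show "\<forall>i\<in>I. c i = \<zero>" using comb[OF c(1)] by simp
  qed
qed

end

subsection \<open>Inner product spaces with a basis\<close>

text \<open>Non-degeneracy in a form that can be computed with: for a form space with a basis it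
  amounts to the existence of such an \<open>h\<close>, by \<open>inner_product_spaceI\<close> and
  \<open>ex_dual_basis\<close>.\<close>

definition dual_basis :: "('a, 'r) ring_scheme \<Rightarrow> ('a, 'b, 'v) form_module_scheme \<Rightarrow> 'i set \<Rightarrow> ('i \<Rightarrow> 'b) \<Rightarrow> ('i \<Rightarrow> 'b) \<Rightarrow> bool" where
  "dual_basis R V I b h \<longleftrightarrow> h \<in> I \<rightarrow> carrier V \<and>
    (\<forall>i\<in>I. \<forall>j\<in>I. form V (h i) (b j) = (if j = i then \<one>\<^bsub>R\<^esub> else \<zero>\<^bsub>R\<^esub>))"

text \<open>\<open>finitely_generated\<close> sums over a set of vectors and \<open>comb\<close>
  over indices. Over the zero ring a basis may repeat vectors, so coefficients are accumulated one
  index at a time instead of being reindexed.\<close>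

lemma finitely_generated_of_basis:
  assumes "module R V" "is_basis R V I b"
  shows "finitely_generated R V"
proof -
  interpret V: module R V by fact
  note bD = V.basisD[OF assms(2)]
  have "\<exists>c\<in>b ` I \<rightarrow> carrier R. x = (\<Oplus>\<^bsub>V\<^esub>a\<in>b ` I. c a \<odot>\<^bsub>V\<^esub> a)" if x: "x \<in> carrier V" for x
  proof -
    have "comb V I b c \<in> {\<Oplus>\<^bsub>V\<^esub>a\<in>A. d a \<odot>\<^bsub>V\<^esub> a | d. d \<in> A \<rightarrow> carrier R}"
      if "b ` I \<subseteq> A" "finite A" "A \<subseteq> carrier V" "c \<in> I \<rightarrow> carrier R" "finite I" for I c A
      using that(5,1,4)
    proof (induction I rule: finite_induct)
      case empty
      have "comb V A (\<lambda>a. a) (\<lambda>_. \<zero>\<^bsub>R\<^esub>) = \<zero>\<^bsub>V\<^esub>"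
        by (rule V.comb_zero[OF that(2) refl]) (use that(3) in \<open>simp add: Pi_iff subset_iff\<close>)
      then show ?case by (intro CollectI exI[of _ "\<lambda>_. \<zero>\<^bsub>R\<^esub>"]) (simp add: comb_def)
    next
      case (insert i I)
      have bA: "b \<in> insert i I \<rightarrow> carrier V" using insert.prems that(3) by (auto simp: Pi_iff)
      have iA: "(\<lambda>a. a) \<in> A \<rightarrow> carrier V" using that(3) by (simp add: Pi_iff subset_iff)
      obtain d where d: "d \<in> A \<rightarrow> carrier R" "comb V I b c = comb V A (\<lambda>a. a) d"
        using insert by (auto simp: comb_def)
      let ?e = "\<lambda>a. c i \<otimes>\<^bsub>R\<^esub> (if a = b i then \<one>\<^bsub>R\<^esub> else \<zero>\<^bsub>R\<^esub>)"
      have ci: "c i \<in> carrier R" using insert.prems by simp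
      have e: "?e \<in> A \<rightarrow> carrier R" using ci by (simp add: Pi_iff)
      have "comb V A (\<lambda>a. a) ?e = c i \<odot>\<^bsub>V\<^esub> b i"
        using V.comb_smult(1)[OF that(2) iA _ ci, of "\<lambda>a. if a = b i then \<one>\<^bsub>R\<^esub> else \<zero>\<^bsub>R\<^esub>"]
          V.comb_delta[OF that(2) iA, of "b i"] insert.prems by (simp add: Pi_iff)
      then have "comb V (insert i I) b c = comb V A (\<lambda>a. a) (\<lambda>a. ?e a \<oplus>\<^bsub>R\<^esub> d a)"
        using V.comb_insert[OF insert(1,2) bA insert.prems(2)] V.comb_add[OF iA e d(1)] d(2) by simp
      moreover have "(\<lambda>a. ?e a \<oplus>\<^bsub>R\<^esub> d a) \<in> A \<rightarrow> carrier R" using e d by (simp add: Pi_iff)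
      ultimately show ?case by (auto simp: comb_def)
    qed
    from this[OF subset_refl _ _ V.coord_Pi[OF assms(2) x] bD(1)] bD V.comb_coord[OF assms(2) x]
    show ?thesis by (auto simp: Pi_iff)
  qed
  moreover have "finite (b ` I)" "b ` I \<subseteq> carrier V" using bD by auto
  ultimately show ?thesis unfolding finitely_generated_def by blast
qed

lemma projective_of_basis:
  assumes "module R V" "is_basis R V I b"
  shows "projective_module R V"
  unfolding projective_module_def
proof (intro allI ballI impI)
  interpret V: module R V by fact
  note bD = V.basisD[OF assms(2)]
  fix N N' :: "('a, nat \<Rightarrow> 'a) module" and g f
  assume g: "g \<in> linear_maps R N N'" and f: "f \<in> linear_maps R V N'"
    and N: "module R N \<and> module R N' \<and> g ` carrier N = carrier N'"
  define n where "n i = inv_into (carrier N) g (f (b i))" for i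
  have n: "n i \<in> carrier N" "g (n i) = f (b i)" if "i \<in> I" for i
    using N linear_mapsD(1)[OF f bD(3)[OF that]] f_inv_into_f[of "f (b i)" g "carrier N"]
      inv_into_into[of "f (b i)" g "carrier N"] by (simp_all add: n_def)
  obtain h where h: "h \<in> linear_maps R V N" "\<And>i. i \<in> I \<Longrightarrow> h (b i) = n i"
    using V.linear_extend[OF assms(2), of N n] N n by (auto simp: Pi_iff)
  have "g (h x) = f x" if "x \<in> carrier V" for x
    using V.linear_eq_on_basis[OF assms(2) _ linear_maps_comp[OF h(1) g] f _ that] N h n by simp
  then show "\<exists>h\<in>linear_maps R V N. \<forall>x\<in>carrier V. g (h x) = f x" using h by blast
qed

lemma (in inner_product_space) form_space: "form_space R V"
  by unfold_locales (rule bilinear, rule symmetric)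

context form_space
begin

lemma form_linear: "x \<in> carrier V \<Longrightarrow> form V x \<in> linear_maps R V (self_module R)"
  using bilinear_mapD(1)[OF bilinear] .

text \<open>Both sides are linear in \<open>x\<close> and agree on the basis. This is how products
  with a vector control its coordinates, for instance when they all lie in
  \<open>\<mm>\<close>.\<close>

lemma coord_eq_form:
  assumes b: "is_basis R V I b" and h: "dual_basis R V I b h" and i: "i \<in> I" and x: "x \<in> carrier V"
  shows "coord R V I b x i = form V (h i) x"
proof (rule linear_eq_on_basis[OF b R.module_self_module coord_linear[OF b i] form_linear _ x])
  show "h i \<in> carrier V" using h i by (auto simp: dual_basis_def)
  show "coord R V I b (b j) i = form V (h i) (b j)" if "j \<in> I" for j
    using coord_basis[OF b that i] h i that by (simp add: dual_basis_def eq_commute)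
qed

lemma inner_product_spaceI:
  assumes b: "is_basis R V I b" and h: "dual_basis R V I b h"
  shows "inner_product_space R V"
proof -
  note bD = basisD[OF b]
  have hV: "h \<in> I \<rightarrow> carrier V" using h by (simp add: dual_basis_def)
  have dual: "(\<lambda>w\<in>carrier V. form V v w) \<in> dual R V" if "v \<in> carrier V" for v
    unfolding dual_def using that by (auto intro!: linear_mapsI simp: form_add_r form_smult_r)
  have "bij_betw (\<lambda>v. \<lambda>w\<in>carrier V. form V v w) (carrier V) (dual R V)"
    unfolding bij_betw_def
  proof
    show "inj_on (\<lambda>v. \<lambda>w\<in>carrier V. form V v w) (carrier V)"
    proof (rule inj_onI)
      fix v w assume vw: "v \<in> carrier V" "w \<in> carrier V"
        and "(\<lambda>x\<in>carrier V. form V v x) = (\<lambda>x\<in>carrier V. form V w x)"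
      then have eq: "form V v x = form V w x" if "x \<in> carrier V" for x
        using that by (metis restrict_apply')
      have "coord R V I b v i = coord R V I b w i" if "i \<in> I" for i
      proof -
        have hi: "h i \<in> carrier V" using hV that by auto
        show ?thesis using coord_eq_form[OF b h that] vw eq[OF hi] symmetric[OF hi] by simp
      qed
      then have "coord R V I b v = coord R V I b w"
        by (rule PiE_ext[OF coord_PiE[OF b vw(1)] coord_PiE[OF b vw(2)]])
      then show "v = w" using comb_coord[OF b] vw by metis
    qed
    show "(\<lambda>v. \<lambda>w\<in>carrier V. form V v w) ` carrier V = dual R V"
    proof
      show "dual R V \<subseteq> (\<lambda>v. \<lambda>w\<in>carrier V. form V v w) ` carrier V"
      proof
        fix \<phi> assume \<phi>: "\<phi> \<in> dual R V"
        then have l: "\<phi> \<in> linear_maps R V (self_module R)" and ext: "\<phi> \<in> extensional (carrier V)"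
          by (simp_all add: dual_def)
        let ?c = "\<lambda>k. \<phi> (b k)"
        have c: "?c \<in> I \<rightarrow> carrier R" using linear_mapsD(1)[OF l] bD(3) by (simp add: Pi_iff)
        \<comment> \<open>The functional is represented by its values on the basis, taken as
          coefficients over the dual basis.\<close>
        let ?v = "comb V I h ?c"
        have v: "?v \<in> carrier V" by (rule comb_closed[OF hV c])
        have "form V ?v (b j) = \<phi> (b j)" if j: "j \<in> I" for j
        proof -
          interpret S: module R "self_module R" by (rule R.module_self_module)
          have "form V ?v (b j) = comb (self_module R) I (\<lambda>i. form V (h i) (b j)) ?c"
            using linear_comb[OF R.module_self_module bilinear_mapD(2)[OF bilinear bD(3)[OF j]] bD(1) hV c] .
          also have "\<dots> = comb (self_module R) I ?c (\<lambda>i. if i = j then \<one> else \<zero>)"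
            unfolding comb_def using h j c
            by (intro S.finsum_cong') (simp_all add: dual_basis_def Pi_iff eq_commute)
          also have "\<dots> = \<phi> (b j)" using S.comb_delta[OF bD(1) _ j, of ?c] c by simp
          finally show ?thesis .
        qed
        then have "form V ?v x = \<phi> x" if "x \<in> carrier V" for x
          using linear_eq_on_basis[OF b R.module_self_module form_linear[OF v] l _ that] by blast
        then have "\<phi> = (\<lambda>w\<in>carrier V. form V ?v w)"
          using ext by (intro extensionalityI[of _ "carrier V"]) simp_all
        then show "\<phi> \<in> (\<lambda>v. \<lambda>w\<in>carrier V. form V v w) ` carrier V" using v by blast
      qed
    qed (use dual in blast)
  qed
  then show ?thesis
    by (intro inner_product_space.intro inner_product_space_axioms.intro module_axioms
        finitely_generated_of_basis[OF module_axioms b] projective_of_basis[OF module_axioms b] bilinear symmetric)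
qed

end

text \<open>The surjectivity in \<open>nondegenerate\<close> represents each coordinate functional
  by a vector.\<close>

lemma (in inner_product_space) ex_dual_basis:
  assumes b: "is_basis R V I b"
  obtains h where "dual_basis R V I b h"
proof -
  interpret F: form_space R V by (rule form_space)
  have "\<exists>v\<in>carrier V. \<forall>j\<in>I. form V v (b j) = (if j = i then \<one> else \<zero>)" if i: "i \<in> I" for i
  proof -
    let ?\<phi> = "\<lambda>x\<in>carrier V. coord R V I b x i"
    note l = coord_linear[OF b i]
    have "?\<phi> \<in> dual R V"
      unfolding dual_def using linear_mapsD[OF l] by (auto intro!: linear_mapsI)
    then obtain v where v: "v \<in> carrier V" "?\<phi> = (\<lambda>w\<in>carrier V. form V v w)"
      using nondegenerate unfolding bij_betw_def by blast
    have "form V v (b j) = (if j = i then \<one> else \<zero>)" if j: "j \<in> I" for j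
    proof -
      have bj: "b j \<in> carrier V" using basisD(3)[OF b j] .
      have "form V v (b j) = ?\<phi> (b j)" using v(2) bj by simp
      also have "\<dots> = (if j = i then \<one> else \<zero>)" using coord_basis[OF b j i] bj by (simp add: eq_commute)
      finally show ?thesis .
    qed
    then show ?thesis using v by blast
  qed
  then obtain h where "\<forall>i\<in>I. h i \<in> carrier V \<and> (\<forall>j\<in>I. form V (h i) (b j) = (if j = i then \<one> else \<zero>))"
    by metis
  then show ?thesis using that[of h] by (simp add: dual_basis_def Pi_iff)
qed

subsection \<open>Gram matrices\<close>

text \<open>The index set is free, so that matrices of sums and products need no renumbering. Two
  form spaces with a common Gram matrix are isometric, by \<open>isometric_of_gram\<close>.\<close>

definition has_gram :: "('a, 'r) ring_scheme \<Rightarrow> ('a, 'b, 'v) form_module_scheme \<Rightarrow> 'i set \<Rightarrow> ('i \<Rightarrow> 'i \<Rightarrow> 'a) \<Rightarrow> bool" where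
  "has_gram R V I G \<longleftrightarrow> (\<exists>b. is_basis R V I b \<and> (\<forall>i\<in>I. \<forall>j\<in>I. form V (b i) (b j) = G i j))"

lemma has_gram_finite: "has_gram R V I G \<Longrightarrow> finite I"
  by (auto simp: has_gram_def is_basis_def)

lemma has_gram_reindex:
  assumes "module R V" "has_gram R V I G" "bij_betw \<pi> J I"
    "\<And>i j. \<lbrakk>i \<in> J; j \<in> J\<rbrakk> \<Longrightarrow> G' i j = G (\<pi> i) (\<pi> j)"
  shows "has_gram R V J G'"
proof -
  obtain b where b: "is_basis R V I b" "\<forall>i\<in>I. \<forall>j\<in>I. form V (b i) (b j) = G i j"
    using assms(2) by (auto simp: has_gram_def)
  have "\<pi> j \<in> I" if "j \<in> J" for j using assms(3) that by (auto simp: bij_betw_def)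
  then show ?thesis
    using module.is_basis_reindex[OF assms(1) b(1) assms(3)] b(2) assms(4)
    unfolding has_gram_def by (intro exI[of _ "\<lambda>j. b (\<pi> j)"]) simp
qed

lemma has_gram_isometric:
  assumes "module R V" "module R W" "has_gram R V I G" "isometric R V W"
  shows "has_gram R W I G"
proof -
  obtain b where b: "is_basis R V I b" "\<forall>i\<in>I. \<forall>j\<in>I. form V (b i) (b j) = G i j"
    using assms(3) by (auto simp: has_gram_def)
  obtain f where f: "f \<in> linear_maps R V W" "bij_betw f (carrier V) (carrier W)"
    "\<forall>x\<in>carrier V. \<forall>y\<in>carrier V. form W (f x) (f y) = form V x y"
    using assms(4) by (auto simp: isometric_def)
  show ?thesis
    using is_basis_image[OF assms(1,2) b(1) f(1,2)] b(2) f(3) module.basisD(3)[OF assms(1) b(1)]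
    unfolding has_gram_def by (intro exI[of _ "\<lambda>i. f (b i)"]) simp
qed

lemma form_preserved:
  assumes V: "form_space R V" and W: "form_space R W" and b: "is_basis R V I b"
    and f: "f \<in> linear_maps R V W"
    and eq: "\<And>i j. \<lbrakk>i \<in> I; j \<in> I\<rbrakk> \<Longrightarrow> form W (f (b i)) (f (b j)) = form V (b i) (b j)"
    and xy: "x \<in> carrier V" "y \<in> carrier V"
  shows "form W (f x) (f y) = form V x y"
proof -
  interpret V: form_space R V by fact
  interpret W: form_space R W by fact
  show ?thesis
    by (rule bilinear_eq_on_bases[OF V.module_axioms V.module_axioms V.R.module_self_module b b
          bilinear_map_compose[OF W.bilinear f f linear_maps_id] V.bilinear eq xy])
qed

lemma isometric_of_gram:
  assumes V: "form_space R V" and W: "form_space R W" and gr: "has_gram R V I G" "has_gram R W I G"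
  shows "isometric R V W"
proof -
  interpret V: form_space R V by fact
  interpret W: form_space R W by fact
  obtain b d where b: "is_basis R V I b" "\<forall>i\<in>I. \<forall>j\<in>I. form V (b i) (b j) = G i j"
    and d: "is_basis R W I d" "\<forall>i\<in>I. \<forall>j\<in>I. form W (d i) (d j) = G i j"
    using gr by (auto simp: has_gram_def)
  obtain f where f: "f \<in> linear_maps R V W" "bij_betw f (carrier V) (carrier W)" "\<And>i. i \<in> I \<Longrightarrow> f (b i) = d i"
    using linear_bij_of_bases[OF V.module_axioms W.module_axioms b(1) d(1)] by blast
  have "form W (f x) (f y) = form V x y" if "x \<in> carrier V" "y \<in> carrier V" for x y
    by (rule form_preserved[OF V W b(1) f(1) _ that]) (use f(3) b(2) d(2) in simp)
  then show ?thesis using f unfolding isometric_def by blast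
qed

lemma inner_product_space_isometric:
  assumes V: "inner_product_space R V" and W: "form_space R W" and "is_basis R V I b" "isometric R V W"
  shows "inner_product_space R W"
proof -
  interpret V: inner_product_space R V by fact
  interpret W: form_space R W by fact
  obtain h where h: "dual_basis R V I b h" using V.ex_dual_basis[OF assms(3)] .
  obtain f where f: "f \<in> linear_maps R V W" "bij_betw f (carrier V) (carrier W)"
    "\<forall>x\<in>carrier V. \<forall>y\<in>carrier V. form W (f x) (f y) = form V x y"
    using assms(4) by (auto simp: isometric_def)
  have "dual_basis R W I (\<lambda>i. f (b i)) (\<lambda>i. f (h i))"
    using h f linear_mapsD(1)[OF f(1)] V.basisD(3)[OF assms(3)] by (simp add: dual_basis_def Pi_iff)
  then show ?thesis
    by (rule W.inner_product_spaceI[OF is_basis_image[OF V.module_axioms W.module_axioms assms(3) f(1,2)]])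
qed

lemma ex_coordinate_form_space:
  assumes "cring R" "finite I" "\<And>i j. \<lbrakk>i \<in> I; j \<in> I\<rbrakk> \<Longrightarrow> G i j \<in> carrier R"
    "\<And>i j. \<lbrakk>i \<in> I; j \<in> I\<rbrakk> \<Longrightarrow> G i j = G j i"
  obtains V :: "('a, 'i \<Rightarrow> 'a) form_module"
  where "form_space (R :: ('a, 'r) ring_scheme) V" "is_basis R V I (unit_vec R I)"
    "\<And>i j. \<lbrakk>i \<in> I; j \<in> I\<rbrakk> \<Longrightarrow> form V (unit_vec R I i) (unit_vec R I j) = G i j"
proof -
  interpret cring R by fact
  let ?K = "coord_space R I undefined"
  note b = unit_vec_basis[OF assms(2)] and m = module_coord_space and s = module_self_module
  obtain t where t: "bilinear_map R ?K ?K (self_module R) t"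
    "\<And>i j. \<lbrakk>i \<in> I; j \<in> I\<rbrakk> \<Longrightarrow> t (unit_vec R I i) (unit_vec R I j) = G i j"
    using bilinear_extend[OF m m s b b, of G] assms(3) by auto
  have t': "bilinear_map R ?K ?K (self_module R) (\<lambda>x y. t y x)"
    using t(1) by (auto simp: bilinear_map_def)
  let ?V = "coord_space R I t"
  have bil: "bilinear_map R ?V ?V (self_module R) (form ?V)"
    using t(1) by (simp add: bilinear_map_def linear_maps_def hom_def)
  have sym: "form ?V v w = form ?V w v" if "v \<in> carrier ?V" "w \<in> carrier ?V" for v w
    using bilinear_eq_on_bases[OF m m s b b t(1) t', of v w] that t(2) assms(4) by simp
  have "form_space R ?V"
    by (intro form_space.intro form_space_axioms.intro m bil sym)
  then show ?thesis using that[of ?V] t(2) b by simp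
qed

subsection \<open>Orthogonal sums\<close>

lemma ball_Plus: "(\<forall>k\<in>I <+> J. P k) \<longleftrightarrow> (\<forall>i\<in>I. P (Inl i)) \<and> (\<forall>j\<in>J. P (Inr j))"
  by blast

lemma orthogonal_sum_simps [simp]:
  "carrier (orthogonal_sum R V W) = carrier V \<times> carrier W"
  "ring.zero (orthogonal_sum R V W) = (\<zero>\<^bsub>V\<^esub>, \<zero>\<^bsub>W\<^esub>)"
  "(v, w) \<oplus>\<^bsub>orthogonal_sum R V W\<^esub> (v', w') = (v \<oplus>\<^bsub>V\<^esub> v', w \<oplus>\<^bsub>W\<^esub> w')"
  "a \<odot>\<^bsub>orthogonal_sum R V W\<^esub> (v, w) = (a \<odot>\<^bsub>V\<^esub> v, a \<odot>\<^bsub>W\<^esub> w)"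
  "form (orthogonal_sum R V W) (v, w) (v', w') = form V v v' \<oplus>\<^bsub>R\<^esub> form W w w'"
  by (simp_all add: orthogonal_sum_def)

lemma module_orthogonal_sum:
  assumes "module R V" "module R W" shows "module R (orthogonal_sum R V W)"
proof -
  interpret V: module R V by fact
  interpret W: module R W by fact
  show ?thesis
  proof (rule moduleI)
    show "abelian_group (orthogonal_sum R V W)"
    proof (rule abelian_groupI)
      fix x assume "x \<in> carrier (orthogonal_sum R V W)"
      then obtain v w where x: "x = (v, w)" "v \<in> carrier V" "w \<in> carrier W" by auto
      show "\<exists>y\<in>carrier (orthogonal_sum R V W). y \<oplus>\<^bsub>orthogonal_sum R V W\<^esub> x = \<zero>\<^bsub>orthogonal_sum R V W\<^esub>"
        by (rule bexI[of _ "(\<ominus>\<^bsub>V\<^esub> v, \<ominus>\<^bsub>W\<^esub> w)"]) (simp_all add: x V.M.l_neg W.M.l_neg)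
    qed (auto simp: V.M.a_assoc W.M.a_assoc intro: V.M.a_comm W.M.a_comm)
  qed (auto simp: V.is_cring V.smult_l_distr W.smult_l_distr V.smult_r_distr W.smult_r_distr
      V.smult_assoc1 W.smult_assoc1)
qed

lemma form_space_orthogonal_sum:
  assumes "form_space R V" "form_space R W" shows "form_space R (orthogonal_sum R V W)"
proof -
  interpret V: form_space R V by fact
  interpret W: form_space R W by fact
  let ?S = "orthogonal_sum R V W"
  have ac: "(a \<oplus>\<^bsub>R\<^esub> b) \<oplus>\<^bsub>R\<^esub> (c \<oplus>\<^bsub>R\<^esub> d) = (a \<oplus>\<^bsub>R\<^esub> c) \<oplus>\<^bsub>R\<^esub> (b \<oplus>\<^bsub>R\<^esub> d)"
    if "a \<in> carrier R" "b \<in> carrier R" "c \<in> carrier R" "d \<in> carrier R" for a b c d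
    using that by (simp add: V.R.a_ac)
  have "bilinear_map R ?S ?S (self_module R) (form ?S)"
    by (rule bilinear_mapI)
      (auto simp: V.form_lin W.form_lin ac V.R.r_distr)
  then show ?thesis
    by (intro form_space.intro form_space_axioms.intro module_orthogonal_sum V.module_axioms W.module_axioms)
      (auto simp: V.symmetric W.symmetric)
qed

lemma is_basis_orthogonal_sum:
  assumes mod: "module R V" "module R W" and b: "is_basis R V I b" and d: "is_basis R W J d"
  shows "is_basis R (orthogonal_sum R V W) (I <+> J) (case_sum (\<lambda>i. (b i, \<zero>\<^bsub>W\<^esub>)) (\<lambda>j. (\<zero>\<^bsub>V\<^esub>, d j)))"
proof -
  interpret V: module R V by fact
  interpret W: module R W by fact
  let ?S = "orthogonal_sum R V W" and ?e = "case_sum (\<lambda>i. (b i, \<zero>\<^bsub>W\<^esub>)) (\<lambda>j. (\<zero>\<^bsub>V\<^esub>, d j))"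
  interpret S: module R ?S by (rule module_orthogonal_sum[OF mod])
  note bD = V.basisD[OF b] and dD = W.basisD[OF d]
  have fin: "finite (I <+> J)" using bD dD by simp
  have e: "?e \<in> I <+> J \<rightarrow> carrier ?S" using bD(3) dD(3) by (auto simp: Pi_iff)
  have fst: "fst \<in> linear_maps R ?S V" and snd: "snd \<in> linear_maps R ?S W"
    by (auto intro!: linear_mapsI)
  have comb: "comb ?S (I <+> J) ?e c = (comb V I b (\<lambda>i. c (Inl i)), comb W J d (\<lambda>j. c (Inr j)))"
    if c: "c \<in> I <+> J \<rightarrow> carrier R" for c
  proof (rule prod_eqI)
    have cI: "(\<lambda>i. c (Inl i)) \<in> I \<rightarrow> carrier R" "(\<lambda>j. c (Inr j)) \<in> J \<rightarrow> carrier R"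
      using c by (auto simp: Pi_iff)
    have "fst (comb ?S (I <+> J) ?e c) = comb V (I <+> J) (\<lambda>k. fst (?e k)) c"
      by (rule S.linear_comb[OF mod(1) fst fin e c])
    also have "\<dots> = comb V I b (\<lambda>i. c (Inl i))"
      using e c bD cI dD V.comb_closed[OF bD(2) cI(1)]
      by (subst V.comb_Plus) (auto simp: Pi_iff V.comb_zero_vectors)
    finally show "fst (comb ?S (I <+> J) ?e c) = fst (comb V I b (\<lambda>i. c (Inl i)), comb W J d (\<lambda>j. c (Inr j)))"
      by simp
    have "snd (comb ?S (I <+> J) ?e c) = comb W (I <+> J) (\<lambda>k. snd (?e k)) c"
      by (rule S.linear_comb[OF mod(2) snd fin e c])
    also have "\<dots> = comb W J d (\<lambda>j. c (Inr j))"
      using e c bD cI dD W.comb_closed[OF dD(2) cI(2)]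
      by (subst W.comb_Plus) (auto simp: Pi_iff W.comb_zero_vectors)
    finally show "snd (comb ?S (I <+> J) ?e c) = snd (comb V I b (\<lambda>i. c (Inl i)), comb W J d (\<lambda>j. c (Inr j)))"
      by simp
  qed
  show ?thesis
  proof (rule S.is_basisI[OF fin e])
    fix x assume "x \<in> carrier ?S"
    then obtain v w where x: "x = (v, w)" "v \<in> carrier V" "w \<in> carrier W" by auto
    let ?c = "case_sum (coord R V I b v) (coord R W J d w)"
    have c: "?c \<in> I <+> J \<rightarrow> carrier R" using V.coord_closed[OF b] W.coord_closed[OF d] x by (auto simp: Pi_iff)
    then have "x = comb ?S (I <+> J) ?e ?c" using comb V.comb_coord[OF b] W.comb_coord[OF d] x by simp
    then show "\<exists>c\<in>I <+> J \<rightarrow> carrier R. x = comb ?S (I <+> J) ?e c" using c by blast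
  next
    fix c assume c: "c \<in> I <+> J \<rightarrow> carrier R" "comb ?S (I <+> J) ?e c = \<zero>\<^bsub>?S\<^esub>"
    have cI: "(\<lambda>i. c (Inl i)) \<in> I \<rightarrow> carrier R" "(\<lambda>j. c (Inr j)) \<in> J \<rightarrow> carrier R"
      using c by (auto simp: Pi_iff)
    have "comb V I b (\<lambda>i. c (Inl i)) = \<zero>\<^bsub>V\<^esub>" "comb W J d (\<lambda>j. c (Inr j)) = \<zero>\<^bsub>W\<^esub>"
      using comb[OF c(1)] c(2) by simp_all
    from V.basis_indep[OF b cI(1) this(1)] W.basis_indep[OF d cI(2) this(2)]
    show "\<forall>k\<in>I <+> J. c k = \<zero>\<^bsub>R\<^esub>" by (simp add: ball_Plus)
  qed
qed

lemma has_gram_orthogonal_sum: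
  assumes V: "form_space R V" "has_gram R V I G" and W: "form_space R W" "has_gram R W J H"
  shows "has_gram R (orthogonal_sum R V W) (I <+> J)
    (\<lambda>k l. case (k, l) of (Inl i, Inl i') \<Rightarrow> G i i' | (Inr j, Inr j') \<Rightarrow> H j j' | _ \<Rightarrow> \<zero>\<^bsub>R\<^esub>)"
proof -
  interpret V: form_space R V by fact
  interpret W: form_space R W by fact
  obtain b d where b: "is_basis R V I b" "\<forall>i\<in>I. \<forall>j\<in>I. form V (b i) (b j) = G i j"
    and d: "is_basis R W J d" "\<forall>i\<in>J. \<forall>j\<in>J. form W (d i) (d j) = H i j"
    using assms by (auto simp: has_gram_def)
  note bV = V.basisD(3)[OF b(1)] and dW = W.basisD(3)[OF d(1)]
  have "G i j \<in> carrier R" if "i \<in> I" "j \<in> I" for i j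
    using b(2) V.form_closed[OF bV bV] that by metis
  moreover have "H i j \<in> carrier R" if "i \<in> J" "j \<in> J" for i j
    using d(2) W.form_closed[OF dW dW] that by metis
  ultimately show ?thesis
    unfolding has_gram_def using b(2) d(2) bV dW
    by (intro exI[of _ "case_sum (\<lambda>i. (b i, \<zero>\<^bsub>W\<^esub>)) (\<lambda>j. (\<zero>\<^bsub>V\<^esub>, d j))"] conjI
        is_basis_orthogonal_sum[OF V.module_axioms W.module_axioms b(1) d(1)]) (simp add: ball_Plus)
qed

lemma inner_product_space_orthogonal_sum:
  assumes V: "inner_product_space R V" "is_basis R V I b" and W: "inner_product_space R W" "is_basis R W J d"
  shows "inner_product_space R (orthogonal_sum R V W)"
proof -
  interpret V: inner_product_space R V by fact
  interpret W: inner_product_space R W by fact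
  interpret FV: form_space R V by (rule V.form_space)
  interpret FW: form_space R W by (rule W.form_space)
  interpret S: form_space R "orthogonal_sum R V W"
    by (rule form_space_orthogonal_sum[OF V.form_space W.form_space])
  obtain h where h: "dual_basis R V I b h" using V.ex_dual_basis[OF V(2)] .
  obtain k where k: "dual_basis R W J d k" using W.ex_dual_basis[OF W(2)] .
  note bV = V.basisD(3)[OF V(2)] and dW = W.basisD(3)[OF W(2)]
  have "dual_basis R (orthogonal_sum R V W) (I <+> J) (case_sum (\<lambda>i. (b i, \<zero>\<^bsub>W\<^esub>)) (\<lambda>j. (\<zero>\<^bsub>V\<^esub>, d j)))
    (case_sum (\<lambda>i. (h i, \<zero>\<^bsub>W\<^esub>)) (\<lambda>j. (\<zero>\<^bsub>V\<^esub>, k j)))"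
    using h k bV dW by (simp add: dual_basis_def Pi_iff ball_Plus)
  then show ?thesis
    by (rule S.inner_product_spaceI[OF is_basis_orthogonal_sum[OF V.module_axioms W.module_axioms V(2) W(2)]])
qed

subsection \<open>Tensor products\<close>

lemma linear_maps_restrict:
  assumes "module R V" "f \<in> linear_maps R V W"
  shows "restrict f (carrier V) \<in> linear_maps R V W \<inter> extensional (carrier V)"
proof -
  interpret module R V by fact
  show ?thesis using linear_mapsD[OF assms(2)] by (auto intro!: linear_mapsI)
qed

lemma (in cring) bilinear_product:
  assumes "f \<in> linear_maps R V (self_module R)" "g \<in> linear_maps R W (self_module R)"
  shows "bilinear_map R V W (self_module R) (\<lambda>v w. f v \<otimes> g w)"
  using linear_mapsD[OF assms(1)] linear_mapsD[OF assms(2)]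
  by (intro bilinear_mapI) (simp_all add: l_distr r_distr m_ac)

lemma bilinear_map_truncate [simp]:
  "bilinear_map R V W (module.truncate P) t \<longleftrightarrow> bilinear_map R V W P t"
  by (simp add: bilinear_map_def)

text \<open>A space free on the pairs of basis vectors is a tensor product: linear maps out of it
  are determined by its basis and bilinear maps by the two given bases, so the universal property
  and the product formula are checked there.\<close>

lemma tensor_product_of_bases:
  fixes R :: "('a, 'r) ring_scheme"
  assumes V: "form_space R V" and W: "form_space R W" and T: "form_space R T"
    and b: "is_basis R V I b" and d: "is_basis R W J d" and e: "is_basis R T (I \<times> J) e"
    and form: "\<And>i i' j j'. \<lbrakk>i \<in> I; i' \<in> I; j \<in> J; j' \<in> J\<rbrakk> \<Longrightarrow>
      form T (e (i, j)) (e (i', j')) = form V (b i) (b i') \<otimes>\<^bsub>R\<^esub> form W (d j) (d j')"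
  obtains t where "bilinear_map R V W T t" "\<And>i j. \<lbrakk>i \<in> I; j \<in> J\<rbrakk> \<Longrightarrow> t (b i) (d j) = e (i, j)"
    "\<And>(N :: ('a, nat \<Rightarrow> 'a) module) s. \<lbrakk>module R N; bilinear_map R V W N s\<rbrakk> \<Longrightarrow>
      \<exists>!h. h \<in> linear_maps R T N \<inter> extensional (carrier T) \<and> (\<forall>v\<in>carrier V. \<forall>w\<in>carrier W. h (t v w) = s v w)"
    "\<And>v v' w w'. \<lbrakk>v \<in> carrier V; v' \<in> carrier V; w \<in> carrier W; w' \<in> carrier W\<rbrakk> \<Longrightarrow>
      form T (t v w) (t v' w') = form V v v' \<otimes>\<^bsub>R\<^esub> form W w w'"
proof -
  interpret V: form_space R V by fact
  interpret W: form_space R W by fact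
  interpret T: form_space R T by fact
  note mV = V.module_axioms and mW = W.module_axioms and mT = T.module_axioms
  note mS = V.R.module_self_module
  note bD = V.basisD(3)[OF b] and dD = W.basisD(3)[OF d] and eD = T.basisD(3)[OF e]
  obtain t where t: "bilinear_map R V W T t" "\<And>i j. \<lbrakk>i \<in> I; j \<in> J\<rbrakk> \<Longrightarrow> t (b i) (d j) = e (i, j)"
    using bilinear_extend[OF mV mW mT b d, of "\<lambda>i j. e (i, j)"] eD by auto
  have tc: "t v w \<in> carrier T" if "v \<in> carrier V" "w \<in> carrier W" for v w
    by (rule bilinear_map_closed[OF t(1) that])
  have univ: "\<exists>!h. h \<in> linear_maps R T N \<inter> extensional (carrier T) \<and> (\<forall>v\<in>carrier V. \<forall>w\<in>carrier W. h (t v w) = s v w)"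
    if N: "module R N" and s: "bilinear_map R V W N s" for N :: "('a, nat \<Rightarrow> 'a) module" and s
  proof (rule ex_ex1I)
    have "(\<lambda>p. s (b (fst p)) (d (snd p))) \<in> I \<times> J \<rightarrow> carrier N"
      using bilinear_map_closed[OF s bD dD] by (simp add: Pi_iff)
    from T.linear_extend[OF e N this] obtain h where h: "h \<in> linear_maps R T N"
      "\<And>p. p \<in> I \<times> J \<Longrightarrow> h (e p) = s (b (fst p)) (d (snd p))" by blast
    have ht: "h (t v w) = s v w" if "v \<in> carrier V" "w \<in> carrier W" for v w
      by (rule bilinear_eq_on_bases[OF mV mW N b d
            bilinear_map_compose[OF t(1) linear_maps_id linear_maps_id h(1)] s _ that])
        (simp add: t(2) h(2))
    show "\<exists>h. h \<in> linear_maps R T N \<inter> extensional (carrier T) \<and> (\<forall>v\<in>carrier V. \<forall>w\<in>carrier W. h (t v w) = s v w)"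
      by (rule exI[of _ "restrict h (carrier T)"])
        (use linear_maps_restrict[OF mT h(1)] ht tc in simp)
  next
    fix h k
    assume h: "h \<in> linear_maps R T N \<inter> extensional (carrier T) \<and> (\<forall>v\<in>carrier V. \<forall>w\<in>carrier W. h (t v w) = s v w)"
      and k: "k \<in> linear_maps R T N \<inter> extensional (carrier T) \<and> (\<forall>v\<in>carrier V. \<forall>w\<in>carrier W. k (t v w) = s v w)"
    have "h (e p) = k (e p)" if p: "p \<in> I \<times> J" for p
    proof -
      obtain i j where ij: "p = (i, j)" "i \<in> I" "j \<in> J" using p by auto
      have "h (t (b i) (d j)) = k (t (b i) (d j))" using h k bD dD ij by simp
      then show ?thesis using t(2)[OF ij(2,3)] ij(1) by simp
    qed
    then have "h x = k x" if "x \<in> carrier T" for x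
      using T.linear_eq_on_basis[OF e N _ _ _ that, of h k] h k by blast
    then show "h = k" using h k by (intro extensionalityI[of h "carrier T" k]) auto
  qed
  have lin: "(\<lambda>x. form T x z) \<in> linear_maps R T (self_module R)" if "z \<in> carrier T" for z
    by (rule bilinear_mapD(2)[OF T.bilinear that])
  have linV: "(\<lambda>x. form V x z) \<in> linear_maps R V (self_module R)" if "z \<in> carrier V" for z
    by (rule bilinear_mapD(2)[OF V.bilinear that])
  have linW: "(\<lambda>x. form W x z) \<in> linear_maps R W (self_module R)" if "z \<in> carrier W" for z
    by (rule bilinear_mapD(2)[OF W.bilinear that])
  \<comment> \<open>With \<open>v'\<close> and \<open>w'\<close> fixed both sides are bilinear in
    \<open>v\<close> and \<open>w\<close>. The reduction is used twice, the second time with the two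
    pairs exchanged by symmetry of the forms.\<close>
  have reduce: "form T (t v w) (t v' w') = form V v v' \<otimes>\<^bsub>R\<^esub> form W w w'"
    if v': "v' \<in> carrier V" and w': "w' \<in> carrier W" and vw: "v \<in> carrier V" "w \<in> carrier W"
      and bas: "\<And>i j. \<lbrakk>i \<in> I; j \<in> J\<rbrakk> \<Longrightarrow> form T (t (b i) (d j)) (t v' w') = form V (b i) v' \<otimes>\<^bsub>R\<^esub> form W (d j) w'"
    for v v' w w'
    by (rule bilinear_eq_on_bases[OF mV mW mS b d
          bilinear_map_compose[OF t(1) linear_maps_id linear_maps_id lin[OF tc[OF v' w']]]
          V.R.bilinear_product[OF linV[OF v'] linW[OF w']] bas vw])
  have form_t: "form T (t v w) (t v' w') = form V v v' \<otimes>\<^bsub>R\<^esub> form W w w'"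
    if c: "v \<in> carrier V" "v' \<in> carrier V" "w \<in> carrier W" "w' \<in> carrier W" for v v' w w'
  proof (rule reduce[OF c(2,4,1,3)])
    fix i j assume ij: "i \<in> I" "j \<in> J"
    have "form T (t v' w') (t (b i) (d j)) = form V v' (b i) \<otimes>\<^bsub>R\<^esub> form W w' (d j)"
      by (rule reduce[OF bD[OF ij(1)] dD[OF ij(2)] c(2,4)]) (simp add: t(2) form ij)
    then show "form T (t (b i) (d j)) (t v' w') = form V (b i) v' \<otimes>\<^bsub>R\<^esub> form W (d j) w'"
      using T.symmetric[of "t v' w'" "t (b i) (d j)"] V.symmetric[of v' "b i"] W.symmetric[of w' "d j"]
        c tc bD[OF ij(1)] dD[OF ij(2)] by simp
  qed
  show ?thesis by (rule that[OF t univ form_t])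
qed

abbreviation kron :: "('a, 'r) ring_scheme \<Rightarrow> ('i \<Rightarrow> 'i \<Rightarrow> 'a) \<Rightarrow> ('j \<Rightarrow> 'j \<Rightarrow> 'a) \<Rightarrow> 'i \<times> 'j \<Rightarrow> 'i \<times> 'j \<Rightarrow> 'a" where
  "kron R G H \<equiv> \<lambda>p q. G (fst p) (fst q) \<otimes>\<^bsub>R\<^esub> H (snd p) (snd q)"

lemma tensor_product_of_gram:
  assumes V: "form_space R V" "has_gram R V I G" and W: "form_space R W" "has_gram R W J H"
    and T: "form_space R T" "has_gram R T (I \<times> J) (kron R G H)"
  shows "tensor_product R V W T"
proof -
  obtain b where b: "is_basis R V I b" "\<forall>i\<in>I. \<forall>j\<in>I. form V (b i) (b j) = G i j"
    using V by (auto simp: has_gram_def)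
  obtain d where d: "is_basis R W J d" "\<forall>i\<in>J. \<forall>j\<in>J. form W (d i) (d j) = H i j"
    using W by (auto simp: has_gram_def)
  obtain e where e: "is_basis R T (I \<times> J) e" "\<forall>p\<in>I \<times> J. \<forall>q\<in>I \<times> J. form T (e p) (e q) = kron R G H p q"
    using T by (auto simp: has_gram_def)
  obtain t where t: "bilinear_map R V W T t"
    "\<And>(N :: ('a, nat \<Rightarrow> 'a) module) s. \<lbrakk>module R N; bilinear_map R V W N s\<rbrakk> \<Longrightarrow>
      \<exists>!h. h \<in> linear_maps R T N \<inter> extensional (carrier T) \<and> (\<forall>v\<in>carrier V. \<forall>w\<in>carrier W. h (t v w) = s v w)"
    "\<And>v v' w w'. \<lbrakk>v \<in> carrier V; v' \<in> carrier V; w \<in> carrier W; w' \<in> carrier W\<rbrakk> \<Longrightarrow>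
      form T (t v w) (t v' w') = form V v v' \<otimes>\<^bsub>R\<^esub> form W w w'"
    by (rule tensor_product_of_bases[OF V(1) W(1) T(1) b(1) d(1) e(1)]) (use b d e in auto)
  show ?thesis unfolding tensor_product_def
    by (rule exI[of _ t]) (use t in blast)
qed

text \<open>The indices are relabelled by an initial segment of the natural numbers, so that the
  space lands on the carrier type on which isometry classes are formed.\<close>

lemma ex_nat_form_space:
  fixes R :: "('a, 'r) ring_scheme" and I :: "'i set"
  assumes "cring R" "finite I" "\<And>i j. \<lbrakk>i \<in> I; j \<in> I\<rbrakk> \<Longrightarrow> G i j \<in> carrier R"
    "\<And>i j. \<lbrakk>i \<in> I; j \<in> I\<rbrakk> \<Longrightarrow> G i j = G j i"
  obtains V :: "('a, nat \<Rightarrow> 'a) form_module" where "form_space R V" "has_gram R V I G"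
proof -
  interpret cring R by fact
  obtain \<pi> where \<pi>: "bij_betw \<pi> I {..<card I}" using ex_bij_betw_finite_nat[OF assms(2)] by (auto simp: atLeast0LessThan)
  let ?g = "inv_into I \<pi>"
  have g: "?g k \<in> I" if "k < card I" for k
    using \<pi> that inv_into_into[of k \<pi> I] by (simp add: bij_betw_def)
  obtain V :: "('a, nat \<Rightarrow> 'a) form_module" where V: "form_space R V"
    "is_basis R V {..<card I} (unit_vec R {..<card I})"
    "\<And>k l. \<lbrakk>k \<in> {..<card I}; l \<in> {..<card I}\<rbrakk> \<Longrightarrow>
      form V (unit_vec R {..<card I} k) (unit_vec R {..<card I} l) = G (?g k) (?g l)"
    using ex_coordinate_form_space[OF assms(1) finite_lessThan, of "card I" "\<lambda>k l. G (?g k) (?g l)"] assms(3,4) g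
    by auto
  interpret V: form_space R V by (rule V(1))
  have "has_gram R V {..<card I} (\<lambda>k l. G (?g k) (?g l))"
    unfolding has_gram_def using V(2,3) by blast
  from has_gram_reindex[OF V.module_axioms this \<pi>] have "has_gram R V I G"
    using \<pi> by (simp add: bij_betw_inv_into_left)
  then show ?thesis using that V(1) by blast
qed

text \<open>Uniqueness of the tensor product: \<open>T\<close> is compared with the free model
  \<open>T0\<close> by maps \<open>k\<close> and \<open>l\<close> in both directions.
  \<open>T\<close> also has to test itself, which ties it to the carrier type of the test
  modules.\<close>

lemma gram_of_tensor_product:
  fixes T :: "('a, nat \<Rightarrow> 'a, 't) form_module_scheme"
  assumes V: "form_space R V" "has_gram R V I G" and W: "form_space R W" "has_gram R W J H"
    and T: "form_space R T" "tensor_product R V W T"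
  shows "has_gram R T (I \<times> J) (kron R G H)"
proof -
  interpret V: form_space R V by fact
  interpret W: form_space R W by fact
  interpret T: form_space R T by fact
  note mV = V.module_axioms and mW = W.module_axioms and mT = T.module_axioms
  obtain b where b: "is_basis R V I b" "\<forall>i\<in>I. \<forall>j\<in>I. form V (b i) (b j) = G i j"
    using V by (auto simp: has_gram_def)
  obtain d where d: "is_basis R W J d" "\<forall>i\<in>J. \<forall>j\<in>J. form W (d i) (d j) = H i j"
    using W by (auto simp: has_gram_def)
  note bD = V.basisD(3)[OF b(1)] and dD = W.basisD(3)[OF d(1)]
  have Gc: "G i j \<in> carrier R" "G i j = G j i" if "i \<in> I" "j \<in> I" for i j
    using b(2) that V.form_closed[of "b i" "b j"] V.symmetric[of "b i" "b j"] bD by auto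
  have Hc: "H i j \<in> carrier R" "H i j = H j i" if "i \<in> J" "j \<in> J" for i j
    using d(2) that W.form_closed[of "d i" "d j"] W.symmetric[of "d i" "d j"] dD by auto
  have fin: "finite (I \<times> J)" using V.basisD(1)[OF b(1)] W.basisD(1)[OF d(1)] by simp
  have kc: "kron R G H p q \<in> carrier R" "kron R G H p q = kron R G H q p" if "p \<in> I \<times> J" "q \<in> I \<times> J" for p q
    using Gc[of "fst p" "fst q"] Hc[of "snd p" "snd q"] that by (simp_all add: mem_Times_iff)
  obtain T0 :: "('a, nat \<Rightarrow> 'a) form_module" where T0: "form_space R T0" "has_gram R T0 (I \<times> J) (kron R G H)"
    by (rule ex_nat_form_space[OF V.is_cring fin kc])
  interpret T0: form_space R T0 by (rule T0(1))
  note mT0 = T0.module_axioms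
  obtain e where e: "is_basis R T0 (I \<times> J) e" "\<forall>p\<in>I \<times> J. \<forall>q\<in>I \<times> J. form T0 (e p) (e q) = kron R G H p q"
    using T0 by (auto simp: has_gram_def)
  obtain t0 where t0: "bilinear_map R V W T0 t0" "\<And>i j. \<lbrakk>i \<in> I; j \<in> J\<rbrakk> \<Longrightarrow> t0 (b i) (d j) = e (i, j)"
    using bilinear_extend[OF mV mW mT0 b(1) d(1), of "\<lambda>i j. e (i, j)"] T0.basisD(3)[OF e(1)] by auto
  from T(2)[unfolded tensor_product_def] obtain t where t1: "bilinear_map R V W T t"
    and t2: "\<forall>(N :: ('a, nat \<Rightarrow> 'a) module) s. module R N \<and> bilinear_map R V W N s \<longrightarrow>
      (\<exists>!h. h \<in> linear_maps R T N \<inter> extensional (carrier T) \<and> (\<forall>v\<in>carrier V. \<forall>w\<in>carrier W. h (t v w) = s v w))"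
    and t3: "\<forall>v\<in>carrier V. \<forall>v'\<in>carrier V. \<forall>w\<in>carrier W. \<forall>w'\<in>carrier W.
      form T (t v w) (t v' w') = form V v v' \<otimes>\<^bsub>R\<^esub> form W w w'"
    by (elim exE conjE) (rule that)
  note t = t1 t2[rule_format, OF conjI] t3[rule_format]
  have tc: "t v w \<in> carrier T" if "v \<in> carrier V" "w \<in> carrier W" for v w
    by (rule bilinear_map_closed[OF t(1) that])
  have t0': "bilinear_map R V W (module.truncate T0) t0" using t0(1) by simp
  obtain l where l: "l \<in> linear_maps R T T0" "\<And>v w. \<lbrakk>v \<in> carrier V; w \<in> carrier W\<rbrakk> \<Longrightarrow> l (t v w) = t0 v w"
    using ex1_implies_ex[OF t(2)[OF module_truncate[OF mT0] t0']] by auto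
  have "(\<lambda>p. t (b (fst p)) (d (snd p))) \<in> I \<times> J \<rightarrow> carrier T"
    using tc bD dD by (simp add: Pi_iff)
  from T0.linear_extend[OF e(1) mT this] obtain k where k: "k \<in> linear_maps R T0 T"
    "\<And>p. p \<in> I \<times> J \<Longrightarrow> k (e p) = t (b (fst p)) (d (snd p))" by blast
  have kt: "k (t0 v w) = t v w" if "v \<in> carrier V" "w \<in> carrier W" for v w
    by (rule bilinear_eq_on_bases[OF mV mW mT b(1) d(1)
          bilinear_map_compose[OF t0(1) linear_maps_id linear_maps_id k(1)] t(1) _ that])
      (simp add: t0(2) k(2))
  have lk: "l (k x) = x" if "x \<in> carrier T0" for x
  proof (rule T0.linear_eq_on_basis[OF e(1) mT0 linear_maps_comp[OF k(1) l(1)] linear_maps_id _ that])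
    fix p assume "p \<in> I \<times> J"
    then show "l (k (e p)) = e p" using k(2)[of p] l(2)[of "b (fst p)" "d (snd p)"] t0(2) bD dD by auto
  qed
  \<comment> \<open>Both \<open>k\<close> after \<open>l\<close> and the identity factor
    \<open>t\<close> through itself, and such a factorisation is unique.\<close>
  have kl: "k (l x) = x" if x: "x \<in> carrier T" for x
  proof -
    let ?P = "\<lambda>h. h \<in> linear_maps R T (module.truncate T) \<inter> extensional (carrier T) \<and>
      (\<forall>v\<in>carrier V. \<forall>w\<in>carrier W. h (t v w) = t v w)"
    have "bilinear_map R V W (module.truncate T) t" using t(1) by simp
    from t(2)[OF module_truncate[OF mT] this] have u: "\<exists>!h. ?P h" .
    have "?P (restrict (\<lambda>x. k (l x)) (carrier T))"
      using linear_maps_restrict[OF mT linear_maps_comp[OF l(1) k(1)]] l(2) kt tc by simp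
    moreover have "?P (restrict (\<lambda>x. x) (carrier T))"
      using linear_maps_restrict[OF mT linear_maps_id] tc by simp
    ultimately have "restrict (\<lambda>x. k (l x)) (carrier T) = restrict (\<lambda>x. x) (carrier T)"
      using u by (rule_tac ex1E[OF u]) metis
    from fun_cong[OF this, of x] show ?thesis using x by simp
  qed
  have bij: "bij_betw k (carrier T0) (carrier T)"
    by (rule bij_betw_byWitness[where f' = l])
      (use lk kl linear_mapsD(1)[OF k(1)] linear_mapsD(1)[OF l(1)] in auto)
  have "form T (k x) (k y) = form T0 x y" if "x \<in> carrier T0" "y \<in> carrier T0" for x y
  proof (rule form_preserved[OF T0(1) T(1) e(1) k(1) _ that])
    fix p q assume pq: "p \<in> I \<times> J" "q \<in> I \<times> J"
    then have "form T (k (e p)) (k (e q)) = form V (b (fst p)) (b (fst q)) \<otimes>\<^bsub>R\<^esub> form W (d (snd p)) (d (snd q))"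
      using k(2) t(3) bD dD by (simp add: mem_Times_iff)
    then have "form T (k (e p)) (k (e q)) = kron R G H p q" using pq b(2) d(2) by (simp add: mem_Times_iff)
    moreover have "form T0 (e p) (e q) = kron R G H p q" using e(2) pq by blast
    ultimately show "form T (k (e p)) (k (e q)) = form T0 (e p) (e q)" by simp
  qed
  then have "isometric R T0 T" unfolding isometric_def using k(1) bij by blast
  then show ?thesis by (rule has_gram_isometric[OF mT0 mT T0(2)])
qed

text \<open>The tensors of the dual basis vectors of \<open>V\<close> and \<open>W\<close> form a
  dual basis, by the product formula for the form.\<close>

lemma inner_product_space_tensor:
  assumes V: "inner_product_space R V" "has_gram R V I G" and W: "inner_product_space R W" "has_gram R W J H"
    and T: "form_space R T" "has_gram R T (I \<times> J) (kron R G H)"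
  shows "inner_product_space R T"
proof -
  interpret V: inner_product_space R V by fact
  interpret W: inner_product_space R W by fact
  interpret T: form_space R T by fact
  obtain b where b: "is_basis R V I b" "\<forall>i\<in>I. \<forall>j\<in>I. form V (b i) (b j) = G i j"
    using V by (auto simp: has_gram_def)
  obtain d where d: "is_basis R W J d" "\<forall>i\<in>J. \<forall>j\<in>J. form W (d i) (d j) = H i j"
    using W by (auto simp: has_gram_def)
  obtain e where e: "is_basis R T (I \<times> J) e" "\<forall>p\<in>I \<times> J. \<forall>q\<in>I \<times> J. form T (e p) (e q) = kron R G H p q"
    using T by (auto simp: has_gram_def)
  obtain t where t: "bilinear_map R V W T t" "\<And>i j. \<lbrakk>i \<in> I; j \<in> J\<rbrakk> \<Longrightarrow> t (b i) (d j) = e (i, j)"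
    "\<And>v v' w w'. \<lbrakk>v \<in> carrier V; v' \<in> carrier V; w \<in> carrier W; w' \<in> carrier W\<rbrakk> \<Longrightarrow>
      form T (t v w) (t v' w') = form V v v' \<otimes>\<^bsub>R\<^esub> form W w w'"
    by (rule tensor_product_of_bases[OF V.form_space W.form_space T(1) b(1) d(1) e(1)]) (use b d e in auto)
  obtain h where h: "dual_basis R V I b h" using V.ex_dual_basis[OF b(1)] .
  obtain k where k: "dual_basis R W J d k" using W.ex_dual_basis[OF d(1)] .
  have "dual_basis R T (I \<times> J) e (\<lambda>p. t (h (fst p)) (k (snd p)))"
    unfolding dual_basis_def
  proof (intro conjI ballI)
    show "(\<lambda>p. t (h (fst p)) (k (snd p))) \<in> I \<times> J \<rightarrow> carrier T"
      using h k bilinear_map_closed[OF t(1)] by (simp add: dual_basis_def Pi_iff)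
    fix p q assume pq: "p \<in> I \<times> J" "q \<in> I \<times> J"
    obtain i j i' j' where ij: "p = (i, j)" "q = (i', j')" "i \<in> I" "i' \<in> I" "j \<in> J" "j' \<in> J" using pq by auto
    have "form T (t (h i) (k j)) (t (b i') (d j')) = form V (h i) (b i') \<otimes>\<^bsub>R\<^esub> form W (k j) (d j')"
      using t(3) h k ij V.basisD(3)[OF b(1)] W.basisD(3)[OF d(1)] by (simp add: dual_basis_def Pi_iff)
    then show "form T (t (h (fst p)) (k (snd p))) (e q) = (if q = p then \<one>\<^bsub>R\<^esub> else \<zero>\<^bsub>R\<^esub>)"
      using h k ij t(2) by (simp add: dual_basis_def)
  qed
  then show ?thesis by (rule T.inner_product_spaceI[OF e(1)])
qed

subsection \<open>Finitely generated projective modules over a local ring are free\<close>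

context module
begin

lemma comb_in_lspan:
  assumes K: "ideal K R" and gs: "set gs \<subseteq> carrier M"
    and "finite I" "c \<in> I \<rightarrow> K" "\<And>i. i \<in> I \<Longrightarrow> b i \<in> set gs"
  shows "comb M I b c \<in> lspan K gs"
proof -
  interpret K: ideal K R by fact
  have KR: "K \<subseteq> carrier R" using K.Icarr by blast
  show ?thesis using assms(3-)
  proof (induction I rule: finite_induct)
    case empty
    show ?case using lspan_zero[OF K.zero_closed gs] by simp
  next
    case (insert i I)
    have p: "b \<in> insert i I \<rightarrow> carrier M" "c \<in> insert i I \<rightarrow> carrier R"
      using insert.prems gs KR by (auto simp: Pi_iff)
    have "c i \<odot>\<^bsub>M\<^esub> b i \<in> lspan K gs"
      using insert.prems KR lspan_base[OF K.zero_closed gs _ KR] by simp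
    moreover have "comb M I b c \<in> lspan K gs" using insert by simp
    ultimately show ?case unfolding comb_insert[OF insert(1,2) p] by (rule lspan_add[OF K gs])
  qed
qed

lemma spn_comb:
  assumes "set gs \<subseteq> carrier M" "x \<in> spn gs"
  shows "\<exists>c\<in>{..<length gs} \<rightarrow> carrier R. x = comb M {..<length gs} (nth gs) c"
  using assms
proof (induction gs arbitrary: x)
  case Nil
  then show ?case by simp
next
  case (Cons g gs)
  obtain a w where x: "x = a \<odot>\<^bsub>M\<^esub> g \<oplus>\<^bsub>M\<^esub> w" "a \<in> carrier R" "w \<in> spn gs" using Cons.prems by auto
  have gs: "set gs \<subseteq> carrier M" "g \<in> carrier M" using Cons.prems by auto
  obtain c where c: "c \<in> {..<length gs} \<rightarrow> carrier R" "w = comb M {..<length gs} (nth gs) c"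
    using Cons.IH[OF gs(1) x(3)] by blast
  let ?c = "case_nat a c" and ?n = "length gs"
  have set: "{..<Suc ?n} = insert 0 (Suc ` {..<?n})" by (rule lessThan_Suc_eq_insert_0)
  have p: "nth (g # gs) \<in> insert 0 (Suc ` {..<?n}) \<rightarrow> carrier M" "?c \<in> insert 0 (Suc ` {..<?n}) \<rightarrow> carrier R"
    using gs c x nth_mem[of _ gs] by (auto simp: Pi_iff)
  have "comb M (Suc ` {..<?n}) (nth (g # gs)) ?c = comb M {..<?n} (nth gs) c"
    using comb_reindex[of Suc "{..<?n}" "nth (g # gs)" ?c] p by (simp add: Pi_iff)
  then have "comb M {..<Suc ?n} (nth (g # gs)) ?c = x"
    unfolding set using comb_insert[OF _ _ p] x c by simp
  moreover have "?c \<in> {..<Suc ?n} \<rightarrow> carrier R" unfolding set by (rule p(2))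
  ultimately show ?case by (intro bexI[of _ ?c]) simp_all
qed

end

context local_module
begin

text \<open>A relation with a unit coefficient at \<open>i\<close> would express
  \<open>gs ! i\<close> by the other generators, which would then be a shorter generating
  family.\<close>

lemma nonunit_coeffs_of_minimal:
  assumes gs: "set gs \<subseteq> carrier M" "spn gs = carrier M"
    and min: "\<And>hs. \<lbrakk>set hs \<subseteq> carrier M; spn hs = carrier M\<rbrakk> \<Longrightarrow> length gs \<le> length hs"
    and c: "c \<in> {..<length gs} \<rightarrow> carrier R" "comb M {..<length gs} (nth gs) c = \<zero>\<^bsub>M\<^esub>" and i: "i < length gs"
  shows "c i \<in> \<mm>"
proof (rule ccontr)
  assume "c i \<notin> \<mm>"
  then have u: "c i \<in> Units R" using c i by (simp add: Units_iff Pi_iff)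
  let ?hs = "take i gs @ drop (Suc i) gs" and ?I = "{..<length gs} - {i}"
  have hs: "set ?hs \<subseteq> carrier M" using gs set_take_subset[of i gs] set_drop_subset[of "Suc i" gs] by auto
  have mem: "gs ! j \<in> set ?hs" if j: "j \<in> ?I" for j
  proof (cases "j < i")
    case True
    then have "take i gs ! j = gs ! j" "j < length (take i gs)" using i by simp_all
    then show ?thesis using nth_mem[of j "take i gs"] by simp
  next
    case False
    then have "drop (Suc i) gs ! (j - Suc i) = gs ! j" "j - Suc i < length (drop (Suc i) gs)"
      using j by auto
    then show ?thesis using nth_mem[of "j - Suc i" "drop (Suc i) gs"] by simp
  qed
  have p: "nth gs \<in> insert i ?I \<rightarrow> carrier M" "c \<in> insert i ?I \<rightarrow> carrier R"
    using gs(1) c(1) i by (simp_all add: Pi_iff subset_iff)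
  let ?w = "comb M ?I (nth gs) c"
  have w: "?w \<in> spn ?hs"
    by (rule comb_in_lspan[OF oneideal hs _ _ mem]) (use p in \<open>simp_all add: Pi_iff\<close>)
  then have wM: "?w \<in> carrier M" using spn_closed[OF hs] by blast
  have gi: "gs ! i \<in> carrier M" using gs nth_mem[OF i] by blast
  have cR: "c i \<in> carrier R" using u by auto
  have "c i \<odot>\<^bsub>M\<^esub> gs ! i \<oplus>\<^bsub>M\<^esub> ?w = comb M (insert i ?I) (nth gs) c"
    using comb_insert[OF _ _ p] by simp
  also have "\<dots> = \<zero>\<^bsub>M\<^esub>" using c i by (simp add: insert_absorb)
  finally have "c i \<odot>\<^bsub>M\<^esub> gs ! i = \<ominus>\<^bsub>M\<^esub> ?w" using cR gi wM M.minus_equality[of "c i \<odot>\<^bsub>M\<^esub> gs ! i" ?w] by simp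
  then have "c i \<odot>\<^bsub>M\<^esub> gs ! i = (\<ominus> \<one>) \<odot>\<^bsub>M\<^esub> ?w" using wM by (simp add: smult_l_minus)
  then have "c i \<odot>\<^bsub>M\<^esub> gs ! i \<in> spn ?hs" using spn_smult[OF hs w, of "\<ominus> \<one>"] by simp
  then have "inv (c i) \<odot>\<^bsub>M\<^esub> (c i \<odot>\<^bsub>M\<^esub> gs ! i) \<in> spn ?hs"
    by (rule spn_smult[OF hs _ Units_inv_closed[OF u]])
  then have "gs ! i \<in> spn ?hs" using smult_inv_cancel[OF u gi] by simp
  then have "gs ! j \<in> spn ?hs" if "j < length gs" for j
    using mem[of j] spn_base[OF hs, of "gs ! j"] that by (cases "j = i") simp_all
  then have "set gs \<subseteq> spn ?hs" by (metis in_set_conv_nth subsetI)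
  then have "spn ?hs = carrier M" using spn_least[OF _ hs] gs(2) spn_closed[OF hs] by blast
  from min[OF hs this] show False using i by simp
qed

end

text \<open>
  A minimal generating family gives a surjection from \<open>R\<^sup>n\<close> with kernel inside \<open>\<mm>R\<^sup>n\<close>. The kernel
  is a direct summand, hence finitely generated and equal to \<open>\<mm>\<close> times itself; it vanishes by Nakayama.
\<close>

theorem (in local_ring) projective_imp_free:
  fixes V :: "('a, nat \<Rightarrow> 'a, 'v) module_scheme"
  assumes V: "module R V" and fg: "finitely_generated R V" and proj: "projective_module R V"
  obtains n :: nat and b where "is_basis R V {..<n} b"
proof -
  interpret V: module R V by fact
  interpret V: local_module \<mm> R V ..
  have "\<exists>gs. set gs \<subseteq> carrier V \<and> V.spn gs = carrier V"
  proof -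
    obtain A where A: "finite A" "A \<subseteq> carrier V"
      "\<And>x. x \<in> carrier V \<Longrightarrow> \<exists>c\<in>A \<rightarrow> carrier R. x = (\<Oplus>\<^bsub>V\<^esub>a\<in>A. c a \<odot>\<^bsub>V\<^esub> a)"
      using fg unfolding finitely_generated_def by blast
    obtain gs where gs: "set gs = A" using finite_list[OF A(1)] by blast
    have "x \<in> V.spn gs" if x: "x \<in> carrier V" for x
    proof -
      obtain c where c: "c \<in> A \<rightarrow> carrier R" "x = comb V A (\<lambda>a. a) c" using A(3)[OF x] by (auto simp: comb_def)
      show ?thesis unfolding c(2) by (rule V.comb_in_lspan[OF oneideal _ A(1) c(1)]) (use gs A in auto)
    qed
    then show ?thesis using V.spn_closed[of gs] gs A by blast
  qed
  then obtain gs where gs: "set gs \<subseteq> carrier V" "V.spn gs = carrier V"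
    and min: "\<And>hs. \<lbrakk>set hs \<subseteq> carrier V; V.spn hs = carrier V\<rbrakk> \<Longrightarrow> length gs \<le> length hs"
    using ex_has_least_nat[of "\<lambda>gs. set gs \<subseteq> carrier V \<and> V.spn gs = carrier V" _ length] by metis
  define n where "n = length gs"
  let ?K = "coord_space R {..<n} undefined" and ?u = "unit_vec R {..<n}"
  \<comment> \<open>The concrete operations are hidden, so that \<open>?K\<close> is handled through
    the module laws only.\<close>
  note coord_space_simps [simp del]
  have mK: "module R ?K" by (rule module_coord_space)
  interpret K: module R ?K by (rule mK)
  interpret K: local_module \<mm> R ?K ..
  have u: "is_basis R ?K {..<n} ?u" by (rule unit_vec_basis) simp
  note uD = K.basisD[OF u]
  have gsP: "nth gs \<in> {..<n} \<rightarrow> carrier V" using gs nth_mem[of _ gs] by (auto simp: Pi_iff n_def)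
  obtain p where p: "p \<in> linear_maps R ?K V" "\<And>i. i < n \<Longrightarrow> p (?u i) = gs ! i"
    using K.linear_extend[OF u V gsP] by blast
  note pD = linear_mapsD[OF p(1)]
  have pcomb: "p (comb ?K {..<n} ?u c) = comb V {..<n} (nth gs) c" if c: "c \<in> {..<n} \<rightarrow> carrier R" for c
    using K.linear_comb[OF V p(1) uD(1,2) c] V.comb_cong[OF gsP c, of "\<lambda>i. p (?u i)" c] p(2) by simp
  have surj: "p ` carrier ?K = carrier V"
  proof
    show "carrier V \<subseteq> p ` carrier ?K"
    proof
      fix x assume "x \<in> carrier V"
      then obtain c where c: "c \<in> {..<n} \<rightarrow> carrier R" "x = comb V {..<n} (nth gs) c"
        using V.spn_comb[OF gs(1)] gs(2) by (auto simp: n_def)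
      show "x \<in> p ` carrier ?K"
        using pcomb[OF c(1)] c(2) K.comb_closed[OF uD(2) c(1)] by (metis image_eqI)
    qed
  qed (use pD(1) in blast)
  \<comment> \<open>The lifting property is applied to the surjection \<open>p\<close> and the
    identity of \<open>V\<close>, which gives a linear section \<open>h\<close> of
    \<open>p\<close>.\<close>
  let ?N = "module.truncate ?K" and ?V = "module.truncate V"
  have fs: "p \<in> linear_maps R ?N ?V" "(\<lambda>x. x) \<in> linear_maps R V ?V"
    and sj: "module R ?N \<and> module R ?V \<and> p ` carrier ?N = carrier ?V"
    using p(1) linear_maps_id surj module_truncate[OF mK] module_truncate[OF V] by simp_all
  from proj[unfolded projective_module_def, THEN spec, THEN spec, THEN bspec, OF fs(1), THEN bspec, OF fs(2), THEN mp, OF sj]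
  obtain h where "h \<in> linear_maps R V ?N" and ph: "\<And>x. x \<in> carrier V \<Longrightarrow> p (h x) = x" by blast
  then have h: "h \<in> linear_maps R V ?K" by simp
  note hD = linear_mapsD[OF h]
  \<comment> \<open>This is the identity minus \<open>h p\<close>, the projection of
    \<open>?K\<close> onto the kernel of \<open>p\<close>. The images \<open>?ks\<close> of the unit
    vectors therefore generate the kernel.\<close>
  define q where "q x = x \<oplus>\<^bsub>?K\<^esub> (\<ominus> \<one>) \<odot>\<^bsub>?K\<^esub> h (p x)" for x
  have hp: "h (p x) \<in> carrier ?K" if "x \<in> carrier ?K" for x using hD(1) pD(1) that by blast
  have q: "q \<in> linear_maps R ?K ?K"
  proof (rule linear_mapsI)
    fix x y assume xy: "x \<in> carrier ?K" "y \<in> carrier ?K"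
    show "q x \<in> carrier ?K" unfolding q_def using xy hp by (intro K.M.a_closed K.smult_closed) simp_all
    have "q (x \<oplus>\<^bsub>?K\<^esub> y) = (x \<oplus>\<^bsub>?K\<^esub> y) \<oplus>\<^bsub>?K\<^esub> ((\<ominus> \<one>) \<odot>\<^bsub>?K\<^esub> h (p x) \<oplus>\<^bsub>?K\<^esub> (\<ominus> \<one>) \<odot>\<^bsub>?K\<^esub> h (p y))"
      unfolding q_def using xy hp pD hD K.smult_r_distr[OF _ hp hp, of "\<ominus> \<one>" x y] by simp
    also have "\<dots> = q x \<oplus>\<^bsub>?K\<^esub> q y"
      unfolding q_def using xy hp by (simp add: K.M.a_ac)
    finally show "q (x \<oplus>\<^bsub>?K\<^esub> y) = q x \<oplus>\<^bsub>?K\<^esub> q y" .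
  next
    fix a x assume ax: "a \<in> carrier R" "x \<in> carrier ?K"
    have "(\<ominus> \<one>) \<odot>\<^bsub>?K\<^esub> (a \<odot>\<^bsub>?K\<^esub> h (p x)) = a \<odot>\<^bsub>?K\<^esub> ((\<ominus> \<one>) \<odot>\<^bsub>?K\<^esub> h (p x))"
      using ax hp[OF ax(2)] K.smult_assoc1[of "\<ominus> \<one>" a] K.smult_assoc1[of a "\<ominus> \<one>"] m_comm[of a "\<ominus> \<one>"]
      by simp
    then show "q (a \<odot>\<^bsub>?K\<^esub> x) = a \<odot>\<^bsub>?K\<^esub> q x"
      unfolding q_def using ax hp pD hD by (simp add: K.smult_r_distr)
  qed
  have q_ker: "q x = x" if "x \<in> carrier ?K" "p x = \<zero>\<^bsub>V\<^esub>" for x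
  proof -
    have "h \<zero>\<^bsub>V\<^esub> = \<zero>\<^bsub>?K\<^esub>"
      using hD(3)[of \<zero> "\<zero>\<^bsub>V\<^esub>"] hD(1)[of "\<zero>\<^bsub>V\<^esub>"] by simp
    then show ?thesis unfolding q_def using that by simp
  qed
  have pq: "p (q x) = \<zero>\<^bsub>V\<^esub>" if "x \<in> carrier ?K" for x
    unfolding q_def using that hp pD ph by (simp add: V.smult_l_minus V.M.r_neg)
  let ?ks = "map (\<lambda>i. q (?u i)) [0..<n]"
  have qu: "q (?u i) \<in> carrier ?K" if "i < n" for i
    using linear_mapsD(1)[OF q uD(3)] that by simp
  have ksK: "set ?ks \<subseteq> carrier ?K" using qu by auto
  \<comment> \<open>On the kernel \<open>q\<close> is the identity, so the coordinates of
    \<open>x\<close> are also coefficients over \<open>?ks\<close>; by minimality of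
    \<open>gs\<close> they lie in \<open>\<mm>\<close>.\<close>
  have ker: "x \<in> K.lspan \<mm> ?ks" if x: "x \<in> carrier ?K" "p x = \<zero>\<^bsub>V\<^esub>" for x
  proof -
    let ?c = "coord R ?K {..<n} ?u x"
    have c: "?c \<in> {..<n} \<rightarrow> carrier R" by (rule K.coord_Pi[OF u x(1)])
    have cx: "comb ?K {..<n} ?u ?c = x" by (rule K.comb_coord[OF u x(1)])
    have "comb V {..<n} (nth gs) ?c = \<zero>\<^bsub>V\<^esub>" using pcomb[OF c] cx x(2) by simp
    then have cm: "?c \<in> {..<n} \<rightarrow> \<mm>"
      using V.nonunit_coeffs_of_minimal[OF gs min, of ?c] c by (simp add: n_def Pi_iff)
    have "x = q (comb ?K {..<n} ?u ?c)" using q_ker[OF x] cx by simp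
    also have "\<dots> = comb ?K {..<n} (\<lambda>i. q (?u i)) ?c" by (rule K.linear_comb[OF mK q uD(1,2) c])
    also have "\<dots> \<in> K.lspan \<mm> ?ks"
      by (rule K.comb_in_lspan[OF ideal_axioms ksK _ cm]) auto
    finally show ?thesis .
  qed
  have "set ?ks \<subseteq> K.lspan \<mm> ?ks" using ker[OF qu pq] uD(3) by auto
  from K.Nakayama[OF ksK this] have ks0: "set ?ks \<subseteq> {\<zero>\<^bsub>?K\<^esub>}" .
  have inj: "x = \<zero>\<^bsub>?K\<^esub>" if x: "x \<in> carrier ?K" "p x = \<zero>\<^bsub>V\<^esub>" for x
  proof -
    have "K.lspan \<mm> ks \<subseteq> {\<zero>\<^bsub>?K\<^esub>}" if "set ks \<subseteq> {\<zero>\<^bsub>?K\<^esub>}" for ks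
      using that by (induction ks) (auto simp: Icarr)
    then show ?thesis using ker[OF x] ks0 by blast
  qed
  have "is_basis R V {..<n} (nth gs)"
  proof (rule V.is_basisI[OF _ gsP])
    show "\<exists>c\<in>{..<n} \<rightarrow> carrier R. x = comb V {..<n} (nth gs) c" if "x \<in> carrier V" for x
      using V.spn_comb[OF gs(1)] gs(2) that by (simp add: n_def)
    show "\<forall>i\<in>{..<n}. c i = \<zero>" if c: "c \<in> {..<n} \<rightarrow> carrier R" "comb V {..<n} (nth gs) c = \<zero>\<^bsub>V\<^esub>" for c
      using inj[OF K.comb_closed[OF uD(2) c(1)]] pcomb[OF c(1)] c(2) K.basis_indep[OF u c(1)] by simp
  qed simp
  then show ?thesis by (rule that)
qed

subsection \<open>The Grothendieck ring of a commutative semiring\<close>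

locale comm_semiring = semiring S + comm_monoid S for S (structure)
begin

abbreviation fd :: "'a \<Rightarrow> 'a \<Rightarrow> ('a \<times> 'a) set" where "fd \<equiv> formal_difference S"

lemma equiv_grothendieck_rel: "equiv (carrier S \<times> carrier S) (grothendieck_rel S)"
proof (rule equivI)
  show "grothendieck_rel S \<subseteq> (carrier S \<times> carrier S) \<times> carrier S \<times> carrier S"
    by (auto simp: grothendieck_rel_def)
  show "refl_on (carrier S \<times> carrier S) (grothendieck_rel S)"
    by (auto simp: refl_on_def grothendieck_rel_def intro!: bexI[of _ \<zero>])
  show "sym (grothendieck_rel S)"
    unfolding sym_def grothendieck_rel_def by (auto dest: sym)
  show "trans (grothendieck_rel S)"
  proof (rule transI)
    fix p q r assume pq: "(p, q) \<in> grothendieck_rel S" and qr: "(q, r) \<in> grothendieck_rel S"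
    obtain a b c d e f where [simp]: "p = (a, b)" "q = (c, d)" "r = (e, f)" by (metis surj_pair)
    obtain k l where s [simp]: "a \<in> carrier S" "b \<in> carrier S" "c \<in> carrier S" "d \<in> carrier S" "e \<in> carrier S" "f \<in> carrier S"
      "k \<in> carrier S" "l \<in> carrier S" and k: "a \<oplus> d \<oplus> k = c \<oplus> b \<oplus> k" and l: "c \<oplus> f \<oplus> l = e \<oplus> d \<oplus> l"
      using pq qr by (auto simp: grothendieck_rel_def)
    \<comment> \<open>\<open>S\<close> need not be cancellative, so the middle term \<open>d\<close>
      is carried into the new witness along with \<open>k\<close> and \<open>l\<close>.\<close>
    have "a \<oplus> f \<oplus> (d \<oplus> k \<oplus> l) = (a \<oplus> d \<oplus> k) \<oplus> (f \<oplus> l)" by (simp add: a_ac)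
    also have "\<dots> = (c \<oplus> f \<oplus> l) \<oplus> (b \<oplus> k)" unfolding k by (simp add: a_ac)
    also have "\<dots> = e \<oplus> b \<oplus> (d \<oplus> k \<oplus> l)" unfolding l by (simp add: a_ac)
    finally have "\<exists>m\<in>carrier S. a \<oplus> f \<oplus> m = e \<oplus> b \<oplus> m" by (intro bexI[of _ "d \<oplus> k \<oplus> l"]) simp_all
    then show "(p, r) \<in> grothendieck_rel S" by (simp add: grothendieck_rel_def)
  qed
qed

lemma mem_fd: "\<lbrakk>a \<in> carrier S; b \<in> carrier S\<rbrakk> \<Longrightarrow> (c, d) \<in> fd a b \<longleftrightarrow>
    c \<in> carrier S \<and> d \<in> carrier S \<and> (\<exists>k\<in>carrier S. a \<oplus> d \<oplus> k = c \<oplus> b \<oplus> k)"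
  by (auto simp: formal_difference_def grothendieck_rel_def)

lemma fd_eq_iff:
  assumes "a \<in> carrier S" "b \<in> carrier S" "c \<in> carrier S" "d \<in> carrier S"
  shows "fd a b = fd c d \<longleftrightarrow> (\<exists>k\<in>carrier S. a \<oplus> d \<oplus> k = c \<oplus> b \<oplus> k)"
  using eq_equiv_class_iff[OF equiv_grothendieck_rel, of "(a, b)" "(c, d)"] assms
  by (simp add: formal_difference_def grothendieck_rel_def)

lemma fd_eqI:
  assumes "a \<in> carrier S" "b \<in> carrier S" "c \<in> carrier S" "d \<in> carrier S" "a \<oplus> d = c \<oplus> b"
  shows "fd a b = fd c d"
  unfolding fd_eq_iff[OF assms(1-4)] using assms(5) by (intro bexI[of _ \<zero>]) simp_all

lemma carrier_grothendieck: "carrier (grothendieck_ring S) = {fd a b | a b. a \<in> carrier S \<and> b \<in> carrier S}"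
  by (auto simp: grothendieck_ring_def quotient_def formal_difference_def)

lemma fd_closed: "\<lbrakk>a \<in> carrier S; b \<in> carrier S\<rbrakk> \<Longrightarrow> fd a b \<in> carrier (grothendieck_ring S)"
  by (auto simp: carrier_grothendieck)

lemma fd_cases:
  assumes "x \<in> carrier (grothendieck_ring S)"
  obtains a b where "a \<in> carrier S" "b \<in> carrier S" "x = fd a b"
  using assms by (auto simp: carrier_grothendieck)

lemma UN_fd:
  assumes "a \<in> carrier S" "b \<in> carrier S" "c \<in> carrier S" "d \<in> carrier S"
    and "\<And>x y z w. \<lbrakk>(x, y) \<in> fd a b; (z, w) \<in> fd c d\<rbrakk> \<Longrightarrow> F x y z w = F a b c d"
  shows "(\<Union>(x, y)\<in>fd a b. \<Union>(z, w)\<in>fd c d. F x y z w) = F a b c d"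
proof -
  have m: "(a, b) \<in> fd a b" "(c, d) \<in> fd c d" using assms(1-4) by (auto simp: mem_fd intro!: bexI[of _ \<zero>])
  have "(\<Union>(z, w)\<in>fd c d. F x y z w) = F a b c d" if "(x, y) \<in> fd a b" for x y
    by (rule UN_constant_eq[OF m(2)]) (use assms(5)[OF that] in \<open>simp add: split_beta\<close>)
  then show ?thesis by (intro UN_constant_eq[OF m(1)]) (simp add: split_beta)
qed

lemma add_fd:
  assumes c: "a \<in> carrier S" "b \<in> carrier S" "c \<in> carrier S" "d \<in> carrier S"
  shows "fd a b \<oplus>\<^bsub>grothendieck_ring S\<^esub> fd c d = fd (a \<oplus> c) (b \<oplus> d)"
proof -
  have "fd (x \<oplus> z) (y \<oplus> w) = fd (a \<oplus> c) (b \<oplus> d)" if xy: "(x, y) \<in> fd a b" and zw: "(z, w) \<in> fd c d" for x y z w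
  proof -
    obtain k l where s [simp]: "x \<in> carrier S" "y \<in> carrier S" "z \<in> carrier S" "w \<in> carrier S" "k \<in> carrier S" "l \<in> carrier S"
      and k: "a \<oplus> y \<oplus> k = x \<oplus> b \<oplus> k" and l: "c \<oplus> w \<oplus> l = z \<oplus> d \<oplus> l"
      using xy zw by (auto simp: mem_fd c)
    note c [simp]
    have "(x \<oplus> z) \<oplus> (b \<oplus> d) \<oplus> (k \<oplus> l) = (x \<oplus> b \<oplus> k) \<oplus> (z \<oplus> d \<oplus> l)" by (simp add: a_ac)
    also have "\<dots> = (a \<oplus> y \<oplus> k) \<oplus> (c \<oplus> w \<oplus> l)" unfolding k l ..
    also have "\<dots> = (a \<oplus> c) \<oplus> (y \<oplus> w) \<oplus> (k \<oplus> l)" by (simp add: a_ac)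
    finally show ?thesis by (subst fd_eq_iff) (auto intro!: bexI[of _ "k \<oplus> l"])
  qed
  then show ?thesis
    using UN_fd[OF c, of "\<lambda>x y z w. fd (x \<oplus> z) (y \<oplus> w)"] by (simp add: grothendieck_ring_def)
qed

lemma mult_fd:
  assumes c: "a \<in> carrier S" "b \<in> carrier S" "c \<in> carrier S" "d \<in> carrier S"
  shows "fd a b \<otimes>\<^bsub>grothendieck_ring S\<^esub> fd c d = fd (a \<otimes> c \<oplus> b \<otimes> d) (a \<otimes> d \<oplus> b \<otimes> c)"
proof -
  let ?F = "\<lambda>x y z w. fd (x \<otimes> z \<oplus> y \<otimes> w) (x \<otimes> w \<oplus> y \<otimes> z)"
  \<comment> \<open>Independence of the representative is checked in the first factor only;
    \<open>swap\<close> carries it over to the second.\<close>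
  have one: "?F x y z w = ?F a b z w"
    if xy: "(x, y) \<in> fd a b" and s1 [simp]: "a \<in> carrier S" "b \<in> carrier S" "z \<in> carrier S" "w \<in> carrier S" for a b x y z w
  proof -
    obtain k where s [simp]: "x \<in> carrier S" "y \<in> carrier S" "k \<in> carrier S"
      and k: "a \<oplus> y \<oplus> k = x \<oplus> b \<oplus> k"
      using xy mem_fd[OF s1(1,2), of x y] by blast
    have "(x \<otimes> z \<oplus> y \<otimes> w) \<oplus> (a \<otimes> w \<oplus> b \<otimes> z) \<oplus> (k \<otimes> z \<oplus> k \<otimes> w) = (x \<oplus> b \<oplus> k) \<otimes> z \<oplus> (a \<oplus> y \<oplus> k) \<otimes> w"
      by (simp add: l_distr a_ac)
    also have "\<dots> = (a \<oplus> y \<oplus> k) \<otimes> z \<oplus> (x \<oplus> b \<oplus> k) \<otimes> w" unfolding k ..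
    also have "\<dots> = (a \<otimes> z \<oplus> b \<otimes> w) \<oplus> (x \<otimes> w \<oplus> y \<otimes> z) \<oplus> (k \<otimes> z \<oplus> k \<otimes> w)"
      by (simp add: l_distr a_ac)
    finally show ?thesis by (subst fd_eq_iff) (auto intro!: bexI[of _ "k \<otimes> z \<oplus> k \<otimes> w"])
  qed
  have swap: "?F x y z w = ?F z w x y" if "x \<in> carrier S" "y \<in> carrier S" "z \<in> carrier S" "w \<in> carrier S" for x y z w
    using that by (simp add: m_comm a_comm)
  have "?F x y z w = ?F a b c d" if xy: "(x, y) \<in> fd a b" and zw: "(z, w) \<in> fd c d" for x y z w
  proof -
    have s: "x \<in> carrier S" "y \<in> carrier S" "z \<in> carrier S" "w \<in> carrier S" using xy zw by (auto simp: mem_fd c)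
    have "?F x y z w = ?F a b z w" by (rule one[OF xy c(1,2) s(3,4)])
    also have "\<dots> = ?F z w a b" by (rule swap[OF c(1,2) s(3,4)])
    also have "\<dots> = ?F c d a b" by (rule one[OF zw c(3,4,1,2)])
    also have "\<dots> = ?F a b c d" by (rule swap[OF c(3,4,1,2)])
    finally show ?thesis .
  qed
  then show ?thesis
    using UN_fd[OF c, of ?F] by (simp add: grothendieck_ring_def)
qed

lemma grothendieck_consts:
  "\<zero>\<^bsub>grothendieck_ring S\<^esub> = fd \<zero> \<zero>" "\<one>\<^bsub>grothendieck_ring S\<^esub> = fd \<one> \<zero>"
  by (simp_all add: grothendieck_ring_def)

theorem cring_grothendieck_ring: "cring (grothendieck_ring S)"
proof (rule cringI)
  let ?G = "grothendieck_ring S"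
  note [simp] = add_fd mult_fd fd_closed grothendieck_consts
  show "abelian_group ?G"
  proof (rule abelian_groupI)
    fix x y assume x: "x \<in> carrier ?G" and y: "y \<in> carrier ?G"
    obtain a b where ab: "a \<in> carrier S" "b \<in> carrier S" "x = fd a b" using fd_cases[OF x] .
    obtain c d where cd: "c \<in> carrier S" "d \<in> carrier S" "y = fd c d" using fd_cases[OF y] .
    show "x \<oplus>\<^bsub>?G\<^esub> y \<in> carrier ?G" using ab cd by simp
    show "x \<oplus>\<^bsub>?G\<^esub> y = y \<oplus>\<^bsub>?G\<^esub> x" using ab cd by (simp add: a_comm)
    have "fd (b \<oplus> a) (a \<oplus> b) = fd \<zero> \<zero>"
      by (rule fd_eqI) (use ab in \<open>simp_all add: a_comm\<close>)
    then show "\<exists>y\<in>carrier ?G. y \<oplus>\<^bsub>?G\<^esub> x = \<zero>\<^bsub>?G\<^esub>"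
      using ab by (intro bexI[of _ "fd b a"]) simp_all
    show "\<zero>\<^bsub>?G\<^esub> \<oplus>\<^bsub>?G\<^esub> x = x" using ab by simp
    fix z assume z: "z \<in> carrier ?G"
    obtain e f where ef: "e \<in> carrier S" "f \<in> carrier S" "z = fd e f" using fd_cases[OF z] .
    show "x \<oplus>\<^bsub>?G\<^esub> y \<oplus>\<^bsub>?G\<^esub> z = x \<oplus>\<^bsub>?G\<^esub> (y \<oplus>\<^bsub>?G\<^esub> z)" using ab cd ef by (simp add: a_assoc)
  qed simp
  show "comm_monoid ?G"
  proof (rule comm_monoidI)
    fix x y assume x: "x \<in> carrier ?G" and y: "y \<in> carrier ?G"
    obtain a b where ab: "a \<in> carrier S" "b \<in> carrier S" "x = fd a b" using fd_cases[OF x] .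
    obtain c d where cd: "c \<in> carrier S" "d \<in> carrier S" "y = fd c d" using fd_cases[OF y] .
    show "x \<otimes>\<^bsub>?G\<^esub> y \<in> carrier ?G" using ab cd by simp
    show "x \<otimes>\<^bsub>?G\<^esub> y = y \<otimes>\<^bsub>?G\<^esub> x"
      using ab cd by (simp add: m_comm a_comm)
    show "\<one>\<^bsub>?G\<^esub> \<otimes>\<^bsub>?G\<^esub> x = x" using ab by simp
    fix z assume z: "z \<in> carrier ?G"
    obtain e f where ef: "e \<in> carrier S" "f \<in> carrier S" "z = fd e f" using fd_cases[OF z] .
    show "x \<otimes>\<^bsub>?G\<^esub> y \<otimes>\<^bsub>?G\<^esub> z = x \<otimes>\<^bsub>?G\<^esub> (y \<otimes>\<^bsub>?G\<^esub> z)"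
      using ab cd ef by (simp add: l_distr r_distr m_assoc a_ac)
  qed simp
  fix x y z assume x: "x \<in> carrier ?G" and y: "y \<in> carrier ?G" and z: "z \<in> carrier ?G"
  obtain a b where ab: "a \<in> carrier S" "b \<in> carrier S" "x = fd a b" using fd_cases[OF x] .
  obtain c d where cd: "c \<in> carrier S" "d \<in> carrier S" "y = fd c d" using fd_cases[OF y] .
  obtain e f where ef: "e \<in> carrier S" "f \<in> carrier S" "z = fd e f" using fd_cases[OF z] .
  show "(x \<oplus>\<^bsub>?G\<^esub> y) \<otimes>\<^bsub>?G\<^esub> z = x \<otimes>\<^bsub>?G\<^esub> z \<oplus>\<^bsub>?G\<^esub> y \<otimes>\<^bsub>?G\<^esub> z"
    using ab cd ef by (simp add: l_distr a_ac)
qed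

end

subsection \<open>The semiring of isometry classes\<close>

text \<open>The isometry class of a space, named by a Gram matrix. It is empty when no inner product
  space has this matrix, hence the non-emptiness hypotheses below.\<close>

definition gram_class :: "('a, 'r) ring_scheme \<Rightarrow> 'i set \<Rightarrow> ('i \<Rightarrow> 'i \<Rightarrow> 'a) \<Rightarrow> ('a, nat \<Rightarrow> 'a) form_module set" where
  "gram_class R I G = {U. inner_product_space R U \<and> has_gram R U I G}"

abbreviation gsum :: "('a, 'r) ring_scheme \<Rightarrow> ('i \<Rightarrow> 'i \<Rightarrow> 'a) \<Rightarrow> ('j \<Rightarrow> 'j \<Rightarrow> 'a) \<Rightarrow> 'i + 'j \<Rightarrow> 'i + 'j \<Rightarrow> 'a" where
  "gsum R G H \<equiv> \<lambda>k l. case (k, l) of (Inl i, Inl i') \<Rightarrow> G i i' | (Inr j, Inr j') \<Rightarrow> H j j' | _ \<Rightarrow> \<zero>\<^bsub>R\<^esub>"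

lemma gram_closed:
  assumes "form_space R V" "has_gram R V I G" "i \<in> I" "j \<in> I"
  shows "G i j \<in> carrier R" "G i j = G j i"
proof -
  interpret form_space R V by fact
  obtain b where b: "is_basis R V I b" "\<forall>i\<in>I. \<forall>j\<in>I. form V (b i) (b j) = G i j"
    using assms(2) by (auto simp: has_gram_def)
  note c = basisD(3)[OF b(1) assms(3)] basisD(3)[OF b(1) assms(4)]
  have e: "form V (b i) (b j) = G i j" "form V (b j) (b i) = G j i" using b(2) assms(3,4) by simp_all
  show "G i j \<in> carrier R" using form_closed[OF c] by (simp add: e)
  show "G i j = G j i" using symmetric[OF c] by (simp add: e)
qed

lemma gram_classD:
  assumes "U \<in> gram_class R I G"
  shows "inner_product_space R U" "form_space R U" "module R U" "has_gram R U I G"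
proof -
  show "inner_product_space R U" "has_gram R U I G" using assms by (simp_all add: gram_class_def)
  then show "form_space R U" "module R U"
    by (simp_all add: inner_product_space.form_space inner_product_space.axioms(1))
qed

lemma gram_class_closed:
  assumes "gram_class R I G \<noteq> {}" "i \<in> I" "j \<in> I"
  shows "G i j \<in> carrier R" "G i j = G j i"
proof -
  obtain U where "U \<in> gram_class R I G" using assms(1) by blast
  note U = gram_classD[OF this]
  show "G i j \<in> carrier R" "G i j = G j i" by (fact gram_closed[OF U(2,4) assms(2,3)])+
qed

lemma isometry_class_eq_gram_class:
  assumes V: "inner_product_space R V" "has_gram R V I G"
  shows "isometry_class R V = gram_class R I G"
proof -
  interpret V: inner_product_space R V by fact
  have "isometric R V U \<longleftrightarrow> has_gram R U I G" if U: "inner_product_space R U" for U :: "('a, nat \<Rightarrow> 'a) form_module"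
  proof -
    interpret U: inner_product_space R U by fact
    show ?thesis
      using has_gram_isometric[OF V.module_axioms U.module_axioms V(2)]
        isometric_of_gram[OF V.form_space U.form_space V(2)] by blast
  qed
  then show ?thesis unfolding isometry_class_def gram_class_def by blast
qed

lemma gram_class_nonempty:
  assumes "inner_product_space R V" "has_gram R V I G"
  shows "gram_class R I G \<noteq> {}"
proof -
  interpret V: inner_product_space R V by fact
  note c = gram_closed[OF V.form_space assms(2)]
  obtain U :: "('a, nat \<Rightarrow> 'a) form_module" where U: "form_space R U" "has_gram R U I G"
    by (rule ex_nat_form_space[OF V.is_cring has_gram_finite[OF assms(2)] c])
  have iso: "isometric R V U" by (rule isometric_of_gram[OF V.form_space U(1) assms(2) U(2)])
  obtain b where "is_basis R V I b" using assms(2) by (auto simp: has_gram_def)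
  from inner_product_space_isometric[OF assms(1) U(1) this iso] show ?thesis
    using U(2) unfolding gram_class_def by blast
qed

lemma gram_class_reindex:
  fixes R :: "('a, 'r) ring_scheme"
  assumes \<pi>: "bij_betw \<pi> J I" and G: "\<And>i j. \<lbrakk>i \<in> J; j \<in> J\<rbrakk> \<Longrightarrow> G' i j = G (\<pi> i) (\<pi> j)"
  shows "gram_class R J G' = gram_class R I G"
proof -
  let ?g = "inv_into J \<pi>"
  have g: "?g i \<in> J" "\<pi> (?g i) = i" if "i \<in> I" for i
    using \<pi> that inv_into_into[of i \<pi> J] f_inv_into_f[of i \<pi> J] by (simp_all add: bij_betw_def)
  have "has_gram R U J G' \<longleftrightarrow> has_gram R U I G" if "module R U" for U :: "('a, nat \<Rightarrow> 'a) form_module"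
  proof
    assume h: "has_gram R U I G" show "has_gram R U J G'"
      by (rule has_gram_reindex[where I = I and G = G and \<pi> = \<pi>, OF that h \<pi>]) (rule G)
  next
    assume h: "has_gram R U J G'" show "has_gram R U I G"
      by (rule has_gram_reindex[where I = J and G = G' and \<pi> = ?g, OF that h bij_betw_inv_into[OF \<pi>]])
        (simp add: G g)
  qed
  then show ?thesis
    unfolding gram_class_def using inner_product_space.axioms(1)[of R] by blast
qed

context local_ring
begin

abbreviation "S \<equiv> isometry_semiring R"

lemma ex_gram:
  fixes V :: "('a, nat \<Rightarrow> 'a) form_module"
  assumes "inner_product_space R V"
  obtains n :: nat and G where "has_gram R V {..<n} G"
proof -
  interpret V: inner_product_space R V by fact
  obtain n :: nat and b where "is_basis R V {..<n} b"
    using projective_imp_free[OF V.module_axioms V.finitely_generated V.projective] .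
  then have "has_gram R V {..<n} (\<lambda>i j. form V (b i) (b j))" by (auto simp: has_gram_def)
  then show ?thesis by (rule that)
qed

lemma gram_class_in_S:
  assumes "gram_class R I G \<noteq> {}" shows "gram_class R I G \<in> carrier S"
proof -
  obtain U where "U \<in> gram_class R I G" using assms by blast
  note U = gram_classD(1,4)[OF this]
  show ?thesis unfolding isometry_class_eq_gram_class[OF U, symmetric]
    using U(1) by (auto simp: isometry_semiring_def)
qed

lemma S_cases:
  assumes "A \<in> carrier S"
  obtains n :: nat and G where "A = gram_class R {..<n} G" "gram_class R {..<n} G \<noteq> {}"
proof -
  obtain V :: "('a, nat \<Rightarrow> 'a) form_module" where V: "inner_product_space R V" "A = isometry_class R V"
    using assms by (auto simp: isometry_semiring_def)
  obtain n :: nat and G where G: "has_gram R V {..<n} G" using ex_gram[OF V(1)] .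
  show ?thesis using that[of n G] isometry_class_eq_gram_class[OF V(1) G] gram_class_nonempty[OF V(1) G] V(2) by simp
qed

text \<open>Addition in \<open>isometry_semiring\<close> is a union over all representatives. It
  collapses because the Gram matrix of the sum, and with it the class, is the same for all of
  them.\<close>

lemma gram_class_add:
  assumes "gram_class R I G \<noteq> {}" "gram_class R J H \<noteq> {}"
  shows "gram_class R I G \<oplus>\<^bsub>S\<^esub> gram_class R J H = gram_class R (I <+> J) (gsum R G H)"
    and "gram_class R (I <+> J) (gsum R G H) \<noteq> {}"
proof -
  have o: "inner_product_space R (orthogonal_sum R V W)"
    "has_gram R (orthogonal_sum R V W) (I <+> J) (gsum R G H)"
    if "V \<in> gram_class R I G" "W \<in> gram_class R J H" for V W
  proof -
    note V = gram_classD[OF that(1)] and W = gram_classD[OF that(2)]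
    show "has_gram R (orthogonal_sum R V W) (I <+> J) (gsum R G H)"
      by (rule has_gram_orthogonal_sum[OF V(2,4) W(2,4)])
    obtain b d where "is_basis R V I b" "is_basis R W J d" using V(4) W(4) by (auto simp: has_gram_def)
    from inner_product_space_orthogonal_sum[OF V(1) this(1) W(1) this(2)]
    show "inner_product_space R (orthogonal_sum R V W)" .
  qed
  obtain V W where VW: "V \<in> gram_class R I G" "W \<in> gram_class R J H" using assms by blast
  show "gram_class R (I <+> J) (gsum R G H) \<noteq> {}" by (rule gram_class_nonempty[OF o[OF VW]])
  have "(\<Union>W\<in>gram_class R J H. isometry_class R (orthogonal_sum R V W)) = gram_class R (I <+> J) (gsum R G H)"
    if "V \<in> gram_class R I G" for V
    by (rule UN_constant_eq[OF VW(2)], rule ballI, rule isometry_class_eq_gram_class[OF o[OF that]])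
  then show "gram_class R I G \<oplus>\<^bsub>S\<^esub> gram_class R J H = gram_class R (I <+> J) (gsum R G H)"
    unfolding isometry_semiring_def ring_record_simps by (intro UN_constant_eq[OF VW(1)] ballI)
qed

text \<open>The product collects all tensor products of representatives. The universal property
  forces the Kronecker matrix on each of them, and conversely a form space with that matrix is a
  tensor product.\<close>

lemma gram_class_mult:
  assumes "gram_class R I G \<noteq> {}" "gram_class R J H \<noteq> {}"
  shows "gram_class R I G \<otimes>\<^bsub>S\<^esub> gram_class R J H = gram_class R (I \<times> J) (kron R G H)"
    and "gram_class R (I \<times> J) (kron R G H) \<noteq> {}"
proof -
  obtain V W where VW: "V \<in> gram_class R I G" "W \<in> gram_class R J H" using assms by blast
  note V = gram_classD[OF VW(1)] and W = gram_classD[OF VW(2)]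
  show "gram_class R I G \<otimes>\<^bsub>S\<^esub> gram_class R J H = gram_class R (I \<times> J) (kron R G H)"
  proof (rule Set.set_eqI)
    fix T :: "('a, nat \<Rightarrow> 'a) form_module"
    have "(\<exists>V\<in>gram_class R I G. \<exists>W\<in>gram_class R J H. tensor_product R V W T) \<longleftrightarrow> has_gram R T (I \<times> J) (kron R G H)"
      if T: "form_space R T"
    proof
      assume "\<exists>V\<in>gram_class R I G. \<exists>W\<in>gram_class R J H. tensor_product R V W T"
      then obtain V' W' where t: "V' \<in> gram_class R I G" "W' \<in> gram_class R J H" "tensor_product R V' W' T" by blast
      show "has_gram R T (I \<times> J) (kron R G H)"
        by (rule gram_of_tensor_product[OF gram_classD(2,4)[OF t(1)] gram_classD(2,4)[OF t(2)] T t(3)])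
    next
      assume "has_gram R T (I \<times> J) (kron R G H)"
      from tensor_product_of_gram[OF V(2,4) W(2,4) T this]
      show "\<exists>V\<in>gram_class R I G. \<exists>W\<in>gram_class R J H. tensor_product R V W T" using VW by blast
    qed
    then show "T \<in> gram_class R I G \<otimes>\<^bsub>S\<^esub> gram_class R J H \<longleftrightarrow> T \<in> gram_class R (I \<times> J) (kron R G H)"
      using inner_product_space.form_space by (auto simp: isometry_semiring_def gram_class_def[of R "I \<times> J"])
  qed
  have fin: "finite (I \<times> J)" using has_gram_finite[OF V(4)] has_gram_finite[OF W(4)] by simp
  have kc: "kron R G H p q \<in> carrier R" "kron R G H p q = kron R G H q p" if "p \<in> I \<times> J" "q \<in> I \<times> J" for p q
    using gram_closed[OF V(2,4), of "fst p" "fst q"] gram_closed[OF W(2,4), of "snd p" "snd q"] that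
    by (simp_all add: mem_Times_iff)
  obtain T :: "('a, nat \<Rightarrow> 'a) form_module" where T: "form_space R T" "has_gram R T (I \<times> J) (kron R G H)"
    by (rule ex_nat_form_space[OF is_cring fin kc])
  show "gram_class R (I \<times> J) (kron R G H) \<noteq> {}"
    using gram_class_nonempty[OF inner_product_space_tensor[OF V(1,4) W(1,4) T] T(2)] .
qed

lemma rank_one_space_gram:
  assumes a: "a \<in> Units R"
  shows "inner_product_space R (rank_one_space R a)" "has_gram R (rank_one_space R a) {()} (\<lambda>_ _. a)"
proof -
  let ?V = "rank_one_space R a"
  have aR: "a \<in> carrier R" using a by auto
  have V [simp]: "carrier ?V = carrier R" "ring.zero ?V = \<zero>" "add ?V = add R" "smult ?V = monoid.mult R"
    "form ?V = (\<lambda>x y. a \<otimes> x \<otimes> y)"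
    by (simp_all add: rank_one_space_def)
  have m: "module R ?V"
  proof (rule moduleI)
    show "abelian_group ?V" by (rule abelian_group_record_cong[OF abelian_group_axioms]) simp_all
  qed (simp_all add: is_cring l_distr r_distr m_assoc)
  then interpret V: module R ?V .
  have "bilinear_map R ?V ?V (self_module R) (form ?V)"
    using aR by (intro bilinear_mapI) (simp_all add: l_distr r_distr m_ac)
  then have f: "form_space R ?V"
    using aR by (intro form_space.intro form_space_axioms.intro m) (simp_all add: m_ac)
  then interpret V: form_space R ?V .
  have b: "is_basis R ?V {()} (\<lambda>_. \<one>)"
  proof (rule V.is_basisI)
    have c: "comb ?V {()} (\<lambda>_. \<one>) c = c ()" if "c \<in> {()} \<rightarrow> carrier R" for c
      using V.comb_insert[of "{}" "()" "\<lambda>_. \<one>" c] that by simp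
    show "\<exists>c\<in>{()} \<rightarrow> carrier R. x = comb ?V {()} (\<lambda>_. \<one>) c" if "x \<in> carrier ?V" for x
      using c[of "\<lambda>_. x"] that by (intro bexI[of _ "\<lambda>_. x"]) simp_all
    show "\<forall>i\<in>{()}. d i = \<zero>" if "d \<in> {()} \<rightarrow> carrier R" "comb ?V {()} (\<lambda>_. \<one>) d = \<zero>\<^bsub>?V\<^esub>" for d
      using c[OF that(1)] that(2) by simp
  qed simp_all
  have "dual_basis R ?V {()} (\<lambda>_. \<one>) (\<lambda>_. inv a)" using a by (simp add: dual_basis_def)
  from V.inner_product_spaceI[OF b this] show "inner_product_space R ?V" .
  show "has_gram R ?V {()} (\<lambda>_ _. a)"
    unfolding has_gram_def using b aR by (intro exI[of _ "\<lambda>_. \<one>"]) simp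
qed

lemma zero_space_gram:
  "inner_product_space R (zero_space R)" "has_gram R (zero_space R) {} G"
proof -
  let ?V = "zero_space R"
  have V [simp]: "carrier ?V = {()}" "form ?V = (\<lambda>_ _. \<zero>)"
    by (simp_all add: zero_space_def)
  have m: "module R ?V"
    by (rule moduleI) (auto simp: is_cring intro!: abelian_groupI)
  then interpret V: module R ?V .
  have "bilinear_map R ?V ?V (self_module R) (form ?V)"
    by (intro bilinear_mapI) simp_all
  then have f: "form_space R ?V"
    by (intro form_space.intro form_space_axioms.intro m) simp_all
  then interpret V: form_space R ?V .
  have b: "is_basis R ?V {} d" for d :: "'i \<Rightarrow> unit"
    by (rule V.is_basisI) simp_all
  have "dual_basis R ?V {} d d" for d :: "'i \<Rightarrow> unit" by (simp add: dual_basis_def)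
  from V.inner_product_spaceI[OF b this] show "inner_product_space R ?V" .
  show "has_gram R ?V {} G" unfolding has_gram_def using b by auto
qed

text \<open>On the empty index set the matrix is arbitrary, and so is the index type. Each use can
  therefore choose the one that fits its other operand.\<close>

lemma S_zero: "\<zero>\<^bsub>S\<^esub> = gram_class R {} G" "gram_class R {} G \<noteq> {}"
  using isometry_class_eq_gram_class[OF zero_space_gram] gram_class_nonempty[OF zero_space_gram]
  by (simp_all add: isometry_semiring_def)

lemma rank_one_class:
  assumes "a \<in> Units R"
  shows "isometry_class R (rank_one_space R a) = gram_class R {()} (\<lambda>_ _. a)" "gram_class R {()} (\<lambda>_ _. a) \<noteq> {}"
  using isometry_class_eq_gram_class[OF rank_one_space_gram[OF assms]]
    gram_class_nonempty[OF rank_one_space_gram[OF assms]] by simp_all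

lemma S_one: "\<one>\<^bsub>S\<^esub> = gram_class R {()} (\<lambda>_ _. \<one>)" "gram_class R {()} (\<lambda>_ _. \<one>) \<noteq> {}"
  using rank_one_class[OF Units_one_closed] by (simp_all add: isometry_semiring_def)

text \<open>By \<open>S_cases\<close> every element has a Gram matrix, since projective spaces over
  the local ring are free. Each law then becomes a bijection between index sets, built from
  \<open><+>\<close> and products, that carries one matrix to the other.\<close>

theorem comm_semiring_S: "comm_semiring S"
proof -
  have add_closed: "A \<oplus>\<^bsub>S\<^esub> B \<in> carrier S" if A: "A \<in> carrier S" and B: "B \<in> carrier S" for A B
  proof -
    obtain m :: nat and F where F: "A = gram_class R {..<m} F" "gram_class R {..<m} F \<noteq> {}" using S_cases[OF A] .
    obtain n :: nat and G where G: "B = gram_class R {..<n} G" "gram_class R {..<n} G \<noteq> {}" using S_cases[OF B] .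
    show ?thesis unfolding F(1) G(1) gram_class_add(1)[OF F(2) G(2)]
      by (rule gram_class_in_S[OF gram_class_add(2)[OF F(2) G(2)]])
  qed
  have mult_closed: "A \<otimes>\<^bsub>S\<^esub> B \<in> carrier S" if A: "A \<in> carrier S" and B: "B \<in> carrier S" for A B
  proof -
    obtain m :: nat and F where F: "A = gram_class R {..<m} F" "gram_class R {..<m} F \<noteq> {}" using S_cases[OF A] .
    obtain n :: nat and G where G: "B = gram_class R {..<n} G" "gram_class R {..<n} G \<noteq> {}" using S_cases[OF B] .
    show ?thesis unfolding F(1) G(1) gram_class_mult(1)[OF F(2) G(2)]
      by (rule gram_class_in_S[OF gram_class_mult(2)[OF F(2) G(2)]])
  qed
  have add_assoc: "(A \<oplus>\<^bsub>S\<^esub> B) \<oplus>\<^bsub>S\<^esub> C = A \<oplus>\<^bsub>S\<^esub> (B \<oplus>\<^bsub>S\<^esub> C)"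
    if A: "A \<in> carrier S" and B: "B \<in> carrier S" and C: "C \<in> carrier S" for A B C
  proof -
    obtain m :: nat and F where F: "A = gram_class R {..<m} F" "gram_class R {..<m} F \<noteq> {}" using S_cases[OF A] .
    obtain n :: nat and G where G: "B = gram_class R {..<n} G" "gram_class R {..<n} G \<noteq> {}" using S_cases[OF B] .
    obtain k :: nat and H where H: "C = gram_class R {..<k} H" "gram_class R {..<k} H \<noteq> {}" using S_cases[OF C] .
    let ?\<pi> = "case_sum (\<lambda>i. Inl (Inl i)) (case_sum (\<lambda>j. Inl (Inr j)) Inr)"
    have "bij_betw ?\<pi> ({..<m} <+> ({..<n} <+> {..<k})) (({..<m} <+> {..<n}) <+> {..<k})"
      by (rule bij_betw_byWitness[where f' = "case_sum (case_sum Inl (\<lambda>j. Inr (Inl j))) (\<lambda>l. Inr (Inr l))"]) auto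
    then have "gram_class R ({..<m} <+> ({..<n} <+> {..<k})) (gsum R F (gsum R G H)) =
      gram_class R (({..<m} <+> {..<n}) <+> {..<k}) (gsum R (gsum R F G) H)"
      by (rule gram_class_reindex) auto
    then show ?thesis
      unfolding F(1) G(1) H(1) gram_class_add(1)[OF F(2) G(2)] gram_class_add(1)[OF G(2) H(2)]
        gram_class_add(1)[OF gram_class_add(2)[OF F(2) G(2)] H(2)]
        gram_class_add(1)[OF F(2) gram_class_add(2)[OF G(2) H(2)]] by (rule sym)
  qed
  have add_comm: "A \<oplus>\<^bsub>S\<^esub> B = B \<oplus>\<^bsub>S\<^esub> A" if A: "A \<in> carrier S" and B: "B \<in> carrier S" for A B
  proof -
    obtain m :: nat and F where F: "A = gram_class R {..<m} F" "gram_class R {..<m} F \<noteq> {}" using S_cases[OF A] .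
    obtain n :: nat and G where G: "B = gram_class R {..<n} G" "gram_class R {..<n} G \<noteq> {}" using S_cases[OF B] .
    have "bij_betw (case_sum Inr Inl) ({..<m} <+> {..<n}) ({..<n} <+> {..<m})"
      by (rule bij_betw_byWitness[where f' = "case_sum Inr Inl"]) auto
    then have "gram_class R ({..<m} <+> {..<n}) (gsum R F G) = gram_class R ({..<n} <+> {..<m}) (gsum R G F)"
      by (rule gram_class_reindex) auto
    then show ?thesis
      unfolding F(1) G(1) gram_class_add(1)[OF F(2) G(2)] gram_class_add(1)[OF G(2) F(2)] .
  qed
  have add_zero: "\<zero>\<^bsub>S\<^esub> \<oplus>\<^bsub>S\<^esub> A = A" if A: "A \<in> carrier S" for A
  proof -
    obtain m :: nat and F where F: "A = gram_class R {..<m} F" "gram_class R {..<m} F \<noteq> {}" using S_cases[OF A] .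
    let ?Z = "\<lambda>(_ :: nat) (_ :: nat). \<zero>"
    have "bij_betw Inr {..<m} (({} :: nat set) <+> {..<m})" by (auto simp: bij_betw_def)
    then have "gram_class R {..<m} F = gram_class R ({} <+> {..<m}) (gsum R ?Z F)"
      by (rule gram_class_reindex) auto
    then show ?thesis
      unfolding F(1) S_zero(1)[of ?Z] gram_class_add(1)[OF S_zero(2)[of ?Z] F(2)] by (rule sym)
  qed
  have mult_assoc: "(A \<otimes>\<^bsub>S\<^esub> B) \<otimes>\<^bsub>S\<^esub> C = A \<otimes>\<^bsub>S\<^esub> (B \<otimes>\<^bsub>S\<^esub> C)"
    if A: "A \<in> carrier S" and B: "B \<in> carrier S" and C: "C \<in> carrier S" for A B C
  proof -
    obtain m :: nat and F where F: "A = gram_class R {..<m} F" "gram_class R {..<m} F \<noteq> {}" using S_cases[OF A] .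
    obtain n :: nat and G where G: "B = gram_class R {..<n} G" "gram_class R {..<n} G \<noteq> {}" using S_cases[OF B] .
    obtain k :: nat and H where H: "C = gram_class R {..<k} H" "gram_class R {..<k} H \<noteq> {}" using S_cases[OF C] .
    note c = gram_class_closed(1)[OF F(2)] gram_class_closed(1)[OF G(2)] gram_class_closed(1)[OF H(2)]
    have "bij_betw (\<lambda>p. ((fst p, fst (snd p)), snd (snd p))) ({..<m} \<times> ({..<n} \<times> {..<k})) (({..<m} \<times> {..<n}) \<times> {..<k})"
      by (rule bij_betw_byWitness[where f' = "\<lambda>p. (fst (fst p), (snd (fst p), snd p))"]) auto
    then have "gram_class R ({..<m} \<times> ({..<n} \<times> {..<k})) (kron R F (kron R G H)) =
      gram_class R (({..<m} \<times> {..<n}) \<times> {..<k}) (kron R (kron R F G) H)"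
      by (rule gram_class_reindex) (auto simp: m_assoc c)
    then show ?thesis
      unfolding F(1) G(1) H(1) gram_class_mult(1)[OF F(2) G(2)] gram_class_mult(1)[OF G(2) H(2)]
        gram_class_mult(1)[OF gram_class_mult(2)[OF F(2) G(2)] H(2)]
        gram_class_mult(1)[OF F(2) gram_class_mult(2)[OF G(2) H(2)]] by (rule sym)
  qed
  have mult_comm: "A \<otimes>\<^bsub>S\<^esub> B = B \<otimes>\<^bsub>S\<^esub> A" if A: "A \<in> carrier S" and B: "B \<in> carrier S" for A B
  proof -
    obtain m :: nat and F where F: "A = gram_class R {..<m} F" "gram_class R {..<m} F \<noteq> {}" using S_cases[OF A] .
    obtain n :: nat and G where G: "B = gram_class R {..<n} G" "gram_class R {..<n} G \<noteq> {}" using S_cases[OF B] .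
    note c = gram_class_closed(1)[OF F(2)] gram_class_closed(1)[OF G(2)]
    have "bij_betw prod.swap ({..<m} \<times> {..<n}) ({..<n} \<times> {..<m})"
      by (rule bij_betw_byWitness[where f' = prod.swap]) auto
    then have "gram_class R ({..<m} \<times> {..<n}) (kron R F G) = gram_class R ({..<n} \<times> {..<m}) (kron R G F)"
      by (rule gram_class_reindex) (auto simp: m_comm c)
    then show ?thesis
      unfolding F(1) G(1) gram_class_mult(1)[OF F(2) G(2)] gram_class_mult(1)[OF G(2) F(2)] .
  qed
  have mult_one: "\<one>\<^bsub>S\<^esub> \<otimes>\<^bsub>S\<^esub> A = A" if A: "A \<in> carrier S" for A
  proof -
    obtain m :: nat and F where F: "A = gram_class R {..<m} F" "gram_class R {..<m} F \<noteq> {}" using S_cases[OF A] .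
    note c = gram_class_closed(1)[OF F(2)]
    have "bij_betw (Pair ()) {..<m} ({()} \<times> {..<m})" by (auto simp: bij_betw_def inj_on_def)
    then have "gram_class R {..<m} F = gram_class R ({()} \<times> {..<m}) (kron R (\<lambda>_ _. \<one>) F)"
      by (rule gram_class_reindex) (auto simp: c)
    then show ?thesis
      unfolding F(1) S_one(1) gram_class_mult(1)[OF S_one(2) F(2)] by (rule sym)
  qed
  have distr: "(A \<oplus>\<^bsub>S\<^esub> B) \<otimes>\<^bsub>S\<^esub> C = A \<otimes>\<^bsub>S\<^esub> C \<oplus>\<^bsub>S\<^esub> B \<otimes>\<^bsub>S\<^esub> C"
    if A: "A \<in> carrier S" and B: "B \<in> carrier S" and C: "C \<in> carrier S" for A B C
  proof -
    obtain m :: nat and F where F: "A = gram_class R {..<m} F" "gram_class R {..<m} F \<noteq> {}" using S_cases[OF A] .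
    obtain n :: nat and G where G: "B = gram_class R {..<n} G" "gram_class R {..<n} G \<noteq> {}" using S_cases[OF B] .
    obtain k :: nat and H where H: "C = gram_class R {..<k} H" "gram_class R {..<k} H \<noteq> {}" using S_cases[OF C] .
    note c = gram_class_closed(1)[OF H(2)]
    have "bij_betw (case_sum (\<lambda>p. (Inl (fst p), snd p)) (\<lambda>p. (Inr (fst p), snd p)))
        (({..<m} \<times> {..<k}) <+> ({..<n} \<times> {..<k})) (({..<m} <+> {..<n}) \<times> {..<k})"
      by (rule bij_betw_byWitness[where f' = "\<lambda>p. case fst p of Inl i \<Rightarrow> Inl (i, snd p) | Inr j \<Rightarrow> Inr (j, snd p)"]) auto
    then have "gram_class R (({..<m} \<times> {..<k}) <+> ({..<n} \<times> {..<k})) (gsum R (kron R F H) (kron R G H)) =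
      gram_class R (({..<m} <+> {..<n}) \<times> {..<k}) (kron R (gsum R F G) H)"
      by (rule gram_class_reindex) (auto simp: c)
    then show ?thesis
      unfolding F(1) G(1) H(1) gram_class_add(1)[OF F(2) G(2)] gram_class_mult(1)[OF F(2) H(2)]
        gram_class_mult(1)[OF G(2) H(2)] gram_class_mult(1)[OF gram_class_add(2)[OF F(2) G(2)] H(2)]
        gram_class_add(1)[OF gram_class_mult(2)[OF F(2) H(2)] gram_class_mult(2)[OF G(2) H(2)]] by (rule sym)
  qed
  have null: "\<zero>\<^bsub>S\<^esub> \<otimes>\<^bsub>S\<^esub> A = \<zero>\<^bsub>S\<^esub>" if A: "A \<in> carrier S" for A
  proof -
    obtain m :: nat and F where F: "A = gram_class R {..<m} F" "gram_class R {..<m} F \<noteq> {}" using S_cases[OF A] .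
    let ?Z = "\<lambda>(_ :: nat) (_ :: nat). \<zero>"
    have "gram_class R ({} \<times> {..<m}) (kron R ?Z F) = \<zero>\<^bsub>S\<^esub>"
      using S_zero(1)[of "kron R ?Z F"] by simp
    then show ?thesis
      using gram_class_mult(1)[OF S_zero(2)[of ?Z] F(2)] unfolding F(1) S_zero(1)[of ?Z, symmetric] by simp
  qed
  have zero: "\<zero>\<^bsub>S\<^esub> \<in> carrier S"
    unfolding S_zero(1)[of "\<lambda>(_ :: nat) (_ :: nat). \<zero>"] by (rule gram_class_in_S[OF S_zero(2)])
  have one: "\<one>\<^bsub>S\<^esub> \<in> carrier S" unfolding S_one(1) by (rule gram_class_in_S[OF S_one(2)])
  have am: "abelian_monoid S"
    by (intro abelian_monoidI add_closed zero add_assoc add_zero add_comm)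
  have cm: "comm_monoid S"
    by (intro comm_monoidI mult_closed one mult_assoc mult_one mult_comm)
  have "semiring S"
  proof (intro semiring.intro semiring_axioms.intro am comm_monoid.axioms(1)[OF cm])
    show "C \<otimes>\<^bsub>S\<^esub> (A \<oplus>\<^bsub>S\<^esub> B) = C \<otimes>\<^bsub>S\<^esub> A \<oplus>\<^bsub>S\<^esub> C \<otimes>\<^bsub>S\<^esub> B"
      if "A \<in> carrier S" "B \<in> carrier S" "C \<in> carrier S" for A B C
      using distr[OF that] mult_comm[OF that(3) add_closed[OF that(1,2)]] mult_comm[OF that(3,1)] mult_comm[OF that(3,2)] by simp
    show "A \<otimes>\<^bsub>S\<^esub> \<zero>\<^bsub>S\<^esub> = \<zero>\<^bsub>S\<^esub>" if "A \<in> carrier S" for A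
      using null[OF that] mult_comm[OF that zero] by simp
  qed (fact distr null)+
  then show ?thesis by (intro comm_semiring.intro cm)
qed

end

subsection \<open>Diagonal forms\<close>

definition diag_gram :: "('a, 'r) ring_scheme \<Rightarrow> 'a list \<Rightarrow> nat \<Rightarrow> nat \<Rightarrow> 'a" where
  "diag_gram R as i j = (if i = j then as ! i else \<zero>\<^bsub>R\<^esub>)"

context form_space
begin

lemma orth_nth:
  assumes "orth fs" "i < length fs" "j < length fs" "i \<noteq> j"
  shows "form V (fs ! i) (fs ! j) = \<zero>"
proof -
  have s: "sorted_wrt (\<lambda>x y. form V x y = \<zero>) fs" "set fs \<subseteq> carrier V" using assms(1) by (simp_all add: orth_def)
  have c: "fs ! i \<in> carrier V" "fs ! j \<in> carrier V" using s(2) nth_mem assms(2,3) by blast+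
  show ?thesis
  proof (cases "i < j")
    case True
    then show ?thesis using sorted_wrt_nth_less[OF s(1) True assms(3)] by simp
  next
    case False
    then have "j < i" using assms(4) by simp
    then show ?thesis using sorted_wrt_nth_less[OF s(1) _ assms(2)] symmetric[OF c] by simp
  qed
qed

text \<open>Pairing a linear relation with the \<open>j\<close>-th vector leaves its
  \<open>j\<close>-th coefficient times a unit norm; this gives independence.\<close>

lemma has_gram_of_orth:
  assumes fs: "orth fs" "spn fs = carrier V"
  shows "has_gram R V {..<length fs} (diag_gram R (map (\<lambda>f. form V f f) fs))"
proof -
  let ?n = "length fs"
  interpret S: module R "self_module R" by (rule R.module_self_module)
  have fsV: "set fs \<subseteq> carrier V" using fs(1) by (rule orthD)
  have fsP: "nth fs \<in> {..<?n} \<rightarrow> carrier V" using fsV nth_mem[of _ fs] by (simp add: Pi_iff subset_iff)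
  have gram: "form V (fs ! i) (fs ! j) = diag_gram R (map (\<lambda>f. form V f f) fs) i j" if "i < ?n" "j < ?n" for i j
    using that orth_nth[OF fs(1) that] by (simp add: diag_gram_def)
  have "is_basis R V {..<?n} (nth fs)"
  proof (rule is_basisI[OF _ fsP])
    show "\<exists>c\<in>{..<?n} \<rightarrow> carrier R. x = comb V {..<?n} (nth fs) c" if "x \<in> carrier V" for x
      using spn_comb[OF fsV] that fs(2) by simp
    fix c assume c: "c \<in> {..<?n} \<rightarrow> carrier R" "comb V {..<?n} (nth fs) c = \<zero>\<^bsub>V\<^esub>"
    show "\<forall>i\<in>{..<?n}. c i = \<zero>"
    proof
      fix j assume j: "j \<in> {..<?n}"
      let ?u = "form V (fs ! j) (fs ! j)"
      have fj: "fs ! j \<in> carrier V" "?u \<in> Units R" using fs(1) j nth_mem[of j fs] orthD[OF fs(1)] by auto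
      then have uR: "?u \<in> carrier R" by simp
      have cj: "c j \<in> carrier R" using c(1) j by (simp add: Pi_iff)
      have "\<zero> = form V (fs ! j) (comb V {..<?n} (nth fs) c)" using c(2) fj by simp
      also have "\<dots> = comb (self_module R) {..<?n} (\<lambda>i. form V (fs ! j) (fs ! i)) c"
        by (rule linear_comb[OF R.module_self_module form_linear[OF fj(1)] finite_lessThan fsP c(1)])
      also have "\<dots> = comb (self_module R) {..<?n} c (\<lambda>i. ?u \<otimes> (if i = j then \<one> else \<zero>))"
        unfolding comb_def
      proof (rule S.finsum_cong'[OF refl])
        fix i assume i: "i \<in> {..<?n}"
        have "form V (fs ! j) (fs ! i) = (if i = j then ?u else \<zero>)"
          using orth_nth[OF fs(1), of j i] i j by simp
        then show "c i \<odot>\<^bsub>self_module R\<^esub> form V (fs ! j) (fs ! i) =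
            (?u \<otimes> (if i = j then \<one> else \<zero>)) \<odot>\<^bsub>self_module R\<^esub> c i"
          using c(1) i uR R.m_comm[of "c i" ?u] by (cases "i = j") (simp_all add: Pi_iff)
      qed (use c(1) uR in \<open>simp add: Pi_iff\<close>)
      also have "\<dots> = ?u \<otimes> c j"
        using S.comb_smult(1)[of "{..<?n}" c "\<lambda>i. if i = j then \<one> else \<zero>" ?u] S.comb_delta[of "{..<?n}" c j] c(1) j uR
        by (simp add: Pi_iff)
      finally have "c j \<otimes> ?u = \<zero>" using R.m_comm[of "c j" ?u] cj uR by simp
      then show "c j = \<zero>" using unit_mult_zero[OF fj(2) cj] by simp
    qed
  qed simp
  then show ?thesis unfolding has_gram_def using gram by (intro exI[of _ "nth fs"]) simp
qed

lemma spn_of_basis: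
  assumes b: "is_basis R V {..<n::nat} b"
  shows "set (map b [0..<n]) \<subseteq> carrier V" "spn (map b [0..<n]) = carrier V"
proof -
  show bV: "set (map b [0..<n]) \<subseteq> carrier V" using basisD(3)[OF b] by auto
  have "x \<in> spn (map b [0..<n])" if x: "x \<in> carrier V" for x
    using comb_in_lspan[OF R.oneideal bV _ coord_Pi[OF b x], of b] comb_coord[OF b x] by simp
  then show "spn (map b [0..<n]) = carrier V" using spn_closed[OF bV] by blast
qed

lemma orth_of_has_gram:
  assumes "has_gram R V {..<length as} (diag_gram R as)" "set as \<subseteq> Units R"
  obtains fs where "orth fs" "spn fs = carrier V" "map (\<lambda>f. form V f f) fs = as"
proof -
  obtain b where b: "is_basis R V {..<length as} b"
    "\<forall>i\<in>{..<length as}. \<forall>j\<in>{..<length as}. form V (b i) (b j) = diag_gram R as i j"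
    using assms(1) by (auto simp: has_gram_def)
  let ?fs = "map b [0..<length as]"
  have "map (\<lambda>f. form V f f) ?fs = as" using b(2) by (intro nth_equalityI) (simp_all add: diag_gram_def)
  moreover have "orth ?fs"
    using spn_of_basis(1)[OF b(1)] b(2) assms(2) nth_mem[of _ as]
    by (auto simp: orth_def diag_gram_def sorted_wrt_iff_nth_less subset_iff)
  ultimately show ?thesis using that spn_of_basis(2)[OF b(1)] by blast
qed

end

context local_ring
begin

definition dclass :: "'a list \<Rightarrow> ('a, nat \<Rightarrow> 'a) form_module set" where
  "dclass as = gram_class R {..<length as} (diag_gram R as)"

definition rk :: "'a \<Rightarrow> ('a, nat \<Rightarrow> 'a) form_module set" where
  "rk a = isometry_class R (rank_one_space R a)"

sublocale S: comm_semiring "isometry_semiring R" by (rule comm_semiring_S)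

lemma rk_closed: "a \<in> Units R \<Longrightarrow> rk a \<in> carrier S"
  unfolding rk_def rank_one_class by (rule gram_class_in_S[OF rank_one_class(2)])

lemma dclass_Nil: "dclass [] = \<zero>\<^bsub>S\<^esub>"
  unfolding S_zero(1)[of "diag_gram R []"] by (simp add: dclass_def)

lemma dclass_Cons:
  assumes "a \<in> Units R" "dclass as \<noteq> {}"
  shows "dclass (a # as) = rk a \<oplus>\<^bsub>S\<^esub> dclass as" "dclass (a # as) \<noteq> {}"
proof -
  note n = rank_one_class(2)[OF assms(1)] assms(2)[unfolded dclass_def]
  have "bij_betw (case_nat (Inl ()) Inr) {..<Suc (length as)} ({()} <+> {..<length as})"
    by (rule bij_betw_byWitness[where f' = "case_sum (\<lambda>_. 0) Suc"]) (auto split: nat.splits)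
  then have "gram_class R {..<Suc (length as)} (diag_gram R (a # as)) =
      gram_class R ({()} <+> {..<length as}) (gsum R (\<lambda>_ _. a) (diag_gram R as))"
    by (rule gram_class_reindex) (auto simp: diag_gram_def split: nat.splits)
  then have e: "dclass (a # as) = gram_class R ({()} <+> {..<length as}) (gsum R (\<lambda>_ _. a) (diag_gram R as))"
    by (simp add: dclass_def)
  show "dclass (a # as) \<noteq> {}" unfolding e by (rule gram_class_add(2)[OF n])
  have "rk a \<oplus>\<^bsub>S\<^esub> dclass as = gram_class R ({()} <+> {..<length as}) (gsum R (\<lambda>_ _. a) (diag_gram R as))"
    unfolding rk_def rank_one_class(1)[OF assms(1)] dclass_def by (rule gram_class_add(1)[OF n])
  then show "dclass (a # as) = rk a \<oplus>\<^bsub>S\<^esub> dclass as" using e by (rule trans[OF _ sym, rotated])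
qed

lemma dclass_nonempty: "set as \<subseteq> Units R \<Longrightarrow> dclass as \<noteq> {}"
proof (induction as)
  case Nil
  show ?case unfolding dclass_def using S_zero(2)[of "diag_gram R []"] by simp
next
  case (Cons a as)
  then show ?case using dclass_Cons(2)[of a as] by simp
qed

lemma dclass_closed: "set as \<subseteq> Units R \<Longrightarrow> dclass as \<in> carrier S"
  unfolding dclass_def using gram_class_in_S dclass_nonempty dclass_def by metis

lemma dclass_append:
  assumes "set as \<subseteq> Units R" "set bs \<subseteq> Units R"
  shows "dclass (as @ bs) = dclass as \<oplus>\<^bsub>S\<^esub> dclass bs"
  using assms(1)
proof (induction as)
  case Nil
  then show ?case using dclass_closed[OF assms(2)] by (simp add: dclass_Nil)
next
  case (Cons a as)
  have U: "a \<in> Units R" "set as \<subseteq> Units R" "set (as @ bs) \<subseteq> Units R" using Cons.prems assms(2) by auto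
  show ?case
    using Cons.IH[OF U(2)] dclass_Cons(1)[OF U(1) dclass_nonempty[OF U(2)]]
      dclass_Cons(1)[OF U(1) dclass_nonempty[OF U(3)]]
      rk_closed[OF U(1)] dclass_closed[OF U(2)] dclass_closed[OF assms(2)]
    by (simp add: S.a_assoc)
qed

lemma dclass_single: "a \<in> Units R \<Longrightarrow> dclass [a] = rk a"
  using dclass_Cons(1)[of a "[]"] dclass_nonempty[of "[]"] rk_closed by (simp add: dclass_Nil)

lemma rk_mult:
  assumes "a \<in> Units R" "b \<in> Units R"
  shows "rk a \<otimes>\<^bsub>S\<^esub> rk b = rk (a \<otimes> b)"
proof -
  have ab: "a \<otimes> b \<in> Units R" using assms by simp
  have "bij_betw (\<lambda>_. ((), ())) {()} ({()} \<times> {()})" by (simp add: bij_betw_def)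
  then have "gram_class R {()} (\<lambda>_ _. a \<otimes> b) = gram_class R ({()} \<times> {()}) (kron R (\<lambda>_ _. a) (\<lambda>_ _. b))"
    by (rule gram_class_reindex) simp
  then show ?thesis
    unfolding rk_def rank_one_class(1)[OF assms(1)] rank_one_class(1)[OF assms(2)] rank_one_class(1)[OF ab]
      gram_class_mult(1)[OF rank_one_class(2)[OF assms(1)] rank_one_class(2)[OF assms(2)]] by (rule sym)
qed

lemma dclass_mult_rk:
  assumes "set as \<subseteq> Units R" "u \<in> Units R"
  shows "dclass as \<otimes>\<^bsub>S\<^esub> rk u = dclass (map (\<lambda>a. a \<otimes> u) as)"
  using assms(1)
proof (induction as)
  case Nil
  then show ?case using rk_closed[OF assms(2)] by (simp add: dclass_Nil)
next
  case (Cons a as)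
  have U: "a \<in> Units R" "set as \<subseteq> Units R" "a \<otimes> u \<in> Units R" "set (map (\<lambda>a. a \<otimes> u) as) \<subseteq> Units R"
    using Cons.prems assms(2) by auto
  show ?case
    using Cons.IH[OF U(2)] dclass_Cons(1)[OF U(1) dclass_nonempty[OF U(2)]]
      dclass_Cons(1)[OF U(3) dclass_nonempty[OF U(4)]] rk_mult[OF U(1) assms(2)]
      rk_closed[OF U(1)] dclass_closed[OF U(2)] rk_closed[OF assms(2)]
    by (simp add: S.l_distr)
qed

text \<open>Turns a change of orthogonal basis inside one representative \<open>U\<close> into an
  identity between diagonal classes.\<close>

lemma dclass_eq_of_orth:
  assumes U: "U \<in> dclass as"
    and fs: "form_space.orth R U fs" "module.lspan U (carrier R) fs = carrier U"
  shows "dclass as = dclass (map (\<lambda>f. form U f f) fs)"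
proof -
  note u = gram_classD[OF U[unfolded dclass_def]]
  interpret U: form_space R U by (rule u(2))
  show ?thesis
    using isometry_class_eq_gram_class[OF u(1,4)] isometry_class_eq_gram_class[OF u(1) U.has_gram_of_orth[OF fs]]
    by (simp add: dclass_def)
qed

text \<open>A single vector of unit norm is the seed from which \<open>ex_orth_basis\<close> grows
  an orthogonal basis. Its frame condition comes from a dual basis: the coordinates of
  \<open>x\<close> are its products with the \<open>h i\<close>.\<close>

lemma diagonalizable:
  fixes U :: "('a, nat \<Rightarrow> 'a) form_module"
  assumes U: "inner_product_space R U" and u: "u \<in> carrier U" "form U u u \<in> Units R"
  obtains as where "set as \<subseteq> Units R" "isometry_class R U = dclass as"
proof -
  interpret U: inner_product_space R U by fact
  interpret U: form_space R U by (rule U.form_space)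
  interpret U: local_form \<mm> R U ..
  obtain n :: nat and b where b: "is_basis R U {..<n} b"
    using projective_imp_free[OF U.module_axioms U.finitely_generated U.projective] .
  obtain h where h: "dual_basis R U {..<n} b h" using U.ex_dual_basis[OF b] .
  let ?gs = "map b [0..<n]"
  note gs = U.spn_of_basis[OF b]
  have frame: "x \<in> U.lspan \<mm> ?gs" if x: "x \<in> carrier U" "\<forall>y\<in>carrier U. form U y x \<in> \<mm>" for x
  proof -
    have "coord R U {..<n} b x \<in> {..<n} \<rightarrow> \<mm>"
      using U.coord_eq_form[OF b h _ x(1)] h x(2) by (simp add: Pi_iff dual_basis_def)
    from U.comb_in_lspan[OF ideal_axioms gs(1) _ this, of b] show ?thesis using U.comb_coord[OF b x(1)] by simp
  qed
  have ug: "set ([u] @ ?gs) \<subseteq> carrier U" using u gs(1) by simp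
  have "carrier U \<subseteq> U.spn ([u] @ ?gs)" using U.spn_mono[of ?gs "[u] @ ?gs"] ug gs(2) by auto
  then have sp: "U.spn ([u] @ ?gs) = carrier U" using U.spn_closed[OF ug] by blast
  have "U.orth [u]" using u by (simp add: U.orth_Cons)
  from U.ex_orth_basis[OF gs(1) frame this _ gs(1) sp] obtain fs where fs: "U.orth fs" "U.spn fs = carrier U"
    by blast
  have "set (map (\<lambda>f. form U f f) fs) \<subseteq> Units R" using U.orthD(2)[OF fs(1)] by auto
  moreover have "isometry_class R U = dclass (map (\<lambda>f. form U f f) fs)"
    using isometry_class_eq_gram_class[OF U U.has_gram_of_orth[OF fs]] by (simp add: dclass_def)
  ultimately show ?thesis by (rule that)
qed

text \<open>In residue characteristic 2 a space may have only non-unit norms, such as the plane with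
  form \<open>x1 y2 + x2 y1\<close>, and then it has no orthogonal basis. The summand
  \<open>\<langle>1\<rangle>\<close> supplies the vector of unit norm, and in \<open>GW R\<close> it
  can be subtracted again.\<close>

lemma add_rk_one_diagonalizable:
  assumes A: "A \<in> carrier S"
  obtains as where "set as \<subseteq> Units R" "A \<oplus>\<^bsub>S\<^esub> rk \<one> = dclass as"
proof -
  obtain m :: nat and F where F: "A = gram_class R {..<m} F" "gram_class R {..<m} F \<noteq> {}" using S_cases[OF A] .
  note one = rank_one_class[OF Units_one_closed]
  let ?I = "{..<m} <+> {()}" and ?G = "gsum R F (\<lambda>_ _. \<one>)"
  have e: "A \<oplus>\<^bsub>S\<^esub> rk \<one> = gram_class R ?I ?G"
    unfolding rk_def F(1) one(1) by (rule gram_class_add(1)[OF F(2) one(2)])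
  obtain U where "U \<in> gram_class R ?I ?G" using gram_class_add(2)[OF F(2) one(2)] by blast
  note U = gram_classD[OF this]
  obtain b where b: "is_basis R U ?I b" "\<forall>i\<in>?I. \<forall>j\<in>?I. form U (b i) (b j) = ?G i j"
    using U(4) by (auto simp: has_gram_def)
  have "b (Inr ()) \<in> carrier U" by (rule module.basisD(3)[OF U(3) b(1) InrI[OF singletonI]])
  moreover have "form U (b (Inr ())) (b (Inr ())) = \<one>" using b(2) by (simp add: ball_Plus)
  ultimately obtain as where "set as \<subseteq> Units R" "isometry_class R U = dclass as"
    using diagonalizable[OF U(1)] by (metis Units_one_closed)
  then show ?thesis using that isometry_class_eq_gram_class[OF U(1,4)] e by simp
qed

end

text \<open>Both lists are the norms of orthogonal bases of one common representative
  \<open>U\<close>, to which \<open>cls_unique\<close> applies.\<close>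

lemma (in diagonal_invariant) sum_eq_of_dclass_eq:
  assumes "set as \<subseteq> Units R" "set bs \<subseteq> Units R" "dclass as = dclass bs"
  shows "(\<Sum>a\<leftarrow>as. c a) = (\<Sum>b\<leftarrow>bs. c b)"
proof -
  obtain U where U: "U \<in> dclass as" using dclass_nonempty[OF assms(1)] by blast
  then have Ub: "U \<in> dclass bs" using assms(3) by simp
  note a = gram_classD[OF U[unfolded dclass_def]] and b = gram_classD[OF Ub[unfolded dclass_def]]
  interpret U: form_space R U by (rule a(2))
  interpret U: diagonal_form \<mm> R c U ..
  obtain fs where fs: "U.orth fs" "U.spn fs = carrier U" "map (\<lambda>f. form U f f) fs = as"
    using U.orth_of_has_gram[OF a(4) assms(1)] .
  obtain gs where gs: "U.orth gs" "U.spn gs = carrier U" "map (\<lambda>f. form U f f) gs = bs"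
    using U.orth_of_has_gram[OF b(4) assms(2)] .
  have "U.cls fs = U.cls gs" using U.cls_unique[OF fs(1) gs(1)] fs(2) gs(2) by simp
  then show ?thesis by (simp add: U.cls_def fs(3)[symmetric] gs(3)[symmetric] comp_def)
qed

section \<open>Relations (1) and (3) hold between classes of rank one spaces\<close>

context local_ring
begin

context
  assumes res: "\<exists>y\<in>Units R. y \<ominus> \<one> \<in> Units R"
begin

text \<open>The base changes are proved in a locale that carries some invariant \<open>c\<close>.
  With the constant 0 for \<open>c\<close> their geometric content becomes available for proving the
  relations themselves, without circularity.\<close>

lemma trivial_invariant: "diagonal_invariant \<mm> R (\<lambda>_. 0 :: nat)"
  using res by unfold_locales auto

lemma rk_square:
  assumes a: "a \<in> Units R" and b: "b \<in> Units R"
  shows "rk (a \<otimes> a \<otimes> b) = rk b"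
proof -
  have sb: "set [b] \<subseteq> Units R" using b by simp
  obtain U where U: "U \<in> dclass [b]" using dclass_nonempty[OF sb] by blast
  note g = gram_classD[OF U[unfolded dclass_def]]
  interpret U: form_space R U by (rule g(2))
  interpret c: diagonal_invariant \<mm> R "\<lambda>_. 0 :: nat" by (rule trivial_invariant)
  interpret U: diagonal_form \<mm> R "\<lambda>_. 0 :: nat" U ..
  obtain fs where fs: "U.orth fs" "U.spn fs = carrier U" "map (\<lambda>f. form U f f) fs = [b]"
    using U.orth_of_has_gram[OF g(4) sb] .
  then obtain v where v: "fs = [v]" "form U v v = b" by (cases fs) auto
  have vU: "v \<in> carrier U" using fs(1) v by (simp add: U.orth_Cons)
  have e: "U.eqv [v] [a \<odot>\<^bsub>U\<^esub> v]" using U.eqv_scale[OF _ a] fs(1) v by simp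
  then have "dclass [b] = dclass (map (\<lambda>f. form U f f) [a \<odot>\<^bsub>U\<^esub> v])"
    using fs(2) v(1) by (intro dclass_eq_of_orth[OF U]) (auto simp: U.eqv_def)
  moreover have "form U (a \<odot>\<^bsub>U\<^esub> v) (a \<odot>\<^bsub>U\<^esub> v) = a \<otimes> a \<otimes> b"
    using vU a b v(2) by (simp add: U.form_lin m_assoc Units_closed)
  ultimately show ?thesis using dclass_single a b by simp
qed

text \<open>The base change \<open>eqv_pair\<close> with \<open>x = 1\<close>, read as two
  orthogonal bases of one plane.\<close>

lemma rk_add:
  assumes a: "a \<in> Units R" and b: "b \<in> Units R" and ab: "a \<oplus> b \<in> Units R"
  shows "rk a \<oplus>\<^bsub>S\<^esub> rk b = rk (a \<oplus> b) \<oplus>\<^bsub>S\<^esub> rk ((a \<oplus> b) \<otimes> a \<otimes> b)"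
proof -
  have sb: "set [a, b] \<subseteq> Units R" using a b by simp
  obtain U where U: "U \<in> dclass [a, b]" using dclass_nonempty[OF sb] by blast
  note g = gram_classD[OF U[unfolded dclass_def]]
  interpret U: form_space R U by (rule g(2))
  interpret c: diagonal_invariant \<mm> R "\<lambda>_. 0 :: nat" by (rule trivial_invariant)
  interpret U: diagonal_form \<mm> R "\<lambda>_. 0 :: nat" U ..
  obtain fs where fs: "U.orth fs" "U.spn fs = carrier U" "map (\<lambda>f. form U f f) fs = [a, b]"
    using U.orth_of_has_gram[OF g(4) sb] .
  then obtain v w where v: "fs = [v, w]" "form U v v = a" "form U w w = b"
    by (cases fs; cases "tl fs") auto
  have vw: "U.orth [v, w]" using fs(1) v(1) by simp
  then have c: "v \<in> carrier U" "w \<in> carrier U" "form U v w = \<zero>" by (simp_all add: U.orth_Cons)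
  have n: "form U (v \<oplus>\<^bsub>U\<^esub> \<one> \<odot>\<^bsub>U\<^esub> w) (v \<oplus>\<^bsub>U\<^esub> \<one> \<odot>\<^bsub>U\<^esub> w) = a \<oplus> b"
    using U.form_add_orth[OF c(1-3), of \<one>] a b v by (simp add: Units_closed)
  let ?p = "v \<oplus>\<^bsub>U\<^esub> \<one> \<odot>\<^bsub>U\<^esub> w" and ?q = "(\<ominus> (form U w w \<otimes> \<one>)) \<odot>\<^bsub>U\<^esub> v \<oplus>\<^bsub>U\<^esub> form U v v \<odot>\<^bsub>U\<^esub> w"
  note pr = U.eqv_pair[OF vw one_closed, unfolded n, OF ab]
  have "dclass [a, b] = dclass (map (\<lambda>f. form U f f) [?p, ?q])"
    using pr(1) fs(2) v(1) by (intro dclass_eq_of_orth[OF U]) (auto simp: U.eqv_def)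
  also have "map (\<lambda>f. form U f f) [?p, ?q] = [a \<oplus> b, (a \<oplus> b) \<otimes> a \<otimes> b]"
    using n pr(3) v by simp
  finally have e: "dclass ([a] @ [b]) = dclass ([a \<oplus> b] @ [(a \<oplus> b) \<otimes> a \<otimes> b])" by simp
  have u: "(a \<oplus> b) \<otimes> a \<otimes> b \<in> Units R" using a b ab by simp
  show ?thesis
    using e dclass_append[of "[a]" "[b]"] dclass_append[of "[a \<oplus> b]" "[(a \<oplus> b) \<otimes> a \<otimes> b]"] a b ab u
    by (simp add: dclass_single)
qed

end

end

subsection \<open>The residue field\<close>

text \<open>If every unit were congruent to 1, the quotient would have just the two classes of 0 and
  1. Then also \<open>1 + 1\<close> lies in \<open>\<mm>\<close>, since as a unit it would be
  congruent to 1 and put 1 into \<open>\<mm>\<close>.\<close>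

lemma (in local_ring) ex_unit_minus_one_unit:
  assumes "\<not> (R Quot \<mm> \<simeq> residue_ring 2)"
  shows "\<exists>y\<in>Units R. y \<ominus> \<one> \<in> Units R"
proof (rule ccontr)
  assume "\<not> ?thesis"
  then have n: "y \<ominus> \<one> \<in> \<mm>" if "y \<in> Units R" for y using that by (intro nonunit) auto
  have one: "\<one> \<notin> \<mm>" using Units_iff[of \<one>] by simp
  have coset: "\<mm> +> x = (if x \<in> \<mm> then \<mm> else \<mm> +> \<one>)" if x: "x \<in> carrier R" for x
  proof (cases "x \<in> \<mm>")
    case True
    then show ?thesis using a_coset_join2[OF x a_subgroup] by simp
  next
    case False
    then have "x \<ominus> \<one> \<in> \<mm>" using n x by (simp add: Units_iff)
    then have "\<mm> +> x = \<mm> +> \<one>" using quotient_eq_iff_same_a_r_cos[OF ideal_axioms x one_closed] by simp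
    then show ?thesis using False by simp
  qed
  have "\<mm> +> \<one> \<noteq> \<mm>"
  proof
    assume "\<mm> +> \<one> = \<mm>"
    then have "\<one> \<in> \<mm>" using a_rcos_self[OF one_closed] by simp
    then show False using one by simp
  qed
  note ne = this
  have carr: "carrier (R Quot \<mm>) = {\<mm>, \<mm> +> \<one>}"
  proof
    show "carrier (R Quot \<mm>) \<subseteq> {\<mm>, \<mm> +> \<one>}"
    proof
      fix w assume "w \<in> carrier (R Quot \<mm>)"
      then obtain x where x: "x \<in> carrier R" "w = \<mm> +> x" unfolding FactRing_simps by auto
      show "w \<in> {\<mm>, \<mm> +> \<one>}" using coset[OF x(1)] x(2) by (cases "x \<in> \<mm>") simp_all
    qed
    have "\<mm> +> \<zero> = \<mm>" by (rule a_coset_join2[OF _ a_subgroup]) (simp_all add: additive_subgroup.zero_closed[OF additive_subgroup_axioms])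
    then have "\<mm> \<in> carrier (R Quot \<mm>)"
      unfolding FactRing_simps by (auto intro!: bexI[of _ \<zero>])
    moreover have "\<mm> +> \<one> \<in> carrier (R Quot \<mm>)" unfolding FactRing_simps by auto
    ultimately show "{\<mm>, \<mm> +> \<one>} \<subseteq> carrier (R Quot \<mm>)" by simp
  qed
  interpret Q: cring "R Quot \<mm>" by (rule quotient_is_cring[OF is_cring])
  have z: "\<zero>\<^bsub>R Quot \<mm>\<^esub> = \<mm>" and o: "\<one>\<^bsub>R Quot \<mm>\<^esub> = \<mm> +> \<one>" by (simp_all add: FactRing_def)
  let ?h = "\<lambda>w. if w = \<mm> then 0 else 1 :: int"
  have oo: "(\<mm> +> \<one>) \<oplus>\<^bsub>R Quot \<mm>\<^esub> (\<mm> +> \<one>) = \<mm>"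
  proof -
    have "(\<mm> +> \<one>) \<oplus>\<^bsub>R Quot \<mm>\<^esub> (\<mm> +> \<one>) = \<mm> +> (\<one> \<oplus> \<one>)"
      by (simp add: FactRing_def a_rcos_sum)
    moreover have "\<one> \<oplus> \<one> \<in> \<mm>"
    proof (rule ccontr)
      assume "\<one> \<oplus> \<one> \<notin> \<mm>"
      then have "(\<one> \<oplus> \<one>) \<ominus> \<one> \<in> \<mm>" using n by (simp add: Units_iff)
      moreover have "(\<one> \<oplus> \<one>) \<ominus> \<one> = \<one>" using one_closed by algebra
      ultimately show False using one by simp
    qed
    ultimately show ?thesis using coset[of "\<one> \<oplus> \<one>"] by simp
  qed
  have "?h \<in> ring_hom (R Quot \<mm>) (residue_ring 2)"
  proof (rule ring_hom_memI)
    fix w u assume "w \<in> carrier (R Quot \<mm>)" "u \<in> carrier (R Quot \<mm>)"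
    then have wu: "w = \<zero>\<^bsub>R Quot \<mm>\<^esub> \<or> w = \<one>\<^bsub>R Quot \<mm>\<^esub>" "u = \<zero>\<^bsub>R Quot \<mm>\<^esub> \<or> u = \<one>\<^bsub>R Quot \<mm>\<^esub>"
      unfolding carr z o by auto
    have h: "?h \<zero>\<^bsub>R Quot \<mm>\<^esub> = 0" "?h \<one>\<^bsub>R Quot \<mm>\<^esub> = 1" using ne by (simp_all add: z o)
    have oo': "\<one>\<^bsub>R Quot \<mm>\<^esub> \<oplus>\<^bsub>R Quot \<mm>\<^esub> \<one>\<^bsub>R Quot \<mm>\<^esub> = \<zero>\<^bsub>R Quot \<mm>\<^esub>" using oo by (simp add: z o)
    show "?h (w \<otimes>\<^bsub>R Quot \<mm>\<^esub> u) = ?h w \<otimes>\<^bsub>residue_ring 2\<^esub> ?h u"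
      using wu h by (elim disjE) (simp_all only: Q.l_one Q.l_null Q.r_null Q.one_closed Q.zero_closed h, simp_all add: residue_ring_def)
    show "?h (w \<oplus>\<^bsub>R Quot \<mm>\<^esub> u) = ?h w \<oplus>\<^bsub>residue_ring 2\<^esub> ?h u"
      using wu h by (elim disjE) (simp_all only: Q.l_zero Q.r_zero Q.one_closed Q.zero_closed oo' h, simp_all add: residue_ring_def)
  qed (use ne in \<open>auto simp: residue_ring_def o\<close>)
  moreover have "bij_betw ?h (carrier (R Quot \<mm>)) (carrier (residue_ring 2))"
    unfolding carr using ne by (auto simp: bij_betw_def residue_ring_def)
  ultimately have "?h \<in> ring_iso (R Quot \<mm>) (residue_ring 2)" by (simp add: ring_iso_def)
  then show False using assms unfolding is_ring_iso_def by blast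
qed

subsection \<open>The Witt ring\<close>

lemma (in cring) mem_principal_genideal:
  assumes "h \<in> carrier R"
  shows "x \<in> Idl {h} \<longleftrightarrow> (\<exists>y\<in>carrier R. x = y \<otimes> h)"
  unfolding cgenideal_eq_genideal[OF assms, symmetric] cgenideal_def by blast

context local_ring
begin

sublocale GW: cring "GW R"
  unfolding GW_def by (rule S.cring_grothendieck_ring)

abbreviation gw :: "'a list \<Rightarrow> 'a list \<Rightarrow> 'a gw" where
  "gw as bs \<equiv> formal_difference S (dclass as) (dclass bs)"

lemma gw_closed: "\<lbrakk>set as \<subseteq> Units R; set bs \<subseteq> Units R\<rbrakk> \<Longrightarrow> gw as bs \<in> carrier (GW R)"
  unfolding GW_def by (intro S.fd_closed dclass_closed)

lemma gw_add:
  "\<lbrakk>set as \<subseteq> Units R; set bs \<subseteq> Units R; set cs \<subseteq> Units R; set ds \<subseteq> Units R\<rbrakk>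
    \<Longrightarrow> gw as bs \<oplus>\<^bsub>GW R\<^esub> gw cs ds = gw (as @ cs) (bs @ ds)"
  unfolding GW_def by (simp add: S.add_fd dclass_closed dclass_append)

lemma GW_class_eq: "a \<in> Units R \<Longrightarrow> GW_class R a = gw [a] []"
  by (simp add: GW_class_def dclass_single dclass_Nil rk_def)

text \<open>Equality of formal differences holds only after adding some \<open>K\<close>. Adding
  \<open>\<langle>1\<rangle>\<close> as well makes that term diagonal, so the equation involves
  diagonal classes only.\<close>

lemma gw_eqD:
  assumes "set as \<subseteq> Units R" "set bs \<subseteq> Units R" "set cs \<subseteq> Units R" "set ds \<subseteq> Units R"
    and "gw as bs = gw cs ds"
  obtains ks where "set ks \<subseteq> Units R" "dclass (as @ ds @ ks) = dclass (cs @ bs @ ks)"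
proof -
  note cl = dclass_closed[OF assms(1)] dclass_closed[OF assms(2)] dclass_closed[OF assms(3)] dclass_closed[OF assms(4)]
  obtain K where K: "K \<in> carrier S" "dclass as \<oplus>\<^bsub>S\<^esub> dclass ds \<oplus>\<^bsub>S\<^esub> K = dclass cs \<oplus>\<^bsub>S\<^esub> dclass bs \<oplus>\<^bsub>S\<^esub> K"
    using assms(5) S.fd_eq_iff[OF cl] by blast
  obtain ks where ks: "set ks \<subseteq> Units R" "K \<oplus>\<^bsub>S\<^esub> rk \<one> = dclass ks" using add_rk_one_diagonalizable[OF K(1)] .
  have one: "rk \<one> \<in> carrier S" by (simp add: rk_closed)
  have "dclass as \<oplus>\<^bsub>S\<^esub> dclass ds \<oplus>\<^bsub>S\<^esub> (K \<oplus>\<^bsub>S\<^esub> rk \<one>) = dclass cs \<oplus>\<^bsub>S\<^esub> dclass bs \<oplus>\<^bsub>S\<^esub> (K \<oplus>\<^bsub>S\<^esub> rk \<one>)"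
    using K one cl by (simp add: S.a_assoc[symmetric])
  then have "dclass (as @ ds @ ks) = dclass (cs @ bs @ ks)"
    using assms(1-4) ks cl dclass_closed[OF ks(1)] by (simp add: dclass_append S.a_assoc)
  then show ?thesis using that ks by blast
qed

text \<open>Adding \<open>\<langle>1\<rangle>\<close> to both terms of a formal difference leaves it
  unchanged and makes both terms diagonal.\<close>

lemma gw_cases:
  assumes "x \<in> carrier (GW R)"
  obtains as bs where "set as \<subseteq> Units R" "set bs \<subseteq> Units R" "x = gw as bs"
proof -
  obtain A B where AB: "A \<in> carrier S" "B \<in> carrier S" "x = formal_difference S A B"
    using S.fd_cases assms unfolding GW_def by metis
  obtain as where as: "set as \<subseteq> Units R" "A \<oplus>\<^bsub>S\<^esub> rk \<one> = dclass as" using add_rk_one_diagonalizable[OF AB(1)] .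
  obtain bs where bs: "set bs \<subseteq> Units R" "B \<oplus>\<^bsub>S\<^esub> rk \<one> = dclass bs" using add_rk_one_diagonalizable[OF AB(2)] .
  have one: "rk \<one> \<in> carrier S" by (simp add: rk_closed)
  have "A \<oplus>\<^bsub>S\<^esub> dclass bs = dclass as \<oplus>\<^bsub>S\<^esub> B"
    unfolding as(2)[symmetric] bs(2)[symmetric] using AB one by (simp add: S.a_ac)
  then have "x = gw as bs" unfolding AB(3)
    by (intro S.fd_eqI AB dclass_closed as bs)
  then show ?thesis using that as bs by blast
qed

lemma gw_mult_hyperbolic:
  assumes as: "set as \<subseteq> Units R" and bs: "set bs \<subseteq> Units R"
  shows "gw as bs \<otimes>\<^bsub>GW R\<^esub> gw [\<one>, \<ominus> \<one>] [] =
    gw (as @ map (\<lambda>a. \<ominus> a) as) (bs @ map (\<lambda>a. \<ominus> a) bs)"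
proof -
  have U: "\<one> \<in> Units R" "\<ominus> \<one> \<in> Units R" by (simp_all add: Units_minus)
  have H: "dclass [\<one>, \<ominus> \<one>] = rk \<one> \<oplus>\<^bsub>S\<^esub> rk (\<ominus> \<one>)"
    using dclass_append[of "[\<one>]" "[\<ominus> \<one>]"] U by (simp add: dclass_single)
  have "dclass cs \<otimes>\<^bsub>S\<^esub> dclass [\<one>, \<ominus> \<one>] = dclass (cs @ map (\<lambda>a. \<ominus> a) cs)" if cs: "set cs \<subseteq> Units R" for cs
  proof -
    have m: "map (\<lambda>a. a \<otimes> \<one>) cs = cs" "map (\<lambda>a. a \<otimes> \<ominus> \<one>) cs = map (\<lambda>a. \<ominus> a) cs"
      using cs by (auto intro!: map_idI simp: r_minus Units_closed subset_iff)
    have neg: "set (map (\<lambda>a. \<ominus> a) cs) \<subseteq> Units R" using cs by (auto simp: Units_minus)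
    show ?thesis
      using dclass_mult_rk[OF cs U(1)] dclass_mult_rk[OF cs U(2)] dclass_append[OF cs neg]
        dclass_closed[OF cs] rk_closed[OF U(1)] rk_closed[OF U(2)] unfolding m H
      by (simp add: S.r_distr)
  qed
  note this[OF as] this[OF bs]
  moreover have "set (as @ map (\<lambda>a. \<ominus> a) as) \<subseteq> Units R" "set (bs @ map (\<lambda>a. \<ominus> a) bs) \<subseteq> Units R" "set [\<one>, \<ominus> \<one>] \<subseteq> Units R"
    using as bs U by (auto simp: Units_minus)
  ultimately show ?thesis
    unfolding GW_def using dclass_closed as bs
    by (simp add: S.mult_fd dclass_Nil del: map_append)
qed

lemma hyperbolic_class: "GW_class R \<one> \<oplus>\<^bsub>GW R\<^esub> GW_class R (\<ominus> \<one>) = gw [\<one>, \<ominus> \<one>] []"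
  using gw_add[of "[\<one>]" "[]" "[\<ominus> \<one>]" "[]"] by (simp add: GW_class_eq Units_minus)

text \<open>A multiple of \<open>h\<close> by a diagonal class is a sum of terms
  \<open>\<langle>a\<rangle> + \<langle>-a\<rangle>\<close>. So the ideal generated by
  \<open>h\<close> is, as an additive group, generated by the left sides of relation (2), although
  it is defined through multiplication.\<close>

lemma mem_hyperbolic_ideal:
  "x \<in> hyperbolic_ideal R \<longleftrightarrow> (\<exists>as bs. set as \<subseteq> Units R \<and> set bs \<subseteq> Units R \<and>
    x = gw (as @ map (\<lambda>a. \<ominus> a) as) (bs @ map (\<lambda>a. \<ominus> a) bs))"
proof -
  have h: "gw [\<one>, \<ominus> \<one>] [] \<in> carrier (GW R)" by (rule gw_closed) (simp_all add: Units_minus)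
  show ?thesis
    unfolding hyperbolic_ideal_def hyperbolic_class GW.mem_principal_genideal[OF h]
  proof
    assume "\<exists>y\<in>carrier (GW R). x = y \<otimes>\<^bsub>GW R\<^esub> gw [\<one>, \<ominus> \<one>] []"
    then obtain y where y: "y \<in> carrier (GW R)" "x = y \<otimes>\<^bsub>GW R\<^esub> gw [\<one>, \<ominus> \<one>] []" by blast
    obtain as bs where ab: "set as \<subseteq> Units R" "set bs \<subseteq> Units R" "y = gw as bs" using gw_cases[OF y(1)] .
    show "\<exists>as bs. set as \<subseteq> Units R \<and> set bs \<subseteq> Units R \<and>
        x = gw (as @ map (\<lambda>a. \<ominus> a) as) (bs @ map (\<lambda>a. \<ominus> a) bs)"
      using ab(1,2) gw_mult_hyperbolic[OF ab(1,2)] unfolding y(2) ab(3) by blast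
  next
    assume "\<exists>as bs. set as \<subseteq> Units R \<and> set bs \<subseteq> Units R \<and>
        x = gw (as @ map (\<lambda>a. \<ominus> a) as) (bs @ map (\<lambda>a. \<ominus> a) bs)"
    then obtain as bs where ab: "set as \<subseteq> Units R" "set bs \<subseteq> Units R"
      "x = gw (as @ map (\<lambda>a. \<ominus> a) as) (bs @ map (\<lambda>a. \<ominus> a) bs)" by blast
    show "\<exists>y\<in>carrier (GW R). x = y \<otimes>\<^bsub>GW R\<^esub> gw [\<one>, \<ominus> \<one>] []"
      unfolding ab(3) gw_mult_hyperbolic[OF ab(1,2), symmetric] using gw_closed[OF ab(1,2)] by blast
  qed
qed

sublocale hyp: ideal "hyperbolic_ideal R" "GW R"
  unfolding hyperbolic_ideal_def hyperbolic_class
  by (rule GW.genideal_ideal) (simp add: gw_closed Units_minus)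

sublocale Witt: cring "Witt_ring R"
  unfolding Witt_ring_def by (rule hyp.quotient_is_cring[OF GW.is_cring])

lemma Witt_quotient_map: "(\<lambda>x. hyperbolic_ideal R +>\<^bsub>GW R\<^esub> x) \<in> ring_hom (GW R) (Witt_ring R)"
  unfolding Witt_ring_def by (rule hyp.rcos_ring_hom)

lemma Witt_quotient_zero:
  assumes "x \<in> carrier (GW R)"
  shows "hyperbolic_ideal R +>\<^bsub>GW R\<^esub> x = \<zero>\<^bsub>Witt_ring R\<^esub> \<longleftrightarrow> x \<in> hyperbolic_ideal R"
proof -
  have "\<zero>\<^bsub>Witt_ring R\<^esub> = hyperbolic_ideal R" by (simp add: Witt_ring_def FactRing_def)
  then show ?thesis
    using hyp.a_rcos_self[OF assms] GW.a_coset_join2[OF assms hyp.a_subgroup] by metis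
qed

lemma Witt_carrier:
  "w \<in> carrier (Witt_ring R) \<longleftrightarrow> (\<exists>x\<in>carrier (GW R). w = hyperbolic_ideal R +>\<^bsub>GW R\<^esub> x)"
  unfolding Witt_ring_def FactRing_simps by auto

end

subsection \<open>The presentation\<close>

abbreviation frag_sum :: "'a list \<Rightarrow> 'a \<Rightarrow>\<^sub>0 int" where "frag_sum as \<equiv> (\<Sum>a\<leftarrow>as. frag_of a)"

lemma keys_frag_sum: "Poly_Mapping.keys (frag_sum as) \<subseteq> set as"
proof (induction as)
  case (Cons a as)
  have "Poly_Mapping.keys (frag_of a + frag_sum as) \<subseteq> Poly_Mapping.keys (frag_of a) \<union> Poly_Mapping.keys (frag_sum as)"
    by (rule keys_add)
  then show ?case using Cons by auto
qed simp

lemma ex_frag_sum_diff: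
  assumes "Poly_Mapping.keys x \<subseteq> U"
  shows "\<exists>as bs. set as \<subseteq> U \<and> set bs \<subseteq> U \<and> x = frag_sum as - frag_sum bs"
  using assms
proof (rule free_Abelian_group_induct)
  show "\<exists>as bs. set as \<subseteq> U \<and> set bs \<subseteq> U \<and> 0 = frag_sum as - frag_sum bs"
    by (intro exI[of _ "[]"]) simp
next
  fix x y
  assume "\<exists>as bs. set as \<subseteq> U \<and> set bs \<subseteq> U \<and> x = frag_sum as - frag_sum bs"
    and "\<exists>as bs. set as \<subseteq> U \<and> set bs \<subseteq> U \<and> y = frag_sum as - frag_sum bs"
  then obtain as bs cs ds where "set as \<subseteq> U" "set bs \<subseteq> U" "x = frag_sum as - frag_sum bs"
    "set cs \<subseteq> U" "set ds \<subseteq> U" "y = frag_sum cs - frag_sum ds" by blast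
  then show "\<exists>as bs. set as \<subseteq> U \<and> set bs \<subseteq> U \<and> x - y = frag_sum as - frag_sum bs"
    by (intro exI[of _ "as @ ds"] exI[of _ "bs @ cs"]) simp
next
  fix a assume "a \<in> U"
  then show "\<exists>as bs. set as \<subseteq> U \<and> set bs \<subseteq> U \<and> frag_of a = frag_sum as - frag_sum bs"
    by (intro exI[of _ "[a]"] exI[of _ "[]"]) simp
qed

section \<open>Completeness of the relations\<close>

context local_ring
begin

context
  fixes N :: "('a \<Rightarrow>\<^sub>0 int) set"
  assumes zero: "0 \<in> N" and add: "\<And>x y. \<lbrakk>x \<in> N; y \<in> N\<rbrakk> \<Longrightarrow> x + y \<in> N"
    and minus: "\<And>x. x \<in> N \<Longrightarrow> - x \<in> N"
    and rel_square: "\<And>a b. \<lbrakk>a \<in> Units R; b \<in> Units R\<rbrakk> \<Longrightarrow> frag_of (a \<otimes> a \<otimes> b) - frag_of b \<in> N"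
    and rel_add: "\<And>a b. \<lbrakk>a \<in> Units R; b \<in> Units R; a \<oplus> b \<in> Units R\<rbrakk> \<Longrightarrow>
      frag_of a + frag_of b - (frag_of (a \<oplus> b) + frag_of ((a \<oplus> b) \<otimes> a \<otimes> b)) \<in> N"
    and residue: "\<exists>y\<in>Units R. y \<ominus> \<one> \<in> Units R"
begin

text \<open>A coset of \<open>N\<close> as a bare set, so that elementwise addition makes it a value
  of the type class that \<open>diagonal_invariant\<close> requires. In that monoid the zero is
  \<open>{0}\<close>, not \<open>N\<close>.\<close>

definition coset_of :: "('a \<Rightarrow>\<^sub>0 int) \<Rightarrow> ('a \<Rightarrow>\<^sub>0 int) set" where "coset_of k = {x. x - k \<in> N}"

lemma coset_of_add: "coset_of k + coset_of l = coset_of (k + l)"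
proof
  show "coset_of k + coset_of l \<subseteq> coset_of (k + l)"
  proof
    fix x assume "x \<in> coset_of k + coset_of l"
    then obtain u v where "x = u + v" "u - k \<in> N" "v - l \<in> N" by (auto simp: set_plus_def coset_of_def)
    then show "x \<in> coset_of (k + l)" using add[of "u - k" "v - l"] by (simp add: coset_of_def algebra_simps)
  qed
  show "coset_of (k + l) \<subseteq> coset_of k + coset_of l"
  proof
    fix x assume "x \<in> coset_of (k + l)"
    then have "x - l \<in> coset_of k" "l \<in> coset_of l" using zero by (simp_all add: coset_of_def algebra_simps)
    then have "(x - l) + l \<in> coset_of k + coset_of l" by (rule set_plus_intro)
    then show "x \<in> coset_of k + coset_of l" by simp
  qed
qed

lemma coset_of_eq_iff: "coset_of k = coset_of l \<longleftrightarrow> k - l \<in> N"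
proof
  assume "coset_of k = coset_of l"
  moreover have "k \<in> coset_of k" using zero by (simp add: coset_of_def)
  ultimately show "k - l \<in> N" by (simp add: coset_of_def)
next
  assume kl: "k - l \<in> N"
  have "x - k \<in> N \<longleftrightarrow> x - l \<in> N" for x
    using add[of "x - k" "k - l"] add[of "x - l" "- (k - l)"] kl minus[of "k - l"] by auto
  then show "coset_of k = coset_of l" by (simp add: coset_of_def)
qed

lemma diagonal_invariant_coset_of: "diagonal_invariant \<mm> R (\<lambda>a. coset_of (frag_of a))"
proof
  fix a b assume "a \<in> Units R" "b \<in> Units R"
  then show "coset_of (frag_of (a \<otimes> a \<otimes> b)) = coset_of (frag_of b)" by (simp add: coset_of_eq_iff rel_square)
next
  fix a b assume "a \<in> Units R" "b \<in> Units R" "a \<oplus> b \<in> Units R"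
  then show "coset_of (frag_of a) + coset_of (frag_of b) = coset_of (frag_of (a \<oplus> b)) + coset_of (frag_of ((a \<oplus> b) \<otimes> a \<otimes> b))"
    unfolding coset_of_add coset_of_eq_iff by (rule rel_add)
next
  fix a b a' b' d
  assume "coset_of (frag_of a) + coset_of (frag_of b) + coset_of (frag_of d) = coset_of (frag_of a') + coset_of (frag_of b') + coset_of (frag_of d)"
  then show "coset_of (frag_of a) + coset_of (frag_of b) = coset_of (frag_of a') + coset_of (frag_of b')"
    unfolding coset_of_add coset_of_eq_iff by (simp add: algebra_simps)
qed (rule residue)

text \<open>Stated as membership rather than as an equation with
  \<open>coset_of (frag_sum as)\<close>, because the sum over the empty list is \<open>{0}\<close>,
  which may be smaller than \<open>N\<close>.\<close>

lemma frag_sum_mem: "frag_sum as \<in> (\<Sum>a\<leftarrow>as. coset_of (frag_of a))"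
proof (induction as)
  case (Cons a as)
  have "frag_of a \<in> coset_of (frag_of a)" using zero by (simp add: coset_of_def)
  then show ?case using Cons by (simp add: set_plus_intro)
qed simp

lemma mem_sum_coset_of: "x \<in> (\<Sum>a\<leftarrow>as. coset_of (frag_of a)) \<Longrightarrow> x - frag_sum as \<in> N"
proof (induction as arbitrary: x)
  case Nil
  then show ?case using zero by simp
next
  case (Cons a as)
  then obtain u v where "x = u + v" "u - frag_of a \<in> N" "v \<in> (\<Sum>a\<leftarrow>as. coset_of (frag_of a))"
    by (auto simp: set_plus_def coset_of_def)
  then show ?case using add[of "u - frag_of a" "v - frag_sum as"] Cons.IH[of v] by (simp add: algebra_simps)
qed

lemma frag_sum_diff_mem:
  assumes "set as \<subseteq> Units R" "set bs \<subseteq> Units R" "dclass as = dclass bs"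
  shows "frag_sum as - frag_sum bs \<in> N"
proof -
  interpret diagonal_invariant \<mm> R "\<lambda>a. coset_of (frag_of a)" by (rule diagonal_invariant_coset_of)
  have "frag_sum as \<in> (\<Sum>a\<leftarrow>bs. coset_of (frag_of a))"
    using frag_sum_mem[of as] sum_eq_of_dclass_eq[OF assms] by simp
  then show ?thesis by (rule mem_sum_coset_of)
qed

text \<open>Clearing formal differences turns membership in the ideal into an equality of two
  diagonal classes, hence into an element of \<open>N\<close>. The lists \<open>?d vs\<close> and
  \<open>?d ws\<close> contribute elements of \<open>N\<close> by (2), and \<open>ks\<close> cancels
  in the free abelian group.\<close>

lemma frag_sum_diff_mem_of_gw:
  assumes rel_hyp: "\<And>a. a \<in> Units R \<Longrightarrow> frag_of a + frag_of (\<ominus> a) \<in> N"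
    and U: "set as \<subseteq> Units R" "set bs \<subseteq> Units R" and gw: "gw as bs \<in> hyperbolic_ideal R"
  shows "frag_sum as - frag_sum bs \<in> N"
proof -
  let ?d = "\<lambda>vs. vs @ map (\<lambda>a. \<ominus> a) vs"
  have hyp: "frag_sum (?d vs) \<in> N" if "set vs \<subseteq> Units R" for vs
    using that
  proof (induction vs)
    case Nil
    then show ?case using zero by simp
  next
    case (Cons v vs)
    then show ?case using add[OF rel_hyp[of v], of "frag_sum (?d vs)"] by (simp add: algebra_simps)
  qed
  have dU: "set (?d vs) \<subseteq> Units R" if "set vs \<subseteq> Units R" for vs using that by (auto simp: Units_minus)
  obtain vs ws where vw: "set vs \<subseteq> Units R" "set ws \<subseteq> Units R" "gw as bs = gw (?d vs) (?d ws)"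
    using gw unfolding mem_hyperbolic_ideal by blast
  obtain ks where ks: "set ks \<subseteq> Units R" "dclass (as @ ?d ws @ ks) = dclass (?d vs @ bs @ ks)"
    using gw_eqD[OF U dU[OF vw(1)] dU[OF vw(2)] vw(3)] .
  have "frag_sum (as @ ?d ws @ ks) - frag_sum (?d vs @ bs @ ks) \<in> N"
    by (rule frag_sum_diff_mem[OF _ _ ks(2)]) (use U dU[OF vw(1)] dU[OF vw(2)] ks(1) in auto)
  from add[OF this add[OF hyp[OF vw(1)] minus[OF hyp[OF vw(2)]]]]
  show ?thesis by (simp add: algebra_simps)
qed

end

section \<open>The homomorphism from the free abelian group to the Witt ring\<close>

lemma Witt_class_eq: "a \<in> Units R \<Longrightarrow> Witt_class R a = hyperbolic_ideal R +>\<^bsub>GW R\<^esub> gw [a] []"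
  by (simp add: Witt_class_def GW_class_eq)

lemma Witt_class_closed: "a \<in> Units R \<Longrightarrow> Witt_class R a \<in> carrier (Witt_ring R)"
  unfolding Witt_carrier using gw_closed[of "[a]" "[]"] Witt_class_eq by auto

text \<open>Lists are handled by induction from the values on generators. The difference follows by
  adding the image of \<open>gw bs []\<close> to both sides and cancelling it in the Witt
  ring.\<close>

lemma hom_frag_sum_diff:
  assumes \<phi>: "\<phi> \<in> hom (free_Abelian_group (Units R)) (add_monoid (Witt_ring R))"
    "\<And>a. a \<in> Units R \<Longrightarrow> \<phi> (frag_of a) = Witt_class R a"
    and U: "set as \<subseteq> Units R" "set bs \<subseteq> Units R"
  shows "\<phi> (frag_sum as - frag_sum bs) = hyperbolic_ideal R +>\<^bsub>GW R\<^esub> gw as bs"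
proof -
  let ?F = "free_Abelian_group (Units R)" and ?q = "\<lambda>x. hyperbolic_ideal R +>\<^bsub>GW R\<^esub> x"
  interpret h: group_hom ?F "add_monoid (Witt_ring R)" \<phi>
    by (intro group_hom.intro group_free_Abelian_group Witt.a_group group_hom_axioms.intro \<phi>(1))
  have hom: "\<phi> (x + y) = \<phi> x \<oplus>\<^bsub>Witt_ring R\<^esub> \<phi> y"
    if "Poly_Mapping.keys x \<subseteq> Units R" "Poly_Mapping.keys y \<subseteq> Units R" for x y
    using h.hom_mult[of x y] that by simp
  have q_add: "?q (x \<oplus>\<^bsub>GW R\<^esub> y) = ?q x \<oplus>\<^bsub>Witt_ring R\<^esub> ?q y" if "x \<in> carrier (GW R)" "y \<in> carrier (GW R)" for x y
    using ring_hom_add[OF Witt_quotient_map that] .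
  have q_closed: "?q x \<in> carrier (Witt_ring R)" if "x \<in> carrier (GW R)" for x
    using ring_hom_closed[OF Witt_quotient_map that] .
  have keys: "Poly_Mapping.keys (frag_sum cs) \<subseteq> Units R" if "set cs \<subseteq> Units R" for cs
    using keys_frag_sum[of cs] that by blast
  have sum: "\<phi> (frag_sum cs) = ?q (gw cs [])" if "set cs \<subseteq> Units R" for cs
    using that
  proof (induction cs)
    case Nil
    have "gw [] [] = \<zero>\<^bsub>GW R\<^esub>" by (simp add: GW_def S.grothendieck_consts dclass_Nil)
    moreover have "?q \<zero>\<^bsub>GW R\<^esub> = \<zero>\<^bsub>Witt_ring R\<^esub>"
      using Witt_quotient_zero[OF GW.zero_closed] hyp.zero_closed by simp
    ultimately show ?case using h.hom_one by simp
  next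
    case (Cons c cs)
    have c: "c \<in> Units R" "set cs \<subseteq> Units R" "set [c] \<subseteq> Units R" using Cons.prems by auto
    have "\<phi> (frag_sum (c # cs)) = ?q (gw [c] []) \<oplus>\<^bsub>Witt_ring R\<^esub> ?q (gw cs [])"
      using hom[of "frag_of c" "frag_sum cs"] keys[OF c(2)] c(1) Cons.IH[OF c(2)] \<phi>(2)[OF c(1)]
      by (simp add: Witt_class_eq)
    also have "\<dots> = ?q (gw (c # cs) [])"
      using q_add[of "gw [c] []" "gw cs []"] gw_closed[of "[c]" "[]"] gw_closed[of cs "[]"]
        gw_add[of "[c]" "[]" cs "[]"] c by simp
    finally show ?case .
  qed
  have "gw as bs \<oplus>\<^bsub>GW R\<^esub> gw bs [] = gw as []"
  proof -
    have "gw (as @ bs) bs = gw as []"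
      by (rule S.fd_eqI) (use U dclass_closed dclass_append in \<open>simp_all add: dclass_Nil\<close>)
    then show ?thesis using gw_add[OF U U(2), of "[]"] by simp
  qed
  then have e1: "?q (gw as bs) \<oplus>\<^bsub>Witt_ring R\<^esub> ?q (gw bs []) = ?q (gw as [])"
    using q_add[OF gw_closed[OF U] gw_closed[OF U(2), of "[]"]] by simp
  have e2: "\<phi> (frag_sum as - frag_sum bs) \<oplus>\<^bsub>Witt_ring R\<^esub> ?q (gw bs []) = ?q (gw as [])"
  proof -
    have k: "Poly_Mapping.keys (frag_sum as - frag_sum bs) \<subseteq> Units R"
      using keys_diff[of "frag_sum as" "frag_sum bs"] keys[OF U(1)] keys[OF U(2)] by blast
    then show ?thesis using hom[OF k keys[OF U(2)]] sum[OF U(1)] sum[OF U(2)] by simp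
  qed
  have closed: "\<phi> (frag_sum as - frag_sum bs) \<in> carrier (Witt_ring R)"
  proof -
    have "Poly_Mapping.keys (frag_sum as - frag_sum bs) \<subseteq> Units R"
      using keys_diff[of "frag_sum as" "frag_sum bs"] keys[OF U(1)] keys[OF U(2)] by blast
    then show ?thesis using h.hom_closed by simp
  qed
  have "x = y" if "x \<oplus>\<^bsub>Witt_ring R\<^esub> z = y \<oplus>\<^bsub>Witt_ring R\<^esub> z"
    "x \<in> carrier (Witt_ring R)" "y \<in> carrier (Witt_ring R)" "z \<in> carrier (Witt_ring R)" for x y z
    using that Witt.add.right_cancel[of z x y] by simp
  from this[OF trans[OF e2 e1[symmetric]] closed q_closed[OF gw_closed[OF U]] q_closed[OF gw_closed[OF U(2)]]]
  show ?thesis by simp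
qed

end

theorem corollary1p5:
  fixes R :: "('a, 'r) ring_scheme" (structure) and \<mm> :: "'a set"
  assumes "local_ring \<mm> R"
    and "\<not> (R Quot \<mm> \<simeq> residue_ring 2)"
  shows "abelian_presentation (add_monoid (Witt_ring R)) (Units R) (Witt_class R)
    ({frag_of (a \<otimes> a \<otimes> b) - frag_of b | a b. a \<in> Units R \<and> b \<in> Units R} \<union>
     {frag_of a + frag_of (\<ominus> a) | a. a \<in> Units R} \<union>
     {frag_of a + frag_of b - (frag_of (a \<oplus> b) + frag_of ((a \<oplus> b) \<otimes> a \<otimes> b)) | a b.
        a \<in> Units R \<and> b \<in> Units R \<and> a \<oplus> b \<in> Units R})"
    (is "abelian_presentation ?W ?U _ ?Rels")
proof -
  interpret local_ring \<mm> R by fact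
  have residue: "\<exists>y\<in>Units R. y \<ominus> \<one> \<in> Units R" by (rule ex_unit_minus_one_unit[OF assms(2)])
  let ?F = "free_Abelian_group ?U" and ?q = "\<lambda>x. hyperbolic_ideal R +>\<^bsub>GW R\<^esub> x"
  interpret F: group ?F by simp
  have W: "comm_group ?W" by (rule Witt.a_comm_group)
  \<comment> \<open>All three kinds of relators are written as differences of two lists, so that
    \<open>hom_frag_sum_diff\<close> computes their images. Relations (1) and (3) hold already
    between isometry classes, relation (2) only modulo the ideal.\<close>
  have pres: "x \<in> ?Rels \<Longrightarrow> \<exists>as bs. set as \<subseteq> ?U \<and> set bs \<subseteq> ?U \<and> x = frag_sum as - frag_sum bs \<and>
      (dclass as = dclass bs \<or> gw as bs \<in> hyperbolic_ideal R)" for x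
  proof (elim UnE CollectE exE conjE)
    fix a b assume x: "x = frag_of (a \<otimes> a \<otimes> b) - frag_of b" and ab: "a \<in> ?U" "b \<in> ?U"
    show ?thesis
      by (rule exI[of _ "[a \<otimes> a \<otimes> b]"], rule exI[of _ "[b]"])
        (use x ab rk_square[OF residue ab] in \<open>simp add: dclass_single\<close>)
  next
    fix a assume x: "x = frag_of a + frag_of (\<ominus> a)" and a: "a \<in> ?U"
    have "gw ([a] @ map (\<lambda>a. \<ominus> a) [a]) ([] @ map (\<lambda>a. \<ominus> a) []) \<in> hyperbolic_ideal R"
      unfolding mem_hyperbolic_ideal using a by (intro exI[of _ "[a]"] exI[of _ "[]"]) simp
    then show ?thesis
      by (intro exI[of _ "[a, \<ominus> a]"] exI[of _ "[]"]) (use x a in \<open>simp add: Units_minus\<close>)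
  next
    fix a b assume x: "x = frag_of a + frag_of b - (frag_of (a \<oplus> b) + frag_of ((a \<oplus> b) \<otimes> a \<otimes> b))"
      and ab: "a \<in> ?U" "b \<in> ?U" "a \<oplus> b \<in> ?U"
    have "dclass [a, b] = dclass [a \<oplus> b, (a \<oplus> b) \<otimes> a \<otimes> b]"
      using rk_add[OF residue ab] dclass_append[of "[a]" "[b]"]
        dclass_append[of "[a \<oplus> b]" "[(a \<oplus> b) \<otimes> a \<otimes> b]"] ab by (simp add: dclass_single)
    then show ?thesis
      by (intro exI[of _ "[a, b]"] exI[of _ "[a \<oplus> b, (a \<oplus> b) \<otimes> a \<otimes> b]"]) (use x ab in simp)
  qed
  have Rels: "?Rels \<subseteq> carrier ?F"
  proof
    fix x assume "x \<in> ?Rels"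
    from pres[OF this] obtain as bs where ab: "set as \<subseteq> ?U" "set bs \<subseteq> ?U" "x = frag_sum as - frag_sum bs" by blast
    have "Poly_Mapping.keys x \<subseteq> set as \<union> set bs"
      using keys_diff[of "frag_sum as" "frag_sum bs"] keys_frag_sum[of as] keys_frag_sum[of bs] ab(3) by blast
    then show "x \<in> carrier ?F" using ab(1,2) by auto
  qed
  let ?N = "generate ?F ?Rels"
  have N: "subgroup ?N ?F" by (rule F.generate_is_subgroup[OF Rels])
  obtain \<phi> where \<phi>: "\<phi> \<in> hom ?F ?W" "\<And>a. a \<in> ?U \<Longrightarrow> \<phi> (frag_of a) = Witt_class R a"
    using comm_group.free_Abelian_group_universal[OF W, of "Witt_class R" ?U] Witt_class_closed by auto
  have \<phi>_diff: "\<phi> (frag_sum as - frag_sum bs) = ?q (gw as bs)" if "set as \<subseteq> ?U" "set bs \<subseteq> ?U" for as bs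
    by (rule hom_frag_sum_diff[OF \<phi>(1) _ that]) (rule \<phi>(2))
  interpret h: group_hom ?F ?W \<phi>
    by (intro group_hom.intro group_free_Abelian_group Witt.a_group group_hom_axioms.intro \<phi>(1))
  have "carrier ?W \<subseteq> \<phi> ` carrier ?F"
  proof
    fix w assume "w \<in> carrier ?W"
    then obtain x where x: "x \<in> carrier (GW R)" "w = ?q x" using Witt_carrier by auto
    obtain as bs where ab: "set as \<subseteq> ?U" "set bs \<subseteq> ?U" "x = gw as bs" using gw_cases[OF x(1)] .
    have "w = \<phi> (frag_sum as - frag_sum bs)" using \<phi>_diff[OF ab(1,2)] x(2) ab(3) by simp
    moreover have "Poly_Mapping.keys (frag_sum as - frag_sum bs) \<subseteq> ?U"
      using keys_diff[of "frag_sum as" "frag_sum bs"] keys_frag_sum[of as] keys_frag_sum[of bs] ab(1,2) by blast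
    ultimately show "w \<in> \<phi> ` carrier ?F" by auto
  qed
  then have surj: "\<phi> ` carrier ?F = carrier ?W" using h.hom_closed by blast
  have "?Rels \<subseteq> kernel ?F ?W \<phi>"
  proof
    fix x assume x: "x \<in> ?Rels"
    from pres[OF this] obtain as bs where ab: "set as \<subseteq> ?U" "set bs \<subseteq> ?U" "x = frag_sum as - frag_sum bs"
      "dclass as = dclass bs \<or> gw as bs \<in> hyperbolic_ideal R" by blast
    have "gw as bs \<in> hyperbolic_ideal R"
    proof (cases "dclass as = dclass bs")
      case True
      have "gw as bs = gw [] []"
        by (rule S.fd_eqI) (use ab dclass_closed True in \<open>simp_all add: dclass_Nil\<close>)
      then have "gw as bs = \<zero>\<^bsub>GW R\<^esub>" by (simp add: GW_def S.grothendieck_consts dclass_Nil)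
      then show ?thesis using hyp.zero_closed by simp
    qed (use ab(4) in simp)
    then have "\<phi> x = \<one>\<^bsub>?W\<^esub>"
      using \<phi>_diff[OF ab(1,2)] Witt_quotient_zero[OF gw_closed[OF ab(1,2)]] ab(3) by simp
    moreover have "x \<in> carrier ?F" using x Rels by (rule subsetD[rotated])
    ultimately show "x \<in> kernel ?F ?W \<phi>" unfolding kernel_def by (intro CollectI conjI)
  qed
  then have le: "?N \<subseteq> kernel ?F ?W \<phi>" by (rule F.generate_subgroup_incl[OF _ h.subgroup_kernel])
  \<comment> \<open>This inclusion carries the content of the theorem: the abstract \<open>N\<close>
    is now the subgroup generated by the relators, so its cosets are the invariant to which
    uniqueness of orthogonal bases was applied.\<close>
  have ge: "kernel ?F ?W \<phi> \<subseteq> ?N"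
  proof
    fix x assume "x \<in> kernel ?F ?W \<phi>"
    then have x: "Poly_Mapping.keys x \<subseteq> ?U" "\<phi> x = \<zero>\<^bsub>Witt_ring R\<^esub>" by (auto simp: kernel_def)
    obtain as bs where ab: "set as \<subseteq> ?U" "set bs \<subseteq> ?U" "x = frag_sum as - frag_sum bs"
      using ex_frag_sum_diff[OF x(1)] by blast
    have gw: "gw as bs \<in> hyperbolic_ideal R"
      using x(2) \<phi>_diff[OF ab(1,2)] Witt_quotient_zero[OF gw_closed[OF ab(1,2)]] ab(3) by simp
    have inc: "r \<in> ?N" if "r \<in> ?Rels" for r using that by (rule generate.incl)
    have "frag_sum as - frag_sum bs \<in> ?N"
    proof (rule frag_sum_diff_mem_of_gw[OF _ _ _ _ _ residue _ ab(1,2) gw])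
      show "0 \<in> ?N" using subgroup.one_closed[OF N] unfolding one_free_Abelian_group .
      show "x + y \<in> ?N" if "x \<in> ?N" "y \<in> ?N" for x y
        using subgroup.m_closed[OF N that] unfolding mult_free_Abelian_group .
      show "- x \<in> ?N" if "x \<in> ?N" for x
        using subgroup.m_inv_closed[OF N that] subgroup.mem_carrier[OF N that]
        unfolding carrier_free_Abelian_group_iff by (simp only: inv_free_Abelian_group)
    qed (rule inc, blast)+
    then show "x \<in> ?N" using ab(3) by simp
  qed
  show ?thesis
    unfolding abelian_presentation_def
    by (intro conjI bexI[of _ \<phi>] ballI W Rels \<phi> surj subset_antisym le ge)
qed

end
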